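(* Let $E/\mathbb{Q}$ be a Serre curve and let $m \geq 2$ be a positive integer. Let $\Delta'_E$ denote the squarefree part of the discriminant of $E$, let $m_E$ denote the adelic level of $E$, and let $v_2(\cdot)$ denote the $2$-adic valuation. Suppose one of the following cases holds: \begin{itemize} \item $m_E \nmid m$; \item $m_E \mid m$, $\Delta'_E \equiv 3 \pmod 4$, and $v_2(m) = 2$; \item $m_E \mid m$, $\Delta'_E \equiv 2 \pmod 4$, and $v_2(m) \in \{3,4\}$. \end{itemize} Then $C_E^{m\text{-div}} = C^{m\text{-div}}$. Otherwise, write $m = m_1m_2$ with $m_1 = \gcd(m,m_E^\infty)$ and $\gcd(m_2,m_E) = 1$. Then $$C_E^{m\text{-div}} = \left(C^{m_1\text{-div}} + \prod_{\ell^\alpha \parallel m_1} \frac{-\ell^{2\alpha-1}}{|\mathrm{GL}_2(\mathbb{Z}/\ell^\alpha\mathbb{Z})|}\right) \cdot C^{m_2\text{-div}}.$$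
   Context: For an elliptic curve $E/\mathbb{Q}$ of conductor $N_E$, given by $Y^2=X^3+aX+b$ with $a,b\in\mathbb{Z}$ and $\Delta_E=-16(4a^3+27b^2)\ne 0$, let $\rho_E:\mathrm{Gal}(\overline{\mathbb{Q}}/\mathbb{Q})\to \mathrm{GL}_2(\widehat{\mathbb{Z}})$ be the adelic Galois representation given by the action on all torsion points (after a choice of basis of the Tate module), $G_E$ its image, and $G_E(n)\subseteq \mathrm{GL}_2(\mathbb{Z}/n\mathbb{Z})$ the reduction of $G_E$ modulo $n$. For non-CM $E$, $G_E$ is open, and the adelic level $m_E$ is the smallest positive integer $M$ such that $G_E$ is the full preimage of $G_E(M)$ under $\mathrm{GL}_2(\widehat{\mathbb{Z}})\to\mathrm{GL}_2(\mathbb{Z}/M\mathbb{Z})$. The squarefree part $\Delta'_E$ is the unique squarefree integer (with sign) such that $\Delta_E/\Delta'_E$ is a square. Serre curve: suppose $\Delta_E$ is not a square. Let $d_E$ be the least positive integer with $\mathbb{Q}(\sqrt{\Delta_E})\subseteq\mathbb{Q}(\zeta_{d_E})$, and let $\alpha:(\mathbb{Z}/d_E\mathbb{Z})^\times\to\{\pm1\}$ be the quadratic character with $\sigma(\sqrt{\Delta_E})=\alpha(\chi_{d_E}(\sigma))\sqrt{\Delta_E}$ for all $\sigma\in\mathrm{Gal}(\overline{\mathbb{Q}}/\mathbb{Q})$, where $\chi_{d_E}$ is the mod $d_E$ cyclotomic character. Let $\epsilon:\mathrm{GL}_2(\mathbb{Z}/2\mathbb{Z})\simeq S_3\to\{\pm1\}$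 be the sign character. Put $H_E=\{M\in\mathrm{GL}_2(\widehat{\mathbb{Z}}):\epsilon(M \bmod 2)=\alpha(\det M \bmod d_E)\}$; one always has $G_E\subseteq H_E$. A Serre curve is a non-CM elliptic curve $E/\mathbb{Q}$ with $G_E=H_E$. $C_E^{m\text{-div}}$ denotes the natural density, among primes, of primes $p\nmid N_E$ with $m\mid \#E_p(\mathbb{F}_p)$, where $E_p$ is the reduction of $E$ mod $p$; equivalently $C_E^{m\text{-div}}=|G_E(m)\cap\Psi(m)|/|G_E(m)|$, where $\Psi(m)=\{M\in\mathrm{GL}_2(\mathbb{Z}/m\mathbb{Z}):\det(I-M)\equiv0\pmod m\}$. Average density: for an integer $q$, let $\omega_q$ be the multiplicative function given on prime powers $\ell^j$ ($j\ge1$) by $\omega_q(\ell^j)=\frac{1}{\ell^{j-1}(\ell-1)}$ if $q\not\equiv1\pmod{\ell^{\lceil j/2\rceil}}$ and $\omega_q(\ell^j)=\frac{\ell^{\lfloor j/2\rfloor+1}+\ell^{\lfloor j/2\rfloor}-1}{\ell^{j+\lfloor j/2\rfloor-1}(\ell^2-1)}$ if $q\equiv1\pmod{\ell^{\lceil j/2\rceil}}$. Put $\overline{m}=\prod_{\ell^j\parallel m}\ell^{\lceil j/2\rceil}$ and $$C^{m\text{-div}}=\frac{1}{\varphi(\overline m)}\sum_{1\le q\le\overline m,\ \gcd(q,\overline m)=1}\omega_q(m),$$ with $\varphi$ the Euler totient function. $\gcd(m,m_E^\infty)$ is the largest divisor of $m$ all of whose prime factors divide $m_E$. The notation $\ell^\alpha\parallel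 n$ means $\ell$ is a prime, $\alpha\ge1$, $\ell^\alpha\mid n$ and $\ell^{\alpha+1}\nmid n$. *)

theory Defs
  imports
    "HOL-Analysis.Analysis"
    "HOL-Algebra.Group"
    "HOL-Number_Theory.Cong"
    "HOL-Number_Theory.Totient"
    "HOL-Combinatorics.Permutations"
    "HOL-Computational_Algebra.Computational_Algebra"
begin

section \<open>The field of algebraic numbers and its Galois group\<close>

definition Qbar :: "complex set" where
  "Qbar = {z. algebraic z}"

text \<open>Automorphisms are functions on all of \<^typ>\<open>complex\<close>, so extensionality pins down
  their irrelevant values outside \<^const>\<open>Qbar\<close>.\<close>

definition Gal_Q :: "(complex \<Rightarrow> complex) set" where
  "Gal_Q = {\<sigma> \<in> extensional Qbar. bij_betw \<sigma> Qbar Qbar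
      \<and> (\<forall>x\<in>Qbar. \<forall>y\<in>Qbar. \<sigma> (x + y) = \<sigma> x + \<sigma> y \<and> \<sigma> (x * y) = \<sigma> x * \<sigma> y)
      \<and> (\<forall>x\<in>\<rat>. \<sigma> x = x)}"

definition zeta :: "nat \<Rightarrow> complex" where
  "zeta n = cis (2 * pi / real n)"

definition is_subfield :: "complex set \<Rightarrow> bool" where
  "is_subfield K \<longleftrightarrow> 0 \<in> K \<and> 1 \<in> K
     \<and> (\<forall>x\<in>K. \<forall>y\<in>K. x + y \<in> K \<and> x * y \<in> K) \<and> (\<forall>x\<in>K. - x \<in> K \<and> inverse x \<in> K)"

definition Q_adjoin :: "complex \<Rightarrow> complex set" where
  "Q_adjoin z = \<Inter>{K. is_subfield K \<and> z \<in> K}"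

text \<open>\<open>(\<int>/d\<int>)\<^sup>\<times>\<close>, represented by least nonnegative residues.\<close>

definition zmod_units :: "nat \<Rightarrow> int set" where
  "zmod_units d = {k. 0 \<le> k \<and> k < int d \<and> coprime k (int d)}"

definition cyc_char :: "nat \<Rightarrow> (complex \<Rightarrow> complex) \<Rightarrow> int" where
  "cyc_char d \<sigma> = (THE k. k \<in> zmod_units d \<and> \<sigma> (zeta d) = zeta d ^ nat k)"


section \<open>Matrix groups\<close>

text \<open>Matrices over \<open>\<int>/n\<int>\<close> are integer matrices with entries in \<open>{0..<n}\<close>.\<close>

definition red_mat :: "nat \<Rightarrow> int^2^2 \<Rightarrow> int^2^2" where
  "red_mat n A = (\<chi> i j. A $ i $ j mod int n)"

definition GL2 :: "nat \<Rightarrow> (int^2^2) set" where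
  "GL2 n = {A. (\<forall>i j. A $ i $ j \<in> {0..<int n}) \<and> coprime (det A) (int n)}"

text \<open>\<open>GL\<^sub>2\<close> of the profinite integers, as the inverse limit of the groups \<^term>\<open>GL2 n\<close>.\<close>

definition GL2_hat :: "(nat \<Rightarrow> int^2^2) set" where
  "GL2_hat = {M \<in> (\<Pi>\<^sub>E n\<in>{0<..}. GL2 n). \<forall>n>0. \<forall>d. d dvd n \<longrightarrow> red_mat d (M n) = M d}"

text \<open>The sign character of \<open>GL\<^sub>2(\<int>/2\<int>)\<close>, which is the symmetric group on the three nonzero
  vectors of \<open>(\<int>/2\<int>)\<^sup>2\<close>.\<close>

definition F2_nonzero :: "(int^2) set" where
  "F2_nonzero = {v. v \<noteq> 0 \<and> (\<forall>i. v $ i \<in> {0, 1})}"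

definition eps2 :: "int^2^2 \<Rightarrow> int" where
  "eps2 A = sign (\<lambda>v. if v \<in> F2_nonzero then (\<chi> i. (A *v v) $ i mod 2) else v)"


section \<open>Elliptic curves \<open>Y\<^sup>2 = X\<^sup>3 + a X + b\<close> with integer coefficients\<close>

text \<open>The squarefree part of the discriminant is the library's \<^const>\<open>squarefree_part\<close>, which on
  \<^typ>\<open>int\<close> keeps the sign of its argument.\<close>

definition Delta :: "int \<Rightarrow> int \<Rightarrow> int" where
  "Delta a b = - 16 * (4 * a ^ 3 + 27 * b ^ 2)"

text \<open>\<^const>\<open>None\<close> is the point at infinity.\<close>

type_synonym point = "(complex \<times> complex) option"

fun ec_add :: "int \<Rightarrow> point \<Rightarrow> point \<Rightarrow> point" where
  "ec_add a None R = R"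
| "ec_add a S None = S"
| "ec_add a (Some (x1, y1)) (Some (x2, y2)) =
    (if x1 = x2 \<and> y1 = - y2 then None
     else let s = (if x1 = x2 then (3 * x1 ^ 2 + of_int a) / (2 * y1) else (y2 - y1) / (x2 - x1));
              x3 = s ^ 2 - x1 - x2
          in Some (x3, s * (x1 - x3) - y1))"

text \<open>The group \<open>E(Qbar)\<close>. Since the notation of \<^typ>\<open>'a monoid\<close> is multiplicative,
  the multiple \<open>k R\<close> of a point is written as a power.\<close>

definition EC :: "int \<Rightarrow> int \<Rightarrow> point monoid" where
  "EC a b = \<lparr>carrier = {None} \<union>
      {Some (x, y) | x y. x \<in> Qbar \<and> y \<in> Qbar \<and> y ^ 2 = x ^ 3 + of_int a * x + of_int b},
     monoid.mult = ec_add a, one = None\<rparr>"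

definition torsion :: "int \<Rightarrow> int \<Rightarrow> nat \<Rightarrow> point set" where
  "torsion a b n = {R \<in> carrier (EC a b). R [^]\<^bsub>EC a b\<^esub> n = \<one>\<^bsub>EC a b\<^esub>}"

definition gal_act :: "(complex \<Rightarrow> complex) \<Rightarrow> point \<Rightarrow> point" where
  "gal_act \<sigma> = map_option (map_prod \<sigma> \<sigma>)"

definition tate_module :: "int \<Rightarrow> int \<Rightarrow> (nat \<Rightarrow> point) set" where
  "tate_module a b = {T \<in> (\<Pi>\<^sub>E n\<in>{0<..}. torsion a b n).
     \<forall>n>0. \<forall>d>0. T (n * d) [^]\<^bsub>EC a b\<^esub> d = T n}"

text \<open>Being a basis over the profinite integers means being one modulo every \<open>n\<close>.\<close>

definition tate_basis :: "int \<Rightarrow> int \<Rightarrow> (nat \<Rightarrow> point) \<Rightarrow> (nat \<Rightarrow> point) \<Rightarrow> bool" where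
  "tate_basis a b P Q \<longleftrightarrow> P \<in> tate_module a b \<and> Q \<in> tate_module a b
     \<and> (\<forall>n>0. bij_betw (\<lambda>(i, j). P n [^]\<^bsub>EC a b\<^esub> i \<otimes>\<^bsub>EC a b\<^esub> Q n [^]\<^bsub>EC a b\<^esub> j)
                ({0..<int n} \<times> {0..<int n}) (torsion a b n))"

text \<open>The matrix of \<open>\<sigma>\<close> acts on coordinate columns with respect to the basis \<open>P\<close>, \<open>Q\<close>.\<close>

definition rho :: "int \<Rightarrow> int \<Rightarrow> (nat \<Rightarrow> point) \<Rightarrow> (nat \<Rightarrow> point) \<Rightarrow> (complex \<Rightarrow> complex)
    \<Rightarrow> (nat \<Rightarrow> int^2^2)" where
  "rho a b P Q \<sigma> = (THE M. M \<in> GL2_hat \<and> (\<forall>n>0.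
      gal_act \<sigma> (P n) = P n [^]\<^bsub>EC a b\<^esub> (M n $ 1 $ 1) \<otimes>\<^bsub>EC a b\<^esub> Q n [^]\<^bsub>EC a b\<^esub> (M n $ 2 $ 1)
    \<and> gal_act \<sigma> (Q n) = P n [^]\<^bsub>EC a b\<^esub> (M n $ 1 $ 2) \<otimes>\<^bsub>EC a b\<^esub> Q n [^]\<^bsub>EC a b\<^esub> (M n $ 2 $ 2)))"

definition G_E :: "int \<Rightarrow> int \<Rightarrow> (nat \<Rightarrow> point) \<Rightarrow> (nat \<Rightarrow> point) \<Rightarrow> (nat \<Rightarrow> int^2^2) set" where
  "G_E a b P Q = rho a b P Q ` Gal_Q"

definition red_group :: "(nat \<Rightarrow> int^2^2) set \<Rightarrow> nat \<Rightarrow> (int^2^2) set" where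
  "red_group G n = (\<lambda>M. M n) ` G"

definition adelic_level :: "(nat \<Rightarrow> int^2^2) set \<Rightarrow> nat" where
  "adelic_level G = (LEAST n. n > 0 \<and> G = {M \<in> GL2_hat. M n \<in> red_group G n})"


section \<open>Complex multiplication\<close>

definition poly2 :: "complex poly poly \<Rightarrow> complex \<Rightarrow> complex \<Rightarrow> complex" where
  "poly2 f x y = poly (poly f [:y:]) x"

definition Qbar_poly2 :: "complex poly poly \<Rightarrow> bool" where
  "Qbar_poly2 f \<longleftrightarrow> (\<forall>i j. coeff (coeff f i) j \<in> Qbar)"

text \<open>Endomorphisms over \<^const>\<open>Qbar\<close> are the group homomorphisms given by rational functions.
  The zero map is listed separately since it has no affine description. A fixed pair of
  fractions may be undefined at finitely many points; there the value is determined by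
  being a homomorphism.\<close>

definition ec_endo :: "int \<Rightarrow> int \<Rightarrow> (point \<Rightarrow> point) \<Rightarrow> bool" where
  "ec_endo a b \<phi> \<longleftrightarrow> \<phi> \<in> hom (EC a b) (EC a b) \<and>
     ((\<forall>R\<in>carrier (EC a b). \<phi> R = \<one>\<^bsub>EC a b\<^esub>) \<or>
      (\<exists>f1 g1 f2 g2. Qbar_poly2 f1 \<and> Qbar_poly2 g1 \<and> Qbar_poly2 f2 \<and> Qbar_poly2 g2 \<and>
         finite {(x, y). Some (x, y) \<in> carrier (EC a b) \<and>
           \<not> (poly2 g1 x y \<noteq> 0 \<and> poly2 g2 x y \<noteq> 0 \<and>
              \<phi> (Some (x, y)) = Some (poly2 f1 x y / poly2 g1 x y, poly2 f2 x y / poly2 g2 x y))}))"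

definition has_CM :: "int \<Rightarrow> int \<Rightarrow> bool" where
  "has_CM a b \<longleftrightarrow>
     (\<exists>\<phi>. ec_endo a b \<phi> \<and> \<not> (\<exists>k::int. \<forall>R\<in>carrier (EC a b). \<phi> R = R [^]\<^bsub>EC a b\<^esub> k))"


section \<open>Serre curves\<close>

definition d_E :: "int \<Rightarrow> int \<Rightarrow> nat" where
  "d_E a b = (LEAST d. d > 0 \<and> Q_adjoin (csqrt (of_int (Delta a b))) \<subseteq> Q_adjoin (zeta d))"

definition alpha_E :: "int \<Rightarrow> int \<Rightarrow> int \<Rightarrow> int" where
  "alpha_E a b = (THE \<alpha>. \<alpha> \<in> zmod_units (d_E a b) \<rightarrow>\<^sub>E {1, -1}
     \<and> (\<forall>k\<in>zmod_units (d_E a b). \<forall>l\<in>zmod_units (d_E a b).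
           \<alpha> (k * l mod int (d_E a b)) = \<alpha> k * \<alpha> l)
     \<and> (\<forall>\<sigma>\<in>Gal_Q. \<sigma> (csqrt (of_int (Delta a b)))
           = of_int (\<alpha> (cyc_char (d_E a b) \<sigma>)) * csqrt (of_int (Delta a b))))"

definition H_E :: "int \<Rightarrow> int \<Rightarrow> (nat \<Rightarrow> int^2^2) set" where
  "H_E a b = {M \<in> GL2_hat.
     eps2 (M 2) = alpha_E a b (det (M (d_E a b)) mod int (d_E a b))}"

definition serre_curve :: "int \<Rightarrow> int \<Rightarrow> (nat \<Rightarrow> point) \<Rightarrow> (nat \<Rightarrow> point) \<Rightarrow> bool" where
  "serre_curve a b P Q \<longleftrightarrow>
     (\<nexists>k. Delta a b = k ^ 2) \<and> \<not> has_CM a b \<and> G_E a b P Q = H_E a b"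


section \<open>The densities\<close>

definition Psi :: "nat \<Rightarrow> (int^2^2) set" where
  "Psi m = {A \<in> GL2 m. [det (mat 1 - A) = 0] (mod int m)}"

text \<open>By the Chebotarev density theorem, this ratio is the natural density of the primes \<open>p\<close> of
  good reduction for which \<open>m\<close> divides \<open>#E\<^sub>p(F\<^sub>p)\<close>: for \<open>p\<close> not dividing \<open>m\<close>, this order is
  congruent to \<open>det (1 - \<rho>(Frob\<^sub>p))\<close> modulo \<open>m\<close>.\<close>

definition C_E_div :: "int \<Rightarrow> int \<Rightarrow> (nat \<Rightarrow> point) \<Rightarrow> (nat \<Rightarrow> point) \<Rightarrow> nat \<Rightarrow> real" where
  "C_E_div a b P Q m =
     real (card (red_group (G_E a b P Q) m \<inter> Psi m)) / real (card (red_group (G_E a b P Q) m))"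

text \<open>Here \<open>(j + 1) div 2\<close> and \<open>j div 2\<close> are the ceiling and the floor of \<open>j/2\<close>.\<close>

definition omega_pp :: "nat \<Rightarrow> nat \<Rightarrow> nat \<Rightarrow> real" where
  "omega_pp q l j =
     (if [q = 1] (mod l ^ ((j + 1) div 2))
      then (real l ^ (j div 2 + 1) + real l ^ (j div 2) - 1)
             / (real l ^ (j + j div 2 - 1) * (real l ^ 2 - 1))
      else 1 / (real l ^ (j - 1) * (real l - 1)))"

definition omega :: "nat \<Rightarrow> nat \<Rightarrow> real" where
  "omega q m = (\<Prod>l\<in>prime_factors m. omega_pp q l (multiplicity l m))"

definition mbar :: "nat \<Rightarrow> nat" where
  "mbar m = (\<Prod>l\<in>prime_factors m. l ^ ((multiplicity l m + 1) div 2))"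

definition C_div :: "nat \<Rightarrow> real" where
  "C_div m = 1 / real (totient (mbar m)) *
     (\<Sum>q | 1 \<le> q \<and> q \<le> mbar m \<and> coprime q (mbar m). omega q m)"

text \<open>The usual \<open>gcd(m, n\<^sup>\<infinity>)\<close>, for \<open>m > 0\<close>; for \<open>m = 0\<close> the set below may be infinite.\<close>

definition gcd_inf :: "nat \<Rightarrow> nat \<Rightarrow> nat" where
  "gcd_inf m n = Max {d. d dvd m \<and> (\<forall>p. prime p \<and> p dvd d \<longrightarrow> p dvd n)}"

end

theory Submission
  imports "HOL-Number_Theory.Number_Theory" Defs
begin

text \<open>
  Gauss sums write \<open>\<surd>D\<close>, for \<open>D\<close> the squarefree part of the discriminant, inside a cyclotomic field.
  Since every power map on roots of unity extends to an automorphism of the algebraic numbers, this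
  pins down \<^const>\<open>d_E\<close> as the conductor of \<open>\<rat>(\<surd>D)\<close> and \<^const>\<open>alpha_E\<close> as the Kronecker symbol.
  Primitivity of that symbol makes the adelic level \<open>lcm(2, d\<^sub>E)\<close>: if the level does not divide \<open>m\<close>,
  the group modulo \<open>m\<close> is everything, and otherwise it has index 2, cut out by a character
  \<open>\<epsilon> \<cdot> \<alpha>(det)\<close>. In the second case the density is the one for the full group plus
  a normalised sum of that character over \<open>\<Psi>(m)\<close>, which factors over the primes dividing \<open>m\<close>.
  Locally put \<open>A = 1 - B\<close>; then \<open>A \<in> \<Psi>\<close> means \<open>det B = 0\<close>, and \<open>det A = 1 - tr B\<close>. The matrices \<open>B\<close>
  that are nonzero modulo \<open>\<ell>\<close> lift uniformly and those that vanish modulo \<open>\<ell>\<close> are handled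
  recursively; this gives \<open>-\<ell>\<^sup>2\<^sup>\<alpha>\<^sup>-\<^sup>1\<close> except for small powers of 2, where the sum cancels.
\<close>

section \<open>Algebraic numbers\<close>

text \<open>\<open>d_E\<close> is a least element and \<open>alpha_E\<close> a unique choice, both
  quantified over field elements or automorphisms. Minimality of the one and uniqueness of the other
  each need an actual automorphism with a prescribed exponent; the irreducibility of cyclotomic
  polynomials and Zorn's lemma supply it.

  The value -l^(2 alpha - 1) is uniform because any weight that depends only on B modulo l, is 1 at
  B = 0 and sums to -l over the singular matrices modulo l has this sum modulo l^alpha. The Legendre
  symbol of 1 - tr B and the sign character both fit. At 2, a character modulo 4 or 8 is not
  determined by B modulo 2. It changes sign when an even trace is shifted by 2 or 4, so that the B
  not divisible by 2 cancel and B = 2X remains. Modulo 4 the condition on det X is void for alpha =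
  2, and the unrestricted character sum is 0. Modulo 8 the remaining character of tr X still changes
  sign under a shift, and this second cancellation gives two exceptional exponents, 3 and 4.\<close>

interpretation rat_span: vector_space "\<lambda>(q::rat) (x::complex). of_rat q * x"
  by unfold_locales (auto simp: algebra_simps of_rat_add of_rat_mult)

lemma span_mult_closed:
  assumes "\<And>b. b \<in> B \<Longrightarrow> z * b \<in> rat_span.span B" and "v \<in> rat_span.span B"
  shows "z * v \<in> rat_span.span B"
proof -
  have "rat_span.subspace {v. z * v \<in> rat_span.span B}"
    unfolding rat_span.subspace_def
    by (auto simp: rat_span.span_zero rat_span.span_add distrib_left mult.left_commute[of z]
        intro: rat_span.span_scale)
  then have "rat_span.span B \<subseteq> {v. z * v \<in> rat_span.span B}"
    by (intro rat_span.span_minimal) (auto simp: assms)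
  then show ?thesis using assms(2) by auto
qed

text \<open>All powers of z stay in a finite-dimensional rational space, so
  \<open>card B + 1\<close> of them satisfy a linear relation.\<close>

lemma algebraic_if_span_invariant:
  assumes "finite B" "1 \<in> rat_span.span B" and "\<And>b. b \<in> B \<Longrightarrow> z * b \<in> rat_span.span B"
  shows "algebraic z"
proof -
  have pow: "z ^ k \<in> rat_span.span B" for k
    by (induction k) (auto simp: assms span_mult_closed)
  define N where "N = card B"
  show ?thesis
  \<comment> \<open>The dimension bound speaks of sets, so it needs N + 1 distinct powers; if a
    power repeats, a difference of two monomials does the job.\<close>
  proof (cases "inj_on (\<lambda>k. z ^ k) {..N}")
    case False
    then obtain i j where ij: "i < j" "z ^ i = z ^ j"
      unfolding inj_on_def by (metis linorder_neqE_nat)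
    let ?p = "monom 1 j - monom 1 i :: complex poly"
    have "coeff ?p j \<noteq> 0" using ij by simp
    then have "?p \<noteq> 0" by (metis coeff_0)
    then show ?thesis
      using ij by (intro algebraicI[of ?p]) (auto simp: poly_monom)
  next
    case True
    let ?S = "(\<lambda>k. z ^ k) ` {..N}"
    have "rat_span.dependent ?S"
    proof (rule ccontr)
      assume "\<not> rat_span.dependent ?S"
      then have "card ?S \<le> card B"
        using rat_span.independent_span_bound[OF \<open>finite B\<close>, of ?S] pow by auto
      then show False
        using True by (simp add: card_image N_def)
    qed
    then obtain u k where u: "u (z ^ k) \<noteq> 0" "k \<le> N" "(\<Sum>v\<in>?S. of_rat (u v) * v) = 0"
      by (subst (asm) rat_span.dependent_finite) auto
    define p where "p = (\<Sum>k\<le>N. monom (of_rat (u (z ^ k))) k :: complex poly)"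
    have co: "coeff p i = (if i \<le> N then of_rat (u (z ^ i)) else 0)" for i
      unfolding p_def by (simp add: coeff_sum)
    have "poly p z = (\<Sum>k\<le>N. of_rat (u (z ^ k)) * z ^ k)"
      unfolding p_def by (simp add: poly_sum poly_monom)
    also have "\<dots> = 0"
      using u(3) by (subst (asm) sum.reindex) (use True in auto)
    finally have "poly p z = 0" .
    moreover have "coeff p k \<noteq> 0" using u by (simp add: co)
    then have "p \<noteq> 0" by (metis coeff_0)
    ultimately show ?thesis
      by (intro algebraicI'[of p]) (auto simp: co)
  qed
qed

lemma algebraic_power_in_span:
  assumes "algebraic (x :: complex)"
  obtains m where "m > 0" and "x ^ m \<in> rat_span.span ((\<lambda>i. x ^ i) ` {..<m})"
proof -
  from assms obtain p where p: "\<And>i. coeff p i \<in> \<rat>" "p \<noteq> 0" "poly p x = 0"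
    unfolding algebraic_altdef by metis
  define m where "m = degree p"
  have "m > 0"
  proof (rule ccontr)
    assume "\<not> m > 0"
    then obtain c where "p = [:c:]" by (auto simp: m_def elim: degree_eq_zeroE)
    with p show False by auto
  qed
  obtain q where q: "\<And>i. coeff p i = of_rat (q i)"
    using p(1) unfolding Rats_def by (simp add: image_iff) metis
  have qm: "q m \<noteq> 0"
    using p(2) q[of m] by (auto simp: m_def)
  have "0 = (\<Sum>i<m. of_rat (q i) * x ^ i) + of_rat (q m) * x ^ m"
    using p(3) unfolding poly_altdef q m_def[symmetric] lessThan_Suc_atMost[symmetric] by simp
  then have "of_rat (q m) * x ^ m = - (\<Sum>i<m. of_rat (q i) * x ^ i)"
    by (simp add: eq_neg_iff_add_eq_0 add.commute)
  then have "x ^ m = - (\<Sum>i<m. of_rat (q i) * x ^ i) / of_rat (q m)"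
    using qm by (subst nonzero_eq_divide_eq) (simp_all add: mult.commute)
  also have "\<dots> = (\<Sum>i<m. of_rat (- q i / q m) * x ^ i)"
    by (simp add: of_rat_divide of_rat_minus sum_negf sum_divide_distrib)
  also have "\<dots> \<in> rat_span.span ((\<lambda>i. x ^ i) ` {..<m})"
    by (intro rat_span.span_sum rat_span.span_scale rat_span.span_base) auto
  finally show ?thesis using that \<open>m > 0\<close> by blast
qed

text \<open>One set serves both numbers: the monomials x^i y^j in the box i < m, j < n.
  Multiplication leaves the box only at its edge, where the top power is expanded again. Sums and
  products then preserve the same space.\<close>

lemma algebraic_span_pair:
  assumes "algebraic (x :: complex)" "algebraic y"
  obtains B where "finite B" "1 \<in> rat_span.span B"
    "\<And>b. b \<in> B \<Longrightarrow> x * b \<in> rat_span.span B" "\<And>b. b \<in> B \<Longrightarrow> y * b \<in> rat_span.span B"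
proof -
  obtain m where m: "m > 0" "x ^ m \<in> rat_span.span ((\<lambda>i. x ^ i) ` {..<m})"
    using algebraic_power_in_span[OF assms(1)] .
  obtain n where n: "n > 0" "y ^ n \<in> rat_span.span ((\<lambda>i. y ^ i) ` {..<n})"
    using algebraic_power_in_span[OF assms(2)] .
  define B where "B = (\<lambda>(i, j). x ^ i * y ^ j) ` ({..<m} \<times> {..<n})"
  have base: "x ^ i * y ^ j \<in> rat_span.span B" if "i < m" "j < n" for i j
    by (rule rat_span.span_base) (use that in \<open>auto simp: B_def\<close>)
  have scale: "rat_span.subspace {v. w * v \<in> rat_span.span B}" for w
    unfolding rat_span.subspace_def
    by (auto simp: rat_span.span_zero rat_span.span_add distrib_left mult.left_commute[of w]
        intro: rat_span.span_scale)
  have x: "y ^ j * x ^ m \<in> rat_span.span B" if "j < n" for j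
    using rat_span.span_minimal[OF _ scale[of "y ^ j"], of "(\<lambda>i. x ^ i) ` {..<m}"] m(2) base that
    by (force simp: mult.commute)
  have y: "x ^ i * y ^ n \<in> rat_span.span B" if "i < m" for i
    using rat_span.span_minimal[OF _ scale[of "x ^ i"], of "(\<lambda>i. y ^ i) ` {..<n}"] n(2) base that
    by force
  show ?thesis
  proof (rule that[of B])
    show "1 \<in> rat_span.span B" using base[of 0 0] m n by simp
    show "x * b \<in> rat_span.span B" if "b \<in> B" for b
    proof -
      obtain i j where ij: "b = x ^ i * y ^ j" "i < m" "j < n" using \<open>b \<in> B\<close> by (auto simp: B_def)
      show ?thesis
        using base[of "Suc i" j] x[of j] ij by (cases "Suc i = m") (auto simp: mult_ac)
    qed
    show "y * b \<in> rat_span.span B" if "b \<in> B" for b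
    proof -
      obtain i j where ij: "b = x ^ i * y ^ j" "i < m" "j < n" using \<open>b \<in> B\<close> by (auto simp: B_def)
      show ?thesis
        using base[of i "Suc j"] y[of i] ij by (cases "Suc j = n") (auto simp: mult_ac)
    qed
  qed (auto simp: B_def)
qed

lemma algebraic_add [intro]: "algebraic (x :: complex) \<Longrightarrow> algebraic y \<Longrightarrow> algebraic (x + y)"
  by (erule (1) algebraic_span_pair, erule (1) algebraic_if_span_invariant)
     (simp add: distrib_right rat_span.span_add)

lemma algebraic_mult [intro]:
  assumes "algebraic (x :: complex)" "algebraic y"
  shows "algebraic (x * y)"
proof -
  obtain B where B: "finite B" "1 \<in> rat_span.span B"
    "\<And>b. b \<in> B \<Longrightarrow> x * b \<in> rat_span.span B" "\<And>b. b \<in> B \<Longrightarrow> y * b \<in> rat_span.span B"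
    using algebraic_span_pair[OF assms] by metis
  show ?thesis
    by (rule algebraic_if_span_invariant[OF B(1,2)])
       (simp add: mult.assoc span_mult_closed B)
qed

lemma Qbar_subfield: "is_subfield Qbar"
  by (auto simp: is_subfield_def Qbar_def)

section \<open>Conjugates of roots of unity\<close>

text \<open>Polynomials stay over the integers because the argument needs contents, divisibility and
  congruences there; only their values are complex.\<close>

definition ipoly :: "int poly \<Rightarrow> complex \<Rightarrow> complex" where
  "ipoly f z = poly (map_poly of_int f) z"

lemma ipoly_0 [simp]: "ipoly 0 z = 0"
  and ipoly_1 [simp]: "ipoly 1 z = 1"
  and ipoly_pCons [simp]: "ipoly (pCons c f) z = of_int c + z * ipoly f z"
  by (simp_all add: ipoly_def map_poly_pCons)

lemma ipoly_add [simp]: "ipoly (f + g) z = ipoly f z + ipoly g z"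
proof -
  have "map_poly of_int (f + g) = map_poly of_int f + (map_poly of_int g :: complex poly)"
    by (rule poly_eqI) (simp add: coeff_map_poly)
  then show ?thesis by (simp add: ipoly_def)
qed

lemma ipoly_smult [simp]: "ipoly (smult c f) z = of_int c * ipoly f z"
  by (induction f) (auto simp: algebra_simps)

lemma ipoly_mult [simp]: "ipoly (f * g) z = ipoly f z * ipoly g z"
  by (induction f) (auto simp: algebra_simps)

lemma ipoly_minus [simp]: "ipoly (- f) z = - ipoly f z"
  by (induction f) auto

lemma ipoly_diff [simp]: "ipoly (f - g) z = ipoly f z - ipoly g z"
  using ipoly_add[of f "- g" z] by simp

lemma ipoly_power [simp]: "ipoly (f ^ k) z = ipoly f z ^ k"
  by (induction k) auto

lemma ipoly_monom [simp]: "ipoly (monom c k) z = of_int c * z ^ k"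
  by (induction k) (auto simp: monom_Suc monom_0)

lemma ipoly_pcompose [simp]: "ipoly (pcompose f g) z = ipoly f (ipoly g z)"
  by (induction f) (auto simp: pcompose_pCons)

section \<open>The Frobenius congruence for integer polynomials\<close>

lemma prime_dvd_binomial_expansion:
  fixes u v :: "'a :: comm_ring_1"
  assumes "prime p"
  shows "of_nat p dvd (u + v) ^ p - (u ^ p + v ^ p)"
proof -
  have "(u + v) ^ p = (\<Sum>k\<le>p. of_nat (p choose k) * u ^ k * v ^ (p - k))"
    by (rule binomial_ring)
  also have "{..p} = insert 0 (insert p {0<..<p})"
    by (auto simp: set_eq_iff)
  also have "(\<Sum>k\<in>\<dots>. of_nat (p choose k) * u ^ k * v ^ (p - k)) =
     v ^ p + (u ^ p + (\<Sum>k\<in>{0<..<p}. of_nat (p choose k) * u ^ k * v ^ (p - k)))"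
    using prime_gt_0_nat[OF assms] by (subst sum.insert; simp)+
  finally have "(u + v) ^ p - (u ^ p + v ^ p) =
      (\<Sum>k\<in>{0<..<p}. of_nat (p choose k) * u ^ k * v ^ (p - k))" by simp
  moreover have "of_nat p dvd (of_nat (p choose k) :: 'a)" if "k \<in> {0<..<p}" for k
  proof -
    have "p dvd (p choose k)" using that assms by (intro dvd_choose_prime) auto
    then show ?thesis by (auto simp: dvd_def)
  qed
  ultimately show ?thesis
    by (auto intro!: dvd_sum dvd_mult2)
qed

lemma prime_dvd_power_diff_int:
  assumes "prime p"
  shows "int p dvd a ^ p - a"
proof (cases "int p dvd a")
  case True
  moreover have "int p dvd a ^ p"
    using True prime_gt_0_nat[OF assms] by (meson dvd_power dvd_trans)
  ultimately show ?thesis by simp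
next
  case False
  define b where "b = nat (a mod int p)"
  have b: "int b = a mod int p"
    using prime_gt_0_nat[OF assms] by (simp add: b_def)
  have "\<not> p dvd b"
    using False b by (metis dvd_mod_iff int_dvd_int_iff dvd_refl)
  then have "[int (b ^ (p - 1)) = int 1] (mod int p)"
    using fermat_theorem[OF assms, of b] by (simp only: cong_int_iff simp_thms)
  moreover have "[int b = a] (mod int p)"
    by (simp add: b cong_def)
  ultimately have "[a ^ (p - 1) = 1] (mod int p)"
    using cong_pow[of "int b" a "int p" "p - 1"] by (metis cong_sym cong_trans of_nat_1 of_nat_power)
  then have "[a ^ (p - 1) * a = 1 * a] (mod int p)"
    by (rule cong_mult) simp
  moreover have "a ^ (p - 1) * a = a ^ p"
    using prime_gt_0_nat[OF assms] by (cases p) auto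
  ultimately show ?thesis by (simp add: cong_iff_dvd_diff)
qed

text \<open>Induction on the coefficients: Fermat's little theorem handles the constant one, the
  binomial congruence splits the p-th power of the sum.\<close>

lemma poly_frobenius_int:
  fixes f :: "int poly"
  assumes "prime p"
  shows "of_nat p dvd pcompose f (monom 1 p) - f ^ p"
proof (induction f)
  case 0
  then show ?case using prime_gt_0_nat[OF assms] by (simp add: zero_power)
next
  case (pCons a f)
  obtain t where t: "a ^ p - a = int p * t"
    using prime_dvd_power_diff_int[OF assms, of a] by (elim dvdE)
  let ?M = "monom 1 p :: int poly"
  have "pCons 0 f ^ p = ?M * f ^ p"
  proof -
    have "pCons 0 f = monom 1 1 * f" by (simp add: monom_Suc monom_0)
    then show ?thesis by (simp add: power_mult_distrib monom_power)
  qed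
  then have eq: "pcompose (pCons a f) ?M - pCons a f ^ p =
     ([:a:] - [:a:] ^ p) + ?M * (pcompose f ?M - f ^ p)
      - (([:a:] + pCons 0 f) ^ p - ([:a:] ^ p + (pCons 0 f) ^ p))"
    by (simp add: pcompose_pCons algebra_simps)
  have "[:a:] - [:a:] ^ p = of_nat p * [:- t:]"
    using t by (simp add: poly_const_pow of_nat_poly algebra_simps)
  then have "of_nat p dvd [:a:] - [:a:] ^ p" by (rule dvdI)
  then show ?case
    unfolding eq
    by (rule dvd_diff[OF dvd_add[OF _ dvd_mult[OF pCons.IH]] prime_dvd_binomial_expansion[OF assms]])
qed

section \<open>Powers of the standard root of unity\<close>

lemma zeta_power_eq: "zeta n ^ k = cis (2 * pi * real k / real n)"
  by (simp add: zeta_def Complex.DeMoivre mult_ac)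

lemma zeta_power_n [simp]: "n > 0 \<Longrightarrow> zeta n ^ n = 1"
  by (simp add: zeta_power_eq)

lemma zeta_power_mod: "n > 0 \<Longrightarrow> zeta n ^ (k mod n) = zeta n ^ k"
proof -
  assume "n > 0"
  have "zeta n ^ k = zeta n ^ (n * (k div n) + k mod n)" by simp
  also have "\<dots> = zeta n ^ (k mod n)"
    using \<open>n > 0\<close> by (simp only: power_add power_mult) simp
  finally show ?thesis by simp
qed

lemma zeta_power_cong_iff:
  assumes "n > 0"
  shows "zeta n ^ i = zeta n ^ j \<longleftrightarrow> [i = j] (mod n)"
proof -
  have "inj_on (\<lambda>k. zeta n ^ k) {..<n}"
    using Complex.bij_betw_roots_unity[OF assms] by (simp add: zeta_power_eq bij_betw_def)
  then have "zeta n ^ (i mod n) = zeta n ^ (j mod n) \<longleftrightarrow> i mod n = j mod n"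
    using assms by (simp add: inj_on_eq_iff)
  then show ?thesis
    using assms by (simp add: zeta_power_mod Cong.cong_def)
qed

lemma root_unity_eq_zeta_power:
  assumes "n > 0" "z ^ n = 1"
  obtains k where "k < n" "z = zeta n ^ k"
  using bij_betw_imp_surj_on[OF Complex.bij_betw_roots_unity[OF assms(1)]] assms(2) that
  by (auto simp: zeta_power_eq set_eq_iff image_iff)

lemma zeta_nonzero [simp]: "zeta n \<noteq> 0"
  by (simp add: zeta_def)

section \<open>Minimal polynomials over the integers\<close>

text \<open>A form of Gauss's lemma: since \<open>f\<close> is primitive, \<open>smult c h\<close>
  and the quotient have the same content, so \<open>c\<close> can be cancelled from the
  quotient.\<close>

lemma dvd_smult_content_1:
  fixes f h :: "int poly"
  assumes "f dvd smult c h" "content f = 1" "c \<noteq> 0"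
  shows "f dvd h"
proof -
  obtain q where q: "smult c h = f * q" using assms(1) by (elim dvdE)
  have "content (smult c h) = content q"
    using assms(2) by (simp add: q content_mult)
  then have "c dvd content q" by (metis content_smult dvd_triv_left normalize_dvd_iff dvd_mult2)
  then obtain r where "q = smult c r"
    by (auto simp flip: const_poly_dvd_iff_dvd_content elim: dvdE)
  then have "smult c h = smult c (f * r)" using q by simp
  then have "h = f * r" using assms(3) by (metis smult_cancel)
  then show ?thesis by simp
qed

text \<open>Take the primitive part of an annihilating polynomial of least degree. Pseudo-division
  stays over the integers at the price of a constant multiple of h, which primitivity
  removes.\<close>

lemma minimal_int_poly:
  assumes "algebraic z"
  obtains f where "f \<noteq> 0" "ipoly f z = 0" "\<And>h. ipoly h z = 0 \<Longrightarrow> f dvd h"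
proof -
  obtain p where "p \<noteq> 0 \<and> ipoly p z = 0"
    using algebraicE'[OF assms] unfolding ipoly_def by metis
  then obtain g where g: "g \<noteq> 0" "ipoly g z = 0"
      and min: "\<And>h. h \<noteq> 0 \<Longrightarrow> ipoly h z = 0 \<Longrightarrow> degree g \<le> degree h"
    using ex_has_least_nat[of "\<lambda>f. f \<noteq> 0 \<and> ipoly f z = 0" p degree] by auto
  define f where "f = primitive_part g"
  have fg: "g = smult (content g) f" by (simp add: f_def)
  have f: "f \<noteq> 0" "content f = 1" "degree f = degree g"
    using g(1) by (simp_all add: f_def)
  have "of_int (content g) * ipoly f z = 0"
    using g(2) by (metis fg ipoly_smult)
  then have "ipoly f z = 0" using g(1) by simp
  note f = f this
  show ?thesis
  proof (rule that[OF f(1,4)])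
    fix h assume h: "ipoly h z = 0"
    obtain q r where qr: "pseudo_divmod h f = (q, r)" by force
    let ?c = "lead_coeff f ^ (Suc (degree h) - degree f)"
    have eq: "smult ?c h = f * q + r" and r: "r = 0 \<or> degree r < degree f"
      using pseudo_divmod[OF f(1) qr] by auto
    have "ipoly r z = 0"
      using arg_cong[OF eq, of "\<lambda>h. ipoly h z"] h f(4) by simp
    then have "r = 0" using r min[of r] f(3) by linarith
    then have "f dvd smult ?c h" using eq by simp
    then show "f dvd h"
      by (rule dvd_smult_content_1) (use f(1,2) in simp_all)
  qed
qed

lemma algebraic_zeta [simp]: "algebraic (zeta n)"
proof (cases "n = 0")
  case True
  then show ?thesis by (simp add: zeta_def)
next
  case False
  have "coeff (monom 1 n - 1 :: complex poly) n \<noteq> 0" using False by simp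
  then have "monom 1 n - 1 \<noteq> (0 :: complex poly)" by (metis coeff_0)
  then show ?thesis
    using False by (intro algebraicI[of "monom 1 n - 1"]) (auto simp: poly_monom)
qed

text \<open>Schur's proof of the irreducibility of the cyclotomic polynomial: differentiating
  \<open>f g = x\<^sup>n - 1\<close> shows that \<open>f(\<zeta>\<^sup>p)\<close>, if nonzero, divides \<open>n\<close> in \<open>\<int>[\<zeta>]\<close>, whereas
  \<open>f(\<zeta>\<^sup>p) \<equiv> f(\<zeta>)\<^sup>p = 0\<close> modulo \<open>p\<close>.\<close>

lemma ipoly_zeta_power_prime:
  assumes n: "n > 0" and p: "prime p" "\<not> p dvd n"
    and f: "f \<noteq> 0" "ipoly f (zeta n) = 0" "\<And>h. ipoly h (zeta n) = 0 \<Longrightarrow> f dvd h"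
    and k: "ipoly f (zeta n ^ k) = 0"
  shows "ipoly f (zeta n ^ (k * p)) = 0"
proof (rule ccontr)
  assume nz: "ipoly f (zeta n ^ (k * p)) \<noteq> 0"
  let ?X = "monom 1 n - 1 :: int poly" and ?y = "zeta n ^ (k * p)"
  have yn: "?y ^ n = 1"
    using n by (simp flip: power_mult add: mult.commute[of _ n]) (simp add: power_mult)
  obtain g where g: "?X = f * g" using f(3)[of ?X] n by (auto elim: dvdE)
  have "ipoly f ?y * ipoly g ?y = 0"
    using arg_cong[OF g, of "\<lambda>h. ipoly h ?y"] yn by simp
  with nz have gy: "ipoly g ?y = 0" by simp
  have "ipoly (pderiv ?X) ?y = ipoly f ?y * ipoly (pderiv g) ?y"
    by (simp add: g pderiv_mult gy)
  then have "of_nat n * ?y ^ (n - 1) = ipoly f ?y * ipoly (pderiv g) ?y"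
    by (simp add: pderiv_diff pderiv_monom)
  then have "of_nat n * (?y ^ (n - 1) * ?y) = ipoly f ?y * ipoly (pderiv g) ?y * ?y"
    by (simp add: mult.assoc)
  also have "?y ^ (n - 1) * ?y = 1"
    using yn n by (cases n) (auto simp: mult.commute)
  finally have ny: "of_nat n = ipoly f ?y * ipoly (pderiv g) ?y * ?y" by simp
  obtain h where h: "pcompose f (monom 1 p) - f ^ p = of_nat p * h"
    using poly_frobenius_int[OF p(1), of f] by (elim dvdE)
  have of_nat_ipoly: "ipoly (of_nat m) w = of_nat m" for m w
    by (simp add: of_nat_poly)
  have "ipoly f ?y = of_nat p * ipoly h (zeta n ^ k)"
    using arg_cong[OF h, of "\<lambda>h. ipoly h (zeta n ^ k)"] k prime_gt_0_nat[OF p(1)]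
    by (simp add: power_mult of_nat_ipoly zero_power)
  \<comment> \<open>The identity n = p H(zeta) lives in the ring generated by \<open>zeta n\<close>;
    reducing H modulo f brings it down to the integers.\<close>
  moreover define H where
    "H = pcompose h (monom 1 k) * pcompose (pderiv g) (monom 1 (k * p)) * monom 1 (k * p)"
  ultimately have nH: "of_nat n = of_nat p * ipoly H (zeta n)"
    using ny by (simp add: mult_ac)
  have "degree f > 0"
  proof (rule ccontr)
    assume "\<not> degree f > 0"
    then obtain c where "f = [:c:]" by (auto elim: degree_eq_zeroE)
    with f(1,2) show False by auto
  qed
  obtain q r where qr: "pseudo_divmod H f = (q, r)" by force
  define c where "c = lead_coeff f ^ (Suc (degree H) - degree f)"
  have eq: "smult c H = f * q + r" and r: "degree r < degree f"
    using pseudo_divmod[OF f(1) qr] \<open>degree f > 0\<close> by (auto simp: c_def)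
  \<comment> \<open>Since f divides a monic polynomial, its leading coefficient is a unit, and so is
    the multiplier \<open>c\<close> of pseudo-division; otherwise p might divide \<open>c\<close>
    instead of n.\<close>
  have lcX: "lead_coeff ?X = 1"
  proof -
    have "degree ?X = n"
      using n by (intro antisym degree_diff_le le_degree) (auto simp: degree_monom_le)
    then show ?thesis using n by simp
  qed
  have "lead_coeff f dvd 1"
    using arg_cong[OF g, of lead_coeff] lcX by (metis dvd_triv_left lead_coeff_mult)
  then have c1: "c dvd 1" unfolding c_def by (subst is_unit_power_iff) simp
  have "ipoly ([: c * int n :] - smult (int p) r) (zeta n) = 0"
    using arg_cong[OF eq, of "\<lambda>h. ipoly h (zeta n)"] f(2) nH by simp
  then have "f dvd [: c * int n :] - smult (int p) r" by (rule f(3))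
  moreover have "degree ([: c * int n :] - smult (int p) r) < degree f"
    using r \<open>degree f > 0\<close> by (intro degree_diff_less) (auto intro: le_less_trans[OF degree_smult_le])
  ultimately have "[: c * int n :] - smult (int p) r = 0"
    by (metis dvd_imp_degree_le not_less)
  then have "c * int n = int p * coeff r 0"
    by (metis coeff_pCons_0 coeff_smult eq_iff_diff_eq_0)
  then have "int p dvd int n"
    using c1 by (metis dvd_triv_left dvd_mult_unit_iff mult.commute)
  with p(2) show False by simp
qed

text \<open>A relation at \<open>zeta n\<close> is a multiple of the minimal polynomial, and the
  roots of that polynomial are moved by one prime factor of k at a time.\<close>

theorem ipoly_zeta_power_coprime:
  assumes n: "n > 0" and "coprime k n" and "ipoly h (zeta n) = 0"
  shows "ipoly h (zeta n ^ k) = 0"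
proof -
  obtain f where f: "f \<noteq> 0" "ipoly f (zeta n) = 0" "\<And>h. ipoly h (zeta n) = 0 \<Longrightarrow> f dvd h"
    using minimal_int_poly[OF algebraic_zeta] by metis
  have "ipoly f (zeta n ^ k) = 0" using \<open>coprime k n\<close>
  proof (induction k rule: prime_divisors_induct)
    case zero
    then have "n = 1" by simp
    then show ?case using f(2) by (simp add: zeta_def)
  next
    case (unit x)
    then show ?case using f(2) by simp
  next
    case (factor p x)
    then have "\<not> p dvd n"
      by (metis coprime_mult_left_iff coprime_absorb_left not_prime_unit)
    with factor ipoly_zeta_power_prime[OF n _ _ f, of p x] show ?case
      by (simp add: mult.commute)
  qed
  with f(3)[OF assms(3)] show ?thesis by (auto elim!: dvdE)
qed

section \<open>Extending embeddings to the algebraic numbers\<close>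

text \<open>Graph of a homomorphism from a subring of the algebraic numbers to \<open>\<complex>\<close>; the last condition
  makes the relation single-valued.\<close>

definition partial_hom :: "(complex \<times> complex) set \<Rightarrow> bool" where
  "partial_hom R \<longleftrightarrow> (\<forall>(x, y)\<in>R. algebraic x) \<and> (0, 0) \<in> R \<and> (1, 1) \<in> R
     \<and> (\<forall>(x, y)\<in>R. \<forall>(u, v)\<in>R. (x + u, y + v) \<in> R \<and> (x * u, y * v) \<in> R)
     \<and> (\<forall>(x, y)\<in>R. (- x, - y) \<in> R) \<and> (\<forall>y. (0, y) \<in> R \<longrightarrow> y = 0)"

lemma partial_homD:
  assumes "partial_hom R"
  shows "(0, 0) \<in> R" "(1, 1) \<in> R" "(x, y) \<in> R \<Longrightarrow> algebraic x"
    "(x, y) \<in> R \<Longrightarrow> (u, v) \<in> R \<Longrightarrow> (x + u, y + v) \<in> R"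
    "(x, y) \<in> R \<Longrightarrow> (u, v) \<in> R \<Longrightarrow> (x * u, y * v) \<in> R"
    "(x, y) \<in> R \<Longrightarrow> (- x, - y) \<in> R" "(0, y) \<in> R \<Longrightarrow> y = 0"
  using assms unfolding partial_hom_def by blast+

lemma partial_hom_diff:
  assumes "partial_hom R" "(x, y) \<in> R" "(u, v) \<in> R"
  shows "(x - u, y - v) \<in> R"
  using partial_homD(4)[OF assms(1,2) partial_homD(6)[OF assms(1,3)]] by simp

lemma partial_hom_unique:
  assumes "partial_hom R" "(x, y) \<in> R" "(x, v) \<in> R"
  shows "y = v"
  using partial_hom_diff[OF assms] partial_homD(7)[OF assms(1)] by fastforce

lemma partial_hom_power:
  "partial_hom R \<Longrightarrow> (x, y) \<in> R \<Longrightarrow> (x ^ k, y ^ k) \<in> R"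
  by (induction k) (auto intro: partial_homD)

lemma partial_hom_sum:
  assumes "partial_hom R" "\<And>i. i \<in> I \<Longrightarrow> (f i, g i) \<in> R"
  shows "(sum f I, sum g I) \<in> R"
  using assms(2) by (induction I rule: infinite_finite_induct) (auto intro: partial_homD[OF assms(1)])

lemma partial_hom_of_nat: "partial_hom R \<Longrightarrow> (of_nat k, of_nat k) \<in> R"
  by (induction k) (auto intro: partial_homD)

lemma partial_hom_of_int: "partial_hom R \<Longrightarrow> (of_int k, of_int k) \<in> R"
  by (cases k rule: int_cases2) (auto intro: partial_homD partial_hom_of_nat)

lemma partial_hom_ipoly:
  assumes "partial_hom R" "(x, y) \<in> R"
  shows "(ipoly f x, ipoly f y) \<in> R"
  by (induction f) (auto intro: partial_homD[OF assms(1)] partial_hom_of_int[OF assms(1)] assms(2))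

lemma algebraic_ipoly:
  assumes "algebraic z" "z \<noteq> 0"
  obtains f where "ipoly f z = 0" "coeff f 0 \<noteq> 0"
proof -
  show ?thesis
    using algebraicE'_nonzero[OF assms] that unfolding ipoly_def by metis
qed

lemma algebraicI_ipoly:
  assumes "ipoly f z = 0" "f \<noteq> 0"
  shows "algebraic z"
proof (rule algebraicI)
  show "map_poly of_int f \<noteq> (0 :: complex poly)"
    using assms(2) by (metis coeff_map_poly coeff_0 of_int_0 of_int_eq_0_iff poly_eqI)
qed (use assms in \<open>auto simp: ipoly_def coeff_map_poly\<close>)

text \<open>A nonzero x satisfies an integer polynomial with nonzero constant term. If x were sent
  to 0, that constant would have to be 0 as well.\<close>

lemma partial_hom_nonzero:
  assumes "partial_hom R" "(x, 0) \<in> R"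
  shows "x = 0"
proof (rule ccontr)
  assume "x \<noteq> 0"
  then obtain f where f: "ipoly f x = 0" "coeff f 0 \<noteq> 0"
    using algebraic_ipoly partial_homD(3)[OF assms] by metis
  have "ipoly f 0 = of_int (coeff f 0)" by (cases f) simp
  then show False
    using partial_hom_ipoly[OF assms, of f] f
      partial_homD(7)[OF assms(1), of "of_int (coeff f 0)"] by simp
qed

section \<open>Adjoining one algebraic number\<close>

text \<open>The coefficientwise extension of R to polynomials, as a relation: \<open>h\<close> is
  the image of \<open>g\<close>.\<close>

definition poly_pairs :: "(complex \<times> complex) set \<Rightarrow> (complex poly \<times> complex poly) set" where
  "poly_pairs R = {(g, h). \<forall>i. (coeff g i, coeff h i) \<in> R}"

definition adjoin :: "(complex \<times> complex) set \<Rightarrow> complex \<Rightarrow> complex \<Rightarrow> (complex \<times> complex) set" where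
  "adjoin R x y = (\<lambda>(g, h). (poly g x, poly h y)) ` poly_pairs R"

lemma algebraic_poly:
  "(\<And>i. algebraic (coeff g i)) \<Longrightarrow> algebraic x \<Longrightarrow> algebraic (poly g x :: complex)"
proof (induction g)
  case (pCons a g)
  have "algebraic a" "algebraic (coeff g i)" for i
    using pCons.prems(1)[of 0] pCons.prems(1)[of "Suc i"] by simp_all
  with pCons show ?case by (auto intro!: algebraic_add algebraic_mult)
qed simp

lemma poly_pairs_closed:
  assumes "partial_hom R" "(g, h) \<in> poly_pairs R" "(g', h') \<in> poly_pairs R"
  shows "(g + g', h + h') \<in> poly_pairs R" "(g * g', h * h') \<in> poly_pairs R"
    "(- g, - h) \<in> poly_pairs R"
  using assms unfolding poly_pairs_def
  by (auto simp: coeff_mult intro!: partial_hom_sum partial_homD[OF assms(1)])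

lemma poly_pairs_const:
  "partial_hom R \<Longrightarrow> (x, y) \<in> R \<Longrightarrow> ([:x:], [:y:]) \<in> poly_pairs R"
  "partial_hom R \<Longrightarrow> (x, y) \<in> R \<Longrightarrow> (monom x k, monom y k) \<in> poly_pairs R"
  by (auto simp: poly_pairs_def coeff_pCons split: nat.splits intro: partial_homD)

text \<open>The hypothesis on roots says exactly that g(x) -> h(y) is well defined; the rest is
  closure of the pairs under ring operations.\<close>

lemma partial_hom_adjoin:
  assumes R: "partial_hom R" and x: "algebraic x"
    and y: "\<And>g h. (g, h) \<in> poly_pairs R \<Longrightarrow> poly g x = 0 \<Longrightarrow> poly h y = 0"
  shows "partial_hom (adjoin R x y)" "R \<subseteq> adjoin R x y" "(x, y) \<in> adjoin R x y"
proof -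
  have I: "(poly g x, poly h y) \<in> adjoin R x y" if "(g, h) \<in> poly_pairs R" for g h
    using that by (auto simp: adjoin_def)
  show sub: "R \<subseteq> adjoin R x y"
    using I[OF poly_pairs_const(1)[OF R]] by auto
  show "(x, y) \<in> adjoin R x y"
    using I[OF poly_pairs_const(2)[OF R partial_homD(2)[OF R], of 1]] by (simp add: poly_monom)
  have E: "\<exists>g h. (g, h) \<in> poly_pairs R \<and> u = poly g x \<and> v = poly h y"
    if "(u, v) \<in> adjoin R x y" for u v
    using that by (auto simp: adjoin_def)
  have "algebraic u" if uv: "(u, v) \<in> adjoin R x y" for u v
  proof -
    obtain g h where "(g, h) \<in> poly_pairs R" "u = poly g x" using E[OF uv] by blast
    then show ?thesis
      using x partial_homD(3)[OF R] by (auto simp: poly_pairs_def intro!: algebraic_poly)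
  qed
  moreover have "(u + u', v + v') \<in> adjoin R x y \<and> (u * u', v * v') \<in> adjoin R x y"
    if uv: "(u, v) \<in> adjoin R x y" "(u', v') \<in> adjoin R x y" for u v u' v'
  proof -
    obtain g h g' h' where
      "(g, h) \<in> poly_pairs R" "u = poly g x" "v = poly h y"
      "(g', h') \<in> poly_pairs R" "u' = poly g' x" "v' = poly h' y"
      using E[OF uv(1)] E[OF uv(2)] by blast
    then show ?thesis
      using poly_pairs_closed(1,2)[OF R, THEN I, of g h g' h'] by simp
  qed
  moreover have "(- u, - v) \<in> adjoin R x y" if uv: "(u, v) \<in> adjoin R x y" for u v
  proof -
    obtain g h where gh: "(g, h) \<in> poly_pairs R" "u = poly g x" "v = poly h y"
      using E[OF uv] by blast
    then show ?thesis
      using poly_pairs_closed(3)[OF R gh(1) gh(1), THEN I] by simp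
  qed
  moreover have "(0, 0) \<in> adjoin R x y" "(1, 1) \<in> adjoin R x y"
    using sub partial_homD(1,2)[OF R] by auto
  moreover have "w = 0" if "(0, w) \<in> adjoin R x y" for w
    using that y by (auto simp: adjoin_def)
  ultimately show "partial_hom (adjoin R x y)"
    unfolding partial_hom_def by blast
qed

section \<open>Maximal homomorphisms are automorphisms of the algebraic numbers\<close>

locale maximal_partial_hom =
  fixes R assumes R: "partial_hom R" and max: "\<And>S. partial_hom S \<Longrightarrow> R \<subseteq> S \<Longrightarrow> S = R"
begin

lemma adjoined:
  assumes "algebraic x" "\<And>g h. (g, h) \<in> poly_pairs R \<Longrightarrow> poly g x = 0 \<Longrightarrow> poly h y = 0"
  shows "(x, y) \<in> R"
  proof -
  have "adjoin R x y = R"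
    using assms(2) by (intro max partial_hom_adjoin[OF R assms(1)])
  moreover have "(x, y) \<in> adjoin R x y"
    using assms(2) by (rule partial_hom_adjoin(3)[OF R assms(1)])
  ultimately show ?thesis by simp
qed

text \<open>A relation for 1/x, multiplied by x^N, becomes one for x, which transfers to y. Hence
  the domain is a field, and leading coefficients can be inverted below.\<close>

lemma inverse_closed:
  assumes "(x, y) \<in> R" "x \<noteq> 0"
  shows "(inverse x, inverse y) \<in> R"
proof (rule adjoined)
  show "algebraic (inverse x)" using partial_homD(3)[OF R assms(1)] by auto
  have y0: "y \<noteq> 0" using partial_hom_nonzero[OF R] assms by auto
  fix g h assume gh: "(g, h) \<in> poly_pairs R" and g: "poly g (inverse x) = 0"
  define N where "N = max (degree g) (degree h)"
  have eq: "z ^ N * poly f (inverse z) = (\<Sum>i\<le>N. coeff f i * z ^ (N - i))"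
    if "z \<noteq> 0" "degree f \<le> N" for z and f :: "complex poly"
  proof -
    have "poly f (inverse z) = (\<Sum>i\<le>N. coeff f i * inverse z ^ i)"
      unfolding poly_altdef using that(2)
      by (intro sum.mono_neutral_left) (auto simp: coeff_eq_0)
    then have "z ^ N * poly f (inverse z) = (\<Sum>i\<le>N. coeff f i * (z ^ N * inverse z ^ i))"
      by (simp add: sum_distrib_left mult_ac)
    also have "\<dots> = (\<Sum>i\<le>N. coeff f i * z ^ (N - i))"
      using that(1) by (intro sum.cong) (auto simp: power_diff field_simps)
    finally show ?thesis .
  qed
  have "((\<Sum>i\<le>N. coeff g i * x ^ (N - i)), (\<Sum>i\<le>N. coeff h i * y ^ (N - i))) \<in> R"
    using gh by (intro partial_hom_sum[OF R] partial_homD(5)[OF R] partial_hom_power[OF R] assms(1))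
      (auto simp: poly_pairs_def)
  then have "(x ^ N * poly g (inverse x), y ^ N * poly h (inverse y)) \<in> R"
    using eq[of x g] eq[of y h] assms(2) y0 by (simp add: N_def)
  then have "y ^ N * poly h (inverse y) = 0"
    using g partial_homD(7)[OF R, of "y ^ N * poly h (inverse y)"] by simp
  then show "poly h (inverse y) = 0" using y0 by simp
qed

text \<open>Let g be a polynomial of least degree over the domain with root x. Any root of its image
  is an admissible value, because long division by g reduces every other relation to this
  one.\<close>

lemma total:
  assumes "algebraic x"
  obtains y where "(x, y) \<in> R"
proof (cases "x = 0")
  case True
  then show ?thesis using that partial_homD(1)[OF R] by blast
next
  case False
  obtain f where f: "ipoly f x = 0" "coeff f 0 \<noteq> 0"
    using algebraic_ipoly[OF assms False] by metis
  let ?P = "\<lambda>(g, h). (g, h) \<in> poly_pairs R \<and> g \<noteq> 0 \<and> poly g x = 0"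
  have nz: "coeff g i = 0 \<longleftrightarrow> coeff h i = 0" if "(g, h) \<in> poly_pairs R" for g h i
    using that partial_homD(7)[OF R] partial_hom_nonzero[OF R]
    unfolding poly_pairs_def by (metis (mono_tags, lifting) case_prodD mem_Collect_eq)
  have deg: "degree g = degree h" if "(g, h) \<in> poly_pairs R" for g h
    using nz[OF that] by (simp add: degree_def)
  have "?P (map_poly of_int f, map_poly of_int f)"
  proof -
    have "coeff (map_poly of_int f :: complex poly) 0 \<noteq> 0" using f(2) by (simp add: coeff_map_poly)
    then have "map_poly of_int f \<noteq> (0 :: complex poly)" by (metis coeff_0)
    then show ?thesis
      using f(1) partial_hom_of_int[OF R] by (auto simp: poly_pairs_def coeff_map_poly ipoly_def)
  qed
  then obtain g h where gh: "(g, h) \<in> poly_pairs R" "g \<noteq> 0" "poly g x = 0"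
    and min: "\<And>g' h'. (g', h') \<in> poly_pairs R \<Longrightarrow> g' \<noteq> 0 \<Longrightarrow> poly g' x = 0 \<Longrightarrow> degree g \<le> degree g'"
    using ex_has_least_nat[of ?P "(map_poly of_int f, map_poly of_int f)" "\<lambda>(g, h). degree g"]
    by (auto split: prod.splits)
  have "degree g \<noteq> 0"
  proof
    assume "degree g = 0"
    then obtain c where "g = [:c:]" by (rule degree_eq_zeroE)
    with gh(2,3) show False by simp
  qed
  then have "degree h \<noteq> 0" using deg[OF gh(1)] by simp
  then obtain y where y: "poly h y = 0"
    using alg_closed_imp_poly_has_root[of h] by auto
  have "(x, y) \<in> R"
  proof (rule adjoined[OF assms])
    fix g' h' assume "(g', h') \<in> poly_pairs R" "poly g' x = 0"
    then show "poly h' y = 0"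
    proof (induction "degree g'" arbitrary: g' h' rule: less_induct)
      case less
      show ?case
      proof (cases "g' = 0")
        case True
        then have "coeff h' i = 0" for i using nz[OF less.prems(1), of i] by simp
        then have "h' = 0" by (intro poly_eqI) simp
        then show ?thesis by simp
      next
        case False
        note dg = min[OF less.prems(1) False less.prems(2)]
        let ?k = "degree g' - degree g"
        define a where "a = lead_coeff g' * inverse (lead_coeff g)"
        define b where "b = lead_coeff h' * inverse (lead_coeff h)"
        have "(lead_coeff g, lead_coeff h) \<in> R"
          using gh(1) deg[OF gh(1)] by (auto simp: poly_pairs_def)
        moreover have "(lead_coeff g', lead_coeff h') \<in> R"
          using less.prems(1) deg[OF less.prems(1)] by (auto simp: poly_pairs_def)
        ultimately have ab: "(a, b) \<in> R"
          unfolding a_def b_def using gh(2) by (auto intro!: partial_homD(5)[OF R] inverse_closed)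
        \<comment> \<open>One step of long division, carried out on both polynomials at
          once.\<close>
        define g2 where "g2 = g' + - (monom a ?k * g)"
        define h2 where "h2 = h' + - (monom b ?k * h)"
        have pair: "(g2, h2) \<in> poly_pairs R"
          unfolding g2_def h2_def
          by (intro poly_pairs_closed(1)[OF R less.prems(1)] poly_pairs_closed(3)[OF R _ gh(1)]
              poly_pairs_closed(2)[OF R _ gh(1)] poly_pairs_const(2)[OF R ab])
        have root: "poly g2 x = 0" by (simp add: g2_def less.prems(2) gh(3))
        have "poly h2 y = 0"
        proof (cases "g2 = 0")
          case True
          then have "coeff h2 i = 0" for i using nz[OF pair, of i] by simp
          then have "h2 = 0" by (intro poly_eqI) simp
          then show ?thesis by simp
        next
          case False
          have "coeff g2 (degree g') = 0"
            using dg gh(2) by (simp add: g2_def coeff_monom_mult a_def)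
          moreover have "degree g2 \<le> degree g'"
            unfolding g2_def using dg
            by (intro degree_add_le order.refl) (auto intro: order.trans[OF degree_mult_le]
                simp: degree_monom_eq order.trans[OF add_mono[OF degree_monom_le order.refl]])
          ultimately have "degree g2 < degree g'"
            using False by (metis le_neq_implies_less leading_coeff_0_iff)
          then show ?thesis using less.hyps[OF _ pair root] by simp
        qed
        then show ?thesis by (simp add: h2_def y)
      qed
    qed
  qed
  then show ?thesis by (rule that)
qed

definition aut :: "complex \<Rightarrow> complex" where
  "aut = restrict (\<lambda>x. THE y. (x, y) \<in> R) Qbar"

lemma aut_eq_iff: "x \<in> Qbar \<Longrightarrow> aut x = y \<longleftrightarrow> (x, y) \<in> R"
proof -
  assume x: "x \<in> Qbar"
  then obtain z where z: "(x, z) \<in> R" using total by (auto simp: Qbar_def)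
  then have "(THE y. (x, y) \<in> R) = z"
    using partial_hom_unique[OF R] by blast
  then have "aut x = z" using x by (simp add: aut_def)
  then show ?thesis using z partial_hom_unique[OF R z] by blast
qed

text \<open>Surjectivity is the point: the map is injective and preserves the finite root set of
  each nonzero integer polynomial, so it permutes that set.\<close>

lemma aut_in_Gal_Q: "aut \<in> Gal_Q"
proof -
  note aut = aut_eq_iff[THEN iffD1, OF _ refl]
  have Q: "x + y \<in> Qbar" "x * y \<in> Qbar" "x - y \<in> Qbar" if "x \<in> Qbar" "y \<in> Qbar" for x y
    using that algebraic_add[of x "- y"] by (auto simp: Qbar_def)
  have hom: "aut (x + y) = aut x + aut y" "aut (x * y) = aut x * aut y"
    if "x \<in> Qbar" "y \<in> Qbar" for x y
    using that aut_eq_iff[OF Q(1)[OF that]] aut_eq_iff[OF Q(2)[OF that]]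
      partial_homD(4,5)[OF R aut[OF that(1)] aut[OF that(2)]] by auto
  have ipoly_aut: "ipoly f (aut x) = 0" if "ipoly f x = 0" "x \<in> Qbar" for f x
    using partial_hom_ipoly[OF R aut[OF that(2)], of f] that partial_homD(7)[OF R] by auto
  have inj: "inj_on aut Qbar"
  proof (rule inj_onI)
    fix x y assume xy: "x \<in> Qbar" "y \<in> Qbar" "aut x = aut y"
    then have "(x - y, 0) \<in> R"
      using partial_hom_diff[OF R aut[OF xy(1)] aut[OF xy(2)]] by simp
    then show "x = y" using partial_hom_nonzero[OF R] by fastforce
  qed
  have rat: "aut x = x" if "x \<in> \<rat>" for x
  proof -
    have "\<exists>i j. x = of_int i / of_int j \<and> j \<noteq> 0"
      by (rule Rats_cases'[OF that]) (metis less_irrefl)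
    then obtain i j where ij: "x = of_int i / of_int j" "j \<noteq> 0" by blast
    have x: "x \<in> Qbar" using that by (simp add: Qbar_def rat_imp_algebraic)
    have j: "of_int j \<in> Qbar" by (simp add: Qbar_def)
    have int: "aut (of_int k) = of_int k" for k
      using aut_eq_iff[of "of_int k"] partial_hom_of_int[OF R] by (simp add: Qbar_def)
    have A: "aut (of_int j * x) = of_int j * aut x"
      using hom(2)[OF j x] int by simp
    have B: "of_int j * x = of_int i" using ij by simp
    have "of_int j * aut x = of_int j * x"
      unfolding A[symmetric] B by (rule int)
    then show ?thesis using ij(2) by (metis mult_cancel_left of_int_eq_0_iff)
  qed
  have roots: "aut ` {z. ipoly f z = 0} = {z. ipoly f z = 0}" if "f \<noteq> 0" for f
  proof (rule endo_inj_surj)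
    have "map_poly of_int f \<noteq> (0 :: complex poly)"
      using that by (metis coeff_map_poly coeff_0 of_int_0 of_int_eq_0_iff poly_eqI)
    then show "finite {z. ipoly f z = 0}" unfolding ipoly_def by (rule poly_roots_finite)
    have sub: "{z. ipoly f z = 0} \<subseteq> Qbar" using algebraicI_ipoly that by (auto simp: Qbar_def)
    then show "inj_on aut {z. ipoly f z = 0}" by (rule inj_on_subset[OF inj])
    show "aut ` {z. ipoly f z = 0} \<subseteq> {z. ipoly f z = 0}" using ipoly_aut sub by auto
  qed
  have root: "\<exists>f. f \<noteq> 0 \<and> ipoly f z = 0" if "z \<in> Qbar" for z
    using algebraicE'[of z] that unfolding Qbar_def ipoly_def by blast
  have "aut ` Qbar = Qbar"
  proof (intro equalityI subsetI)
    fix y assume "y \<in> aut ` Qbar"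
    then obtain x where "x \<in> Qbar" "y = aut x" by auto
    then obtain f where f: "f \<noteq> 0" "ipoly f x = 0" using root by blast
    then have "ipoly f y = 0" using ipoly_aut[of f x] \<open>x \<in> Qbar\<close> \<open>y = aut x\<close> by simp
    then show "y \<in> Qbar" using algebraicI_ipoly f(1) by (simp add: Qbar_def)
  next
    fix y assume "y \<in> Qbar"
    then obtain f where f: "f \<noteq> 0" "ipoly f y = 0" using root by auto
    then have "y \<in> aut ` {z. ipoly f z = 0}" using roots[of f] by simp
    then show "y \<in> aut ` Qbar" using algebraicI_ipoly[OF _ f(1)] by (auto simp: Qbar_def)
  qed
  with inj hom rat show ?thesis
    by (auto simp: Gal_Q_def bij_betw_def aut_def)
qed

end

text \<open>The starting point is the ring homomorphism generated by \<open>zeta n\<close> ->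
  \<open>zeta n ^ k\<close>, which is single-valued because conjugate roots of unity satisfy the
  same integer relations.\<close>

theorem Gal_Q_zeta_power:
  assumes "n > 0" "coprime k n"
  obtains \<sigma> where "\<sigma> \<in> Gal_Q" "\<sigma> (zeta n) = zeta n ^ k"
proof -
  define R0 where "R0 = range (\<lambda>f. (ipoly f (zeta n), ipoly f (zeta n ^ k)))"
  have I: "(ipoly f (zeta n), ipoly f (zeta n ^ k)) \<in> R0" for f by (auto simp: R0_def)
  have R0: "partial_hom R0"
  proof -
    have "algebraic (ipoly f (zeta n))" for f
      unfolding ipoly_def by (intro algebraic_poly) (auto simp: coeff_map_poly)
    moreover have "(ipoly f (zeta n) + ipoly g (zeta n), ipoly f (zeta n ^ k) + ipoly g (zeta n ^ k)) \<in> R0"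
      "(ipoly f (zeta n) * ipoly g (zeta n), ipoly f (zeta n ^ k) * ipoly g (zeta n ^ k)) \<in> R0"
      "(- ipoly f (zeta n), - ipoly f (zeta n ^ k)) \<in> R0" for f g
      using I[of "f + g"] I[of "f * g"] I[of "- f"] by simp_all
    moreover have "(0, 0) \<in> R0" "(1, 1) \<in> R0" using I[of 0] I[of 1] by simp_all
    moreover have "w = 0" if "(0, w) \<in> R0" for w
      using that ipoly_zeta_power_coprime[OF assms] unfolding R0_def by force
    ultimately show ?thesis
      unfolding partial_hom_def by (auto simp: R0_def)
  qed
  let ?A = "{R. partial_hom R \<and> R0 \<subseteq> R}"
  have "\<exists>M\<in>?A. \<forall>X\<in>?A. M \<subseteq> X \<longrightarrow> X = M"
  proof (rule subset_Zorn_nonempty)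
    show "?A \<noteq> {}" using R0 by auto
    fix C assume C: "C \<noteq> {}" "subset.chain ?A C"
    have hom: "partial_hom X" "R0 \<subseteq> X" if "X \<in> C" for X
      using C(2) that by (auto simp: subset_chain_def)
    \<comment> \<open>Any two pairs lie in a common member of the chain, so the binary closure
      conditions pass to the union.\<close>
    have two: "\<exists>X\<in>C. p \<in> X \<and> q \<in> X" if pq: "p \<in> \<Union>C" "q \<in> \<Union>C" for p q
    proof -
      obtain X Y where "p \<in> X" "X \<in> C" "q \<in> Y" "Y \<in> C" using pq by blast
      moreover from this have "X \<subseteq> Y \<or> Y \<subseteq> X" using C(2) by (simp add: subset_chain_def)
      ultimately show ?thesis by blast
    qed
    have "partial_hom (\<Union>C)"
      unfolding partial_hom_def
    proof (intro conjI ballI allI impI; clarsimp?)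
      show "algebraic x" if "(x, y) \<in> X" "X \<in> C" for x y X
        using partial_homD(3)[OF hom(1)[OF that(2)] that(1)] .
      show "\<exists>X\<in>C. (0, 0) \<in> X" "\<exists>X\<in>C. (1, 1) \<in> X"
        using C(1) hom partial_homD(1,2) by blast+
      show "\<exists>X\<in>C. (- x, - y) \<in> X" if "(x, y) \<in> X" "X \<in> C" for x y X
        using partial_homD(6)[OF hom(1)[OF that(2)] that(1)] that(2) by blast
      show "y = 0" if "(0, y) \<in> X" "X \<in> C" for y X
        using partial_homD(7)[OF hom(1)[OF that(2)] that(1)] .
      fix x y u v X Y assume "(x, y) \<in> X" "X \<in> C" "(u, v) \<in> Y" "Y \<in> C"
      then obtain Z where Z: "Z \<in> C" "(x, y) \<in> Z" "(u, v) \<in> Z"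
        using two[of "(x, y)" "(u, v)"] by blast
      then show "(\<exists>X\<in>C. (x + u, y + v) \<in> X) \<and> (\<exists>X\<in>C. (x * u, y * v) \<in> X)"
        using partial_homD(4,5)[OF hom(1)[OF Z(1)] Z(2,3)] Z(1) by blast
    qed
    then show "\<Union>C \<in> ?A" using C(1) hom(2) by auto
  qed
  then obtain R where hom: "partial_hom R" and sub: "R0 \<subseteq> R"
    and max: "\<And>S. partial_hom S \<Longrightarrow> R \<subseteq> S \<Longrightarrow> S = R" by auto
  interpret maximal_partial_hom R by unfold_locales (fact hom, fact max)
  have "(zeta n, zeta n ^ k) \<in> R"
    using I[of "monom 1 1"] sub by auto
  then have "aut (zeta n) = zeta n ^ k"
    by (subst aut_eq_iff) (auto simp: Qbar_def)
  with aut_in_Gal_Q show ?thesis by (rule that)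
qed

section \<open>Gauss sums\<close>

lemma Legendre_cong:
  assumes "[a = b] (mod p)"
  shows "Legendre a p = Legendre b p"
  using assms by (simp add: Legendre_def QuadRes_def Cong.cong_def)

lemma Legendre_cases: "Legendre a p \<in> {-1, 0, 1}"
  by (auto simp: Legendre_def)

lemma Legendre_eq_0_iff: "Legendre a p = 0 \<longleftrightarrow> p dvd a"
  by (auto simp: Legendre_def cong_0_iff)

lemma Legendre_square: "(Legendre a p)\<^sup>2 = (if p dvd a then 0 else 1)"
  using Legendre_cases[of a p] Legendre_eq_0_iff[of a p] by auto

text \<open>Euler's criterion yields congruences only; values in {-1, 0, 1} differ by at most 2, so
  modulo p > 2 they are equalities.\<close>

lemma sign_cong_imp_eq:
  assumes "x \<in> {-1, 0, 1 :: int}" "y \<in> {-1, 0, 1}" "[x = y] (mod p)" "p > 2"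
  shows "x = y"
proof -
  have "p dvd x - y" using assms(3) by (simp add: cong_iff_dvd_diff)
  moreover have "\<bar>x - y\<bar> < p" using assms by auto
  ultimately show ?thesis by (metis dvd_imp_le_int eq_iff_diff_eq_0 not_less abs_of_pos assms(4) order_less_trans zero_less_numeral)
qed

lemma Legendre_mult:
  assumes "prime p" "p > 2"
  shows "Legendre (a * b) (int p) = Legendre a p * Legendre b p"
proof (rule sign_cong_imp_eq)
  have "[Legendre (a * b) p = (a * b) ^ ((p - 1) div 2)] (mod int p)"
    by (rule euler_criterion[OF assms])
  moreover have "[Legendre a p * Legendre b p = a ^ ((p - 1) div 2) * b ^ ((p - 1) div 2)] (mod int p)"
    by (intro cong_mult euler_criterion assms)
  ultimately show "[Legendre (a * b) p = Legendre a p * Legendre b p] (mod int p)"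
    by (simp add: power_mult_distrib) (rule cong_trans, assumption, rule cong_sym)
qed (use Legendre_cases[of a p] Legendre_cases[of b p] Legendre_cases[of "a * b" p] assms in auto)

text \<open>A primitive root is a nonresidue, its power with exponent (p - 1)/2 not being 1.\<close>

lemma exists_Legendre_minus_1:
  assumes "prime p" "p > 2"
  obtains u :: nat where "Legendre (int u) (int p) = -1"
proof -
  obtain g where g: "residue_primroot p g"
    using prime_primitive_root_exists[of p] assms(1) prime_gt_1_nat by blast
  let ?h = "(p - 1) div 2"
  have ord: "ord p g = p - 1" "coprime p g"
    using g assms by (auto simp: residue_primroot_def totient_prime)
  have h: "0 < ?h" "?h < p - 1" using assms(2) by auto
  have "\<not> [g ^ ?h = 1] (mod p)"
  proof
    assume "[g ^ ?h = 1] (mod p)"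
    then have "ord p g dvd ?h" by (metis ord_divides)
    with ord(1) h show False by (auto dest: dvd_imp_le)
  qed
  then have "\<not> [int g ^ ?h = 1] (mod int p)"
    by (metis cong_int_iff of_nat_1 of_nat_power)
  then have "Legendre (int g) p \<noteq> 1"
    using euler_criterion[OF assms, of "int g"] by (metis cong_sym)
  moreover have "\<not> p dvd g" using ord(2) assms(1) by (metis coprime_absorb_left not_prime_unit)
  then have "Legendre (int g) p \<noteq> 0" by (simp add: Legendre_eq_0_iff)
  ultimately show ?thesis using that[of g] Legendre_cases[of "int g" p] by auto
qed

lemma sum_mod_mult_coprime:
  fixes F :: "nat \<Rightarrow> 'a :: comm_monoid_add"
  assumes "coprime k n" "n > 0" "\<And>x. F (x mod n) = F x"
  shows "(\<Sum>x<n. F (k * x)) = (\<Sum>x<n. F x)"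
proof -
  have inj: "inj_on (\<lambda>x. k * x mod n) {..<n}"
  proof (rule inj_onI)
    fix x y assume xy: "x \<in> {..<n}" "y \<in> {..<n}" "k * x mod n = k * y mod n"
    then have "[x = y] (mod n)"
      using assms(1) cong_mult_lcancel_nat[of k n x y] by (simp add: Cong.cong_def)
    then show "x = y" using xy by (simp add: Cong.cong_def)
  qed
  have "(\<lambda>x. k * x mod n) ` {..<n} = {..<n}"
    by (rule endo_inj_surj) (use inj assms(2) in auto)
  with inj have "bij_betw (\<lambda>x. k * x mod n) {..<n} {..<n}"
    by (simp add: bij_betw_def)
  then have "(\<Sum>x<n. F (k * x mod n)) = (\<Sum>x<n. F x)"
    by (rule sum.reindex_bij_betw)
  then show ?thesis by (simp add: assms(3))
qed

text \<open>Multiplication by a nonresidue permutes the residues and negates every term.\<close>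

lemma sum_Legendre:
  assumes "prime p" "p > 2"
  shows "(\<Sum>x<p. Legendre (int x) (int p)) = 0"
proof -
  obtain u where u: "Legendre (int u) (int p) = -1" using exists_Legendre_minus_1[OF assms] .
  have "coprime u p"
    using u Legendre_eq_0_iff[of "int u" p] prime_imp_coprime[OF assms(1), of u] by (auto simp: coprime_commute)
  then have "(\<Sum>x<p. Legendre (int (u * x)) (int p)) = (\<Sum>x<p. Legendre (int x) (int p))"
    using assms by (intro sum_mod_mult_coprime Legendre_cong) (auto simp: Cong.cong_def zmod_int prime_gt_0_nat)
  moreover have "Legendre (int (u * x)) (int p) = - Legendre (int x) (int p)" for x
    using Legendre_mult[OF assms, of u x] u by simp
  ultimately show ?thesis by (simp add: sum_negf)
qed

lemma Legendre_minus_1: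
  assumes "prime p" "p > 2"
  shows "Legendre (-1) (int p) = (-1) ^ ((p - 1) div 2)"
  by (rule sign_cong_imp_eq[OF Legendre_cases _ euler_criterion[OF assms]])
     (use assms in \<open>auto simp: minus_one_power_iff\<close>)

text \<open>The signed prime (-1/p) p is the square of the Gauss sum; that it is 1 modulo 4 fixes
  the 2-part left over when D is written with signed primes.\<close>

lemma Legendre_minus_1_mult_mod_4:
  assumes "prime p" "p > 2"
  shows "(Legendre (-1) (int p) * int p) mod 4 = 1"
proof -
  have "odd p" using assms prime_odd_nat by auto
  then have "p mod 4 = 1 \<or> p mod 4 = 3" by presburger
  then show ?thesis
  proof
    assume "p mod 4 = 1"
    then have "even ((p - 1) div 2)" by presburger
    with \<open>p mod 4 = 1\<close> show ?thesis
      unfolding Legendre_minus_1[OF assms] by simp presburger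
  next
    assume "p mod 4 = 3"
    then have "odd ((p - 1) div 2)" by presburger
    with \<open>p mod 4 = 3\<close> show ?thesis
      unfolding Legendre_minus_1[OF assms] by simp presburger
  qed
qed

section \<open>Quadratic Gauss sums\<close>

definition gauss_sum :: "nat \<Rightarrow> complex" where
  "gauss_sum p = (\<Sum>x<p. of_int (Legendre (int x) (int p)) * zeta p ^ x)"

lemma sum_zeta_powers:
  assumes "n > 0"
  shows "(\<Sum>x<n. zeta n ^ (x * w)) = (if n dvd w then of_nat n else 0)"
proof (cases "n dvd w")
  case True
  then have "zeta n ^ (x * w) = 1" for x
    using zeta_power_cong_iff[OF assms, of "x * w" 0] by (simp add: cong_0_iff)
  then show ?thesis using True by simp
next
  case False
  let ?z = "zeta n ^ w"
  have "?z \<noteq> 1" using zeta_power_cong_iff[OF assms, of w 0] False by (simp add: cong_0_iff)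
  moreover have "?z ^ n = 1"
    using zeta_power_cong_iff[OF assms, of "w * n" 0] by (simp add: cong_0_iff power_mult)
  ultimately have "(\<Sum>x<n. ?z ^ x) = 0"
    using geometric_sum[of ?z n] by simp
  then show ?thesis using False by (simp add: power_mult mult.commute flip: power_mult)
qed

text \<open>Substituting k x for x pulls out (k/p), which is its own inverse. The formula serves
  both the square of the Gauss sum and the Galois action on it.\<close>

lemma gauss_sum_scale:
  assumes p: "prime p" "p > 2" and k: "\<not> p dvd k"
  shows "(\<Sum>x<p. of_int (Legendre (int x) (int p)) * zeta p ^ (k * x)) =
           of_int (Legendre (int k) (int p)) * gauss_sum p"
proof -
  let ?L = "\<lambda>x. Legendre (int x) (int p)"
  have p0: "p > 0" using p(2) by simp
  have "coprime k p" using prime_imp_coprime[OF p(1) k] by (simp add: coprime_commute)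
  then have "gauss_sum p = (\<Sum>x<p. of_int (?L (k * x)) * zeta p ^ (k * x))"
    unfolding gauss_sum_def using p0
    by (intro sum_mod_mult_coprime[symmetric] arg_cong2[where f = "(*)"] arg_cong[where f = of_int]
        Legendre_cong zeta_power_mod) (auto simp: Cong.cong_def zmod_int)
  also have "\<dots> = (\<Sum>x<p. of_int (?L k) * (of_int (?L x) * zeta p ^ (k * x)))"
    using Legendre_mult[OF p] by (simp add: mult_ac)
  finally have "of_int (?L k) * gauss_sum p =
      of_int ((?L k)\<^sup>2) * (\<Sum>x<p. of_int (?L x) * zeta p ^ (k * x))"
    by (simp add: sum_distrib_left power2_eq_square mult_ac)
  then show ?thesis using k by (simp add: Legendre_square)
qed

theorem gauss_sum_square:
  assumes p: "prime p" "p > 2"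
  shows "(gauss_sum p)\<^sup>2 = of_int (Legendre (-1) (int p) * int p)"
proof -
  let ?L = "\<lambda>x. Legendre (int x) (int p)"
  have p0: "p > 0" using p(2) by simp
  have "(gauss_sum p)\<^sup>2 = (\<Sum>u<p. of_int (?L u) * zeta p ^ u * gauss_sum p)"
    by (simp add: power2_eq_square gauss_sum_def sum_distrib_right)
  \<comment> \<open>Scaling absorbs the factor (u/p) into the second sum. It does not apply at u =
    0, where that factor is 0, so the term is switched off.\<close>
  also have "\<dots> = (\<Sum>u<p. zeta p ^ u * (\<Sum>x<p. of_int (?L x) * zeta p ^ (u * x)) * (if u = 0 then 0 else 1))"
  proof (intro sum.cong refl)
    fix u assume "u \<in> {..<p}"
    then show "of_int (?L u) * zeta p ^ u * gauss_sum p =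
        zeta p ^ u * (\<Sum>x<p. of_int (?L x) * zeta p ^ (u * x)) * (if u = 0 then 0 else 1)"
      using gauss_sum_scale[OF p, of u] Legendre_eq_0_iff[of "int u" "int p"]
      by (auto simp: mult_ac dest: dvd_imp_le)
  qed
  also have "\<dots> = (\<Sum>u\<in>{..<p} - {0}. \<Sum>x<p. of_int (?L x) * zeta p ^ (u * (x + 1)))"
    by (intro sum.mono_neutral_cong_right)
       (auto simp: sum_distrib_left power_add mult_ac algebra_simps)
  also have "\<dots> = (\<Sum>x<p. of_int (?L x) * (\<Sum>u\<in>{..<p} - {0}. zeta p ^ (u * (x + 1))))"
    by (subst sum.swap) (simp add: sum_distrib_left)
  also have "\<dots> = (\<Sum>x<p. of_int (?L x) * ((\<Sum>u<p. zeta p ^ (u * (x + 1))) - 1))"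
    using p0 by (simp add: sum_diff1)
  \<comment> \<open>The full geometric sum is p exactly when p divides x + 1. The -1 for the omitted
    u = 0 contributes the sum of all Legendre symbols, which vanishes.\<close>
  also have "\<dots> = (\<Sum>x<p. of_int (?L x) * (if x = p - 1 then of_nat p else 0)) - of_int (\<Sum>x<p. ?L x)"
  proof -
    have "p dvd x + 1 \<longleftrightarrow> x = p - 1" if "x < p" for x
      using that p0 by (auto dest: dvd_imp_le)
    then show ?thesis
      unfolding sum_zeta_powers[OF p0] right_diff_distrib sum_subtractf
      by (auto intro!: sum.cong)
  qed
  also have "\<dots> = of_int (?L (p - 1)) * of_nat p"
    using p0 by (simp add: sum_Legendre[OF p] if_distrib sum.delta cong: if_cong)
  also have "?L (p - 1) = Legendre (-1) (int p)"
    using p0 by (intro Legendre_cong) (auto simp: cong_iff_dvd_diff of_nat_diff)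
  finally show ?thesis by simp
qed

section \<open>Quadratic fields inside cyclotomic fields\<close>

lemma Gal_Q_simps:
  assumes "\<sigma> \<in> Gal_Q"
  shows "x \<in> Qbar \<Longrightarrow> y \<in> Qbar \<Longrightarrow> \<sigma> (x + y) = \<sigma> x + \<sigma> y"
    "x \<in> Qbar \<Longrightarrow> y \<in> Qbar \<Longrightarrow> \<sigma> (x * y) = \<sigma> x * \<sigma> y"
    "\<sigma> (of_int c) = of_int c" "\<sigma> 0 = 0" "\<sigma> 1 = 1"
  using assms Rats_0 Rats_1 by (auto simp: Gal_Q_def simp del: Rats_0 Rats_1)

lemma Qbar_simps [simp, intro]:
  "0 \<in> Qbar" "1 \<in> Qbar" "of_int c \<in> Qbar" "zeta n \<in> Qbar"
  "x \<in> Qbar \<Longrightarrow> y \<in> Qbar \<Longrightarrow> x + y \<in> Qbar"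
  "x \<in> Qbar \<Longrightarrow> y \<in> Qbar \<Longrightarrow> x * y \<in> Qbar"
  "x \<in> Qbar \<Longrightarrow> x ^ k \<in> Qbar"
proof -
  show "x \<in> Qbar \<Longrightarrow> x ^ k \<in> Qbar" by (induction k) (auto simp: Qbar_def)
qed (auto simp: Qbar_def)

lemma Gal_Q_power: "\<sigma> \<in> Gal_Q \<Longrightarrow> x \<in> Qbar \<Longrightarrow> \<sigma> (x ^ k) = \<sigma> x ^ k"
  by (induction k) (auto simp: Gal_Q_simps)

lemma Gal_Q_sum:
  assumes "\<sigma> \<in> Gal_Q" "\<And>i. i \<in> I \<Longrightarrow> f i \<in> Qbar"
  shows "\<sigma> (sum f I) = (\<Sum>i\<in>I. \<sigma> (f i)) \<and> sum f I \<in> Qbar"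
  using assms(2) by (induction I rule: infinite_finite_induct) (auto simp: Gal_Q_simps[OF assms(1)])

lemma Q_adjoin_minimal: "is_subfield K \<Longrightarrow> z \<in> K \<Longrightarrow> Q_adjoin z \<subseteq> K"
  by (auto simp: Q_adjoin_def)

lemma Q_adjoin_base: "z \<in> Q_adjoin z"
  by (auto simp: Q_adjoin_def)

lemma is_subfield_Q_adjoin: "is_subfield (Q_adjoin z)"
  unfolding Q_adjoin_def is_subfield_def by auto

lemma is_subfieldD:
  assumes "is_subfield K"
  shows "0 \<in> K" "1 \<in> K" "x \<in> K \<Longrightarrow> y \<in> K \<Longrightarrow> x + y \<in> K" "x \<in> K \<Longrightarrow> y \<in> K \<Longrightarrow> x * y \<in> K"
    "x \<in> K \<Longrightarrow> - x \<in> K" "x \<in> K \<Longrightarrow> inverse x \<in> K"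
  using assms unfolding is_subfield_def by auto

lemma is_subfield_power: "is_subfield K \<Longrightarrow> x \<in> K \<Longrightarrow> x ^ k \<in> K"
  by (induction k) (auto intro: is_subfieldD)

lemma is_subfield_of_int: "is_subfield K \<Longrightarrow> of_int c \<in> K"
proof -
  assume K: "is_subfield K"
  have "of_nat k \<in> K" for k by (induction k) (auto intro: is_subfieldD[OF K])
  then show ?thesis by (cases c rule: int_cases2) (auto intro: is_subfieldD[OF K])
qed

lemma is_subfield_sum:
  "is_subfield K \<Longrightarrow> (\<And>i. i \<in> I \<Longrightarrow> f i \<in> K) \<Longrightarrow> sum f I \<in> K"
  by (induction I rule: infinite_finite_induct) (auto intro: is_subfieldD)

lemma zeta_div: "d dvd n \<Longrightarrow> n > 0 \<Longrightarrow> zeta d = zeta n ^ (n div d)"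
  by (auto simp: zeta_def Complex.DeMoivre elim!: dvdE)

section \<open>Square roots together with their Galois characters\<close>

text \<open>A square root of c in the n-th cyclotomic field, bundled with the character that
  describes the Galois action on it. Such data can be lifted to multiples of n and
  multiplied.\<close>

definition quad_elem :: "nat \<Rightarrow> int \<Rightarrow> (int \<Rightarrow> int) \<Rightarrow> complex \<Rightarrow> bool" where
  "quad_elem n c \<psi> \<delta> \<longleftrightarrow> \<delta> \<in> Q_adjoin (zeta n) \<and> \<delta>\<^sup>2 = of_int c \<and>
     (\<forall>\<sigma>\<in>Gal_Q. \<forall>k. coprime k n \<longrightarrow> \<sigma> (zeta n) = zeta n ^ k \<longrightarrow> \<sigma> \<delta> = of_int (\<psi> (int k)) * \<delta>)"

lemma Q_adjoin_zeta_Qbar: "Q_adjoin (zeta n) \<subseteq> Qbar"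
  by (intro Q_adjoin_minimal Qbar_subfield) simp

lemma quad_elem_lift:
  assumes "quad_elem d c \<psi> \<delta>" "d dvd n" "n > 0"
  shows "quad_elem n c \<psi> \<delta>"
proof -
  note z = zeta_div[OF assms(2,3)]
  have "zeta d \<in> Q_adjoin (zeta n)"
    unfolding z by (intro is_subfield_power is_subfield_Q_adjoin Q_adjoin_base)
  then have "Q_adjoin (zeta d) \<subseteq> Q_adjoin (zeta n)"
    by (intro Q_adjoin_minimal is_subfield_Q_adjoin)
  then have "\<delta> \<in> Q_adjoin (zeta n)" "\<delta>\<^sup>2 = of_int c"
    using assms(1) by (auto simp: quad_elem_def)
  moreover have "\<sigma> \<delta> = of_int (\<psi> (int k)) * \<delta>"
    if "\<sigma> \<in> Gal_Q" "coprime k n" "\<sigma> (zeta n) = zeta n ^ k" for \<sigma> k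
  proof -
    have "\<sigma> (zeta d) = zeta d ^ k"
      using that by (simp add: z Gal_Q_power flip: power_mult) (simp add: mult.commute)
    moreover have "coprime k d"
      using that(2) assms(2) by (metis coprime_mult_right_iff dvdE)
    ultimately show ?thesis using assms(1) that(1) unfolding quad_elem_def by simp
  qed
  ultimately show ?thesis unfolding quad_elem_def by simp
qed

lemma quad_elem_1: "quad_elem n 1 (\<lambda>_. 1) 1"
  by (auto simp: quad_elem_def Gal_Q_simps intro: is_subfieldD[OF is_subfield_Q_adjoin])

lemma quad_elem_mult:
  assumes "quad_elem n c \<psi> \<delta>" "quad_elem n c' \<psi>' \<delta>'"
  shows "quad_elem n (c * c') (\<lambda>k. \<psi> k * \<psi>' k) (\<delta> * \<delta>')"
  using assms Q_adjoin_zeta_Qbar[of n] is_subfieldD(4)[OF is_subfield_Q_adjoin, of \<delta> "zeta n" \<delta>']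
  by (auto simp: quad_elem_def Gal_Q_simps(2) subset_iff power_mult_distrib)

text \<open>The quadratic characters of conductor dividing 8 that belong to the square roots of 1,
  -1, 2 and -2; the last branch is meant for -2. Values at even k are not 0 but arbitrary
  signs.\<close>

definition chi2 :: "int \<Rightarrow> int \<Rightarrow> int" where
  "chi2 e k = (if e = 1 then 1 else if e = -1 then (if k mod 4 = 1 then 1 else -1)
     else if e = 2 then (if k mod 8 \<in> {1, 7} then 1 else -1)
     else (if k mod 8 \<in> {1, 3} then 1 else -1))"

lemma coprime_even_odd: "coprime k n \<Longrightarrow> even n \<Longrightarrow> odd (k :: nat)"
  by (meson coprime_common_divisor odd_one)

lemma zeta_4: "zeta 4 = \<i>"
  by (simp add: zeta_def flip: cis_pi_half)

lemma zeta_8_power_4: "zeta 8 ^ 4 = -1"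
  by (simp add: zeta_power_eq)

lemma quad_elem_minus_1: "quad_elem 4 (-1) (chi2 (-1)) \<i>"
proof -
  have "\<i> ^ k = of_int (chi2 (-1) (int k)) * \<i>" if "coprime k 4" for k
  proof -
    have "odd k" using that by (rule coprime_even_odd) simp
    then have "k mod 4 = 1 \<or> k mod 4 = 3" by presburger
    moreover have "\<i> ^ k = \<i> ^ (k mod 4)"
      using zeta_power_mod[of 4 k] by (simp add: zeta_4)
    moreover have "int k mod 4 = int (k mod 4)" by (simp add: zmod_int)
    moreover have "\<i> ^ 3 = - \<i>" by (simp add: numeral_3_eq_3)
    ultimately show ?thesis
      unfolding chi2_def by (elim disjE) simp_all
  qed
  then show ?thesis
    using Q_adjoin_base[of \<i>] by (auto simp: quad_elem_def zeta_4)
qed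

text \<open>With z = \<open>zeta 8\<close>, z + 1/z is 2 cos(pi/4) and z + z^3 is 2 i sin(pi/4) up
  to reordering: square roots of 2 and -2.\<close>

lemma quad_elem_2: "quad_elem 8 2 (chi2 2) (zeta 8 + zeta 8 ^ 7)"
  and quad_elem_minus_2: "quad_elem 8 (-2) (chi2 (-2)) (zeta 8 + zeta 8 ^ 3)"
proof -
  let ?z = "zeta 8"
  have red: "?z ^ 4 = -1" "?z ^ 5 = - ?z" "?z ^ 6 = - (?z ^ 2)" "?z ^ 7 = - (?z ^ 3)"
    using zeta_8_power_4 power_add[of ?z 4 1] power_add[of ?z 4 2] power_add[of ?z 4 3] by simp_all
  have m: "?z ^ k = ?z ^ (k mod 8)" for k using zeta_power_mod[of 8 k] by simp
  have cases: "k mod 8 \<in> {1, 3, 5, 7}" if "coprime k 8" for k :: nat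
  proof -
    have "odd k" using that by (rule coprime_even_odd) simp
    then show ?thesis by simp presburger
  qed
  have m2: "?z ^ (7 * k) = ?z ^ (7 * (k mod 8) mod 8)" "?z ^ (3 * k) = ?z ^ (3 * (k mod 8) mod 8)" for k
    using m[of "7 * k"] m[of "3 * k"] by (simp_all add: mod_mult_right_eq)
  have int: "int k mod 8 = int (k mod 8)" for k by (simp add: zmod_int)
  have Q: "?z ^ j \<in> Q_adjoin ?z" for j
    by (intro is_subfield_power is_subfield_Q_adjoin Q_adjoin_base)
  have sq: "(?z + ?z ^ 7)\<^sup>2 = 2" "(?z + ?z ^ 3)\<^sup>2 = -2"
    using red by (simp_all add: power2_eq_square algebra_simps flip: power_Suc power_add)
  have pow: "?z ^ k + ?z ^ (7 * k) = of_int (chi2 2 (int k)) * (?z + ?z ^ 7)"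
    "?z ^ k + ?z ^ (3 * k) = of_int (chi2 (-2) (int k)) * (?z + ?z ^ 3)" if "coprime k 8" for k
    using cases[OF that] unfolding m[of k] m2 chi2_def int by (auto simp: red)
  have gal: "\<sigma> (?z + ?z ^ j) = ?z ^ k + ?z ^ (j * k)"
    if "\<sigma> \<in> Gal_Q" "\<sigma> ?z = ?z ^ k" for \<sigma> j k
    using that by (simp add: Gal_Q_simps Gal_Q_power mult.commute flip: power_mult)
  have act: "\<sigma> (?z + ?z ^ 7) = of_int (chi2 2 (int k)) * (?z + ?z ^ 7)"
    "\<sigma> (?z + ?z ^ 3) = of_int (chi2 (-2) (int k)) * (?z + ?z ^ 3)"
    if "\<sigma> \<in> Gal_Q" "coprime k 8" "\<sigma> ?z = ?z ^ k" for \<sigma> k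
    unfolding gal[OF that(1,3)] by (fact pow[OF that(2)])+
  have sum: "?z + ?z ^ j \<in> Q_adjoin ?z" for j
    by (intro is_subfieldD(3)[OF is_subfield_Q_adjoin] Q_adjoin_base Q)
  show "quad_elem 8 2 (chi2 2) (?z + ?z ^ 7)"
    unfolding quad_elem_def sq by (intro conjI ballI allI impI sum act) auto
  show "quad_elem 8 (-2) (chi2 (-2)) (?z + ?z ^ 3)"
    unfolding quad_elem_def sq by (intro conjI ballI allI impI sum act) auto
qed

lemma quad_elem_gauss_sum:
  assumes p: "prime p" "p > 2"
  shows "quad_elem p (Legendre (-1) (int p) * int p) (\<lambda>k. Legendre k (int p)) (gauss_sum p)"
  unfolding quad_elem_def
proof (intro conjI ballI allI impI)
  show "gauss_sum p \<in> Q_adjoin (zeta p)"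
    unfolding gauss_sum_def
    by (intro is_subfield_sum is_subfieldD(4) is_subfield_Q_adjoin is_subfield_of_int
        is_subfield_power Q_adjoin_base)
  show "(gauss_sum p)\<^sup>2 = of_int (Legendre (-1) (int p) * int p)"
    by (rule gauss_sum_square[OF p])
  fix \<sigma> k assume \<sigma>: "\<sigma> \<in> Gal_Q" and k: "coprime k p" and z: "\<sigma> (zeta p) = zeta p ^ k"
  have "\<not> p dvd k" using k p(1) by (metis coprime_absorb_right not_prime_unit)
  have "\<sigma> (gauss_sum p) = (\<Sum>x<p. of_int (Legendre (int x) (int p)) * zeta p ^ (k * x))"
    unfolding gauss_sum_def
    by (subst Gal_Q_sum[OF \<sigma>, THEN conjunct1])
       (auto simp: Gal_Q_simps[OF \<sigma>] Gal_Q_power[OF \<sigma>] z power_mult)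
  also have "\<dots> = of_int (Legendre (int k) (int p)) * gauss_sum p"
    by (rule gauss_sum_scale[OF p \<open>\<not> p dvd k\<close>])
  finally show "\<sigma> (gauss_sum p) = of_int (Legendre (int k) (int p)) * gauss_sum p" .
qed

section \<open>The conductor and Kronecker symbol of a squarefree integer\<close>

text \<open>The cofactor in {1, -1, 2, -2} that makes D a product of signed primes. For squarefree D
  the last branch is D = 6 modulo 8.\<close>

definition two_part :: "int \<Rightarrow> int" where
  "two_part D = (if D mod 4 = 1 then 1 else if D mod 4 = 3 then -1 else if D mod 8 = 2 then 2 else -2)"

definition odd_primes :: "int \<Rightarrow> nat set" where
  "odd_primes D = prime_factors (nat \<bar>D\<bar>) - {2}"

text \<open>For squarefree D this is the absolute value of the discriminant of the field generated
  by the square root of D, and 1 for D = 1.\<close>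

definition conductor :: "int \<Rightarrow> nat" where
  "conductor D = (if D mod 4 = 1 then nat \<bar>D\<bar> else 4 * nat \<bar>D\<bar>)"

text \<open>All Legendre symbols have k on top. This is the form in which the Gauss sums deliver the
  character and in which it splits into local factors, with no appeal to reciprocity.\<close>

definition kronecker :: "int \<Rightarrow> int \<Rightarrow> int" where
  "kronecker D k = chi2 (two_part D) k * (\<Prod>l\<in>odd_primes D. Legendre k (int l))"

lemma odd_primesD:
  assumes "l \<in> odd_primes D"
  shows "prime l" "l > 2" "odd l" "l dvd nat \<bar>D\<bar>"
proof -
  show l: "prime l" "l dvd nat \<bar>D\<bar>" using assms by (auto simp: odd_primes_def in_prime_factors_iff)
  then show "l > 2" using assms prime_ge_2_nat[of l] by (auto simp: odd_primes_def)
  with l(1) show "odd l" using prime_odd_nat by auto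
qed

lemma finite_odd_primes [simp]: "finite (odd_primes D)"
  by (simp add: odd_primes_def)

lemma squarefree_mod_4:
  assumes "squarefree (D :: int)"
  shows "D mod 4 \<noteq> 0"
proof
  assume "D mod 4 = 0"
  then have "2\<^sup>2 dvd D" by (simp add: mod_eq_0_iff_dvd)
  from squarefreeD[OF assms this] show False by simp
qed

lemma squarefree_abs_eq:
  assumes "squarefree (D :: int)"
  shows "nat \<bar>D\<bar> = (if even D then 2 else 1) * (\<Prod>l\<in>odd_primes D. l)"
proof -
  let ?n = "nat \<bar>D\<bar>"
  have D0: "D \<noteq> 0" using assms by auto
  have "squarefree ?n"
  proof (rule squarefreeI)
    fix x assume "x\<^sup>2 dvd ?n"
    then have "int (x\<^sup>2) dvd \<bar>D\<bar>" using int_dvd_int_iff[of "x\<^sup>2" ?n] by simp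
    then have "int x dvd 1" by (intro squarefreeD[OF assms]) simp
    then show "x dvd 1" by simp
  qed
  then have "multiplicity p ?n = 1" if "p \<in> prime_factors ?n" for p
    using that D0 squarefree_factorial_semiring'[of ?n] by auto
  then have "(\<Prod>p\<in>prime_factors ?n. p) = (\<Prod>p\<in>prime_factors ?n. p ^ multiplicity p ?n)"
    by (intro prod.cong) auto
  also have "\<dots> = ?n" using prod_prime_factors[of ?n] D0 by simp
  finally have n: "(\<Prod>p\<in>prime_factors ?n. p) = ?n" .
  have "2 \<in> prime_factors ?n \<longleftrightarrow> even D"
    using D0 by (auto simp: in_prime_factors_iff even_nat_iff)
  then show ?thesis
    using n prod.remove[of "prime_factors ?n" 2 "\<lambda>p. p"] by (auto simp: odd_primes_def)
qed

text \<open>The product P of the signed primes is 1 modulo 4 and is the odd part of D up to sign. So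
  D is one of P, -P, 2P, -2P, and its residue modulo 8 tells which.\<close>

lemma squarefree_decomposition:
  assumes "squarefree (D :: int)"
  shows "D = two_part D * (\<Prod>l\<in>odd_primes D. Legendre (-1) (int l) * int l)"
proof -
  define P where "P = (\<Prod>l\<in>odd_primes D. Legendre (-1) (int l) * int l)"
  have "(\<Prod>l\<in>S. Legendre (-1) (int l) * int l) mod 4 = 1" if "finite S" "S \<subseteq> odd_primes D" for S
    using that
  proof (induction S)
    case (insert l S)
    then have "(Legendre (-1) (int l) * int l) mod 4 = 1"
      by (intro Legendre_minus_1_mult_mod_4) (auto dest: odd_primesD)
    with insert show ?case
      by (subst prod.insert) (auto simp: mod_mult_eq[symmetric, of "Legendre _ _ * _"])
  qed simp
  then have P4: "P mod 4 = 1" by (simp add: P_def)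
  have "\<bar>P\<bar> = (\<Prod>l\<in>odd_primes D. int l)"
    unfolding P_def abs_prod
  proof (rule prod.cong[OF refl])
    fix l assume l: "l \<in> odd_primes D"
    show "\<bar>Legendre (-1) (int l) * int l\<bar> = int l"
      using Legendre_minus_1[OF odd_primesD(1,2)[OF l]] by (simp add: abs_mult power_abs)
  qed
  then have "\<bar>D\<bar> = (if even D then 2 else 1) * \<bar>P\<bar>"
    using arg_cong[OF squarefree_abs_eq[OF assms], of int] by (auto simp: of_nat_prod)
  then have "(odd D \<and> D = P) \<or> (odd D \<and> D = - P) \<or> (even D \<and> D = 2 * P) \<or> (even D \<and> D = - (2 * P))"
    by (auto split: if_splits)
  then have "D = two_part D * P"
  proof (elim disjE conjE)
    assume "D = P"
    then show ?thesis using P4 by (simp add: two_part_def)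
  next
    assume "D = - P"
    moreover from this have "D mod 4 = 3" using P4 by presburger
    ultimately show ?thesis by (simp add: two_part_def)
  next
    assume "D = 2 * P"
    moreover from this have "D mod 4 = 2" "D mod 8 = 2" using P4 by presburger+
    ultimately show ?thesis by (simp add: two_part_def)
  next
    assume "D = - (2 * P)"
    moreover from this have "D mod 4 = 2" "D mod 8 = 6" using P4 by presburger+
    ultimately show ?thesis by (simp add: two_part_def)
  qed
  then show ?thesis by (simp add: P_def)
qed

definition conductor_2 :: "int \<Rightarrow> nat" where
  "conductor_2 D = (if D mod 4 = 1 then 1 else if odd D then 4 else 8)"

lemma conductor_eq:
  assumes "squarefree D"
  shows "conductor D = conductor_2 D * (\<Prod>l\<in>odd_primes D. l)"
proof -
  have "D mod 4 = 1 \<Longrightarrow> odd D" by presburger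
  then show ?thesis
    using squarefree_abs_eq[OF assms] by (auto simp: conductor_def conductor_2_def)
qed

lemma conductor_pos: "squarefree D \<Longrightarrow> conductor D > 0"
  by (auto simp: conductor_def)

lemma odd_primes_dvd_conductor: "l \<in> odd_primes D \<Longrightarrow> l dvd conductor D"
  by (auto simp: conductor_def dest: odd_primesD(4))

lemma exists_quad_elem:
  assumes "squarefree D"
  obtains \<delta> where "quad_elem (conductor D) D (kronecker D) \<delta>"
proof -
  let ?n = "conductor D"
  have n: "?n > 0" by (rule conductor_pos[OF assms])
  have "\<exists>\<delta>. quad_elem ?n (\<Prod>l\<in>S. Legendre (-1) (int l) * int l) (\<lambda>k. \<Prod>l\<in>S. Legendre k (int l)) \<delta>"
    if "finite S" "S \<subseteq> odd_primes D" for S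
    using that
  proof (induction S)
    case empty
    show ?case using quad_elem_1 by auto
  next
    case (insert l S)
    then have l: "l \<in> odd_primes D" by simp
    have "quad_elem ?n (Legendre (-1) (int l) * int l) (\<lambda>k. Legendre k (int l)) (gauss_sum l)"
      by (rule quad_elem_lift[OF quad_elem_gauss_sum odd_primes_dvd_conductor[OF l] n])
        (use odd_primesD[OF l] in auto)
    with insert show ?case
      using quad_elem_mult by (subst prod.insert; simp) blast
  qed
  from this[of "odd_primes D"] obtain \<delta> where odd_part:
    "quad_elem ?n (\<Prod>l\<in>odd_primes D. Legendre (-1) (int l) * int l) (\<lambda>k. \<Prod>l\<in>odd_primes D. Legendre k (int l)) \<delta>"
    by auto
  have "\<exists>\<delta>. quad_elem ?n (two_part D) (chi2 (two_part D)) \<delta>"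
  proof -
    have "D mod 4 \<noteq> 0" by (rule squarefree_mod_4[OF assms])
    then have "D mod 4 = 1 \<or> D mod 4 = 3 \<or> D mod 4 = 2 \<and> even D" by presburger
    then consider "D mod 4 = 1" | "D mod 4 = 3" | "D mod 4 = 2" "even D" by blast
    then show ?thesis
    proof cases
      case 1
      moreover have "chi2 1 = (\<lambda>_. 1)" by (auto simp: chi2_def)
      ultimately show ?thesis using quad_elem_1[of ?n] by (auto simp: two_part_def)
    next
      case 2
      then show ?thesis
        using quad_elem_lift[OF quad_elem_minus_1 _ n]
        by (auto simp: two_part_def conductor_def)
    next
      case 3
      then have "8 dvd ?n" by (auto simp: conductor_def even_nat_iff dest!: evenE)
      then show ?thesis
        using quad_elem_lift[OF quad_elem_2 _ n] quad_elem_lift[OF quad_elem_minus_2 _ n] 3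
        by (auto simp: two_part_def)
    qed
  qed
  then obtain \<delta>2 where "quad_elem ?n (two_part D) (chi2 (two_part D)) \<delta>2" ..
  from quad_elem_mult[OF this odd_part] that show ?thesis
    unfolding squarefree_decomposition[OF assms, symmetric] kronecker_def[abs_def] by blast
qed

lemma chi2_cases: "chi2 e k \<in> {1, -1}"
  by (simp add: chi2_def)

lemma chi2_cong: "[k = k'] (mod 8) \<Longrightarrow> chi2 e k = chi2 e k'"
proof -
  assume k: "[k = k'] (mod 8)"
  then have "[k = k'] (mod 4)" by (rule cong_dvd_modulus) simp
  with k show ?thesis by (simp add: chi2_def Cong.cong_def)
qed

lemma chi2_minus_1_cong: "[k = k'] (mod 4) \<Longrightarrow> chi2 (-1) k = chi2 (-1) k'"
  by (simp add: chi2_def Cong.cong_def)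

lemma chi2_mult:
  assumes "odd k" "odd l"
  shows "chi2 e (k * l) = chi2 e k * chi2 e l"
proof -
  have "k mod 8 \<in> {1, 3, 5, 7}" "l mod 8 \<in> {1, 3, 5, 7}"
    using assms by (simp; presburger)+
  moreover have "chi2 e (x * y) = chi2 e x * chi2 e y"
    if "x \<in> {1, 3, 5, 7}" "y \<in> {1, 3, 5, 7}" for x y
    using that by (elim insertE emptyE) (simp_all add: chi2_def)
  ultimately have "chi2 e ((k mod 8) * (l mod 8)) = chi2 e (k mod 8) * chi2 e (l mod 8)"
    by blast
  moreover have "chi2 e ((k mod 8) * (l mod 8)) = chi2 e (k * l)"
    "chi2 e (k mod 8) = chi2 e k" "chi2 e (l mod 8) = chi2 e l"
    by (rule chi2_cong; simp add: Cong.cong_def mod_mult_eq)+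
  ultimately show ?thesis by simp
qed

lemma coprime_conductorD:
  assumes "coprime k (int (conductor D))"
  shows "l \<in> odd_primes D \<Longrightarrow> \<not> int l dvd k" "D mod 4 \<noteq> 1 \<Longrightarrow> odd k"
proof -
  show "\<not> int l dvd k" if l: "l \<in> odd_primes D"
  proof
    assume "int l dvd k"
    moreover have "int l dvd int (conductor D)" using odd_primes_dvd_conductor[OF l] by simp
    ultimately have "is_unit (int l)" using assms by (rule coprime_common_divisor[rotated])
    then show False using odd_primesD(2)[OF l] by simp
  qed
  show "odd k" if "D mod 4 \<noteq> 1"
  proof
    assume "even k"
    moreover have "even (int (conductor D))" using that by (simp add: conductor_def)
    ultimately have "is_unit (2 :: int)" using assms by (rule coprime_common_divisor[rotated])
    then show False by simp
  qed
qed

lemma kronecker_cases: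
  assumes "coprime k (int (conductor D))"
  shows "kronecker D k \<in> {1, -1}"
proof -
  have "(\<Prod>l\<in>S. Legendre k (int l)) \<in> {1, -1}" if "finite S" "S \<subseteq> odd_primes D" for S
    using that
  proof (induction S)
    case (insert l S)
    then have "Legendre k (int l) \<in> {1, -1}"
      using Legendre_cases[of k "int l"] coprime_conductorD(1)[OF assms, of l] Legendre_eq_0_iff[of k "int l"]
      by auto
    with insert show ?case by auto
  qed simp
  from this[OF finite_odd_primes order.refl] chi2_cases[of "two_part D" k] show ?thesis
    by (auto simp: kronecker_def)
qed

lemma kronecker_mult:
  assumes "coprime k (int (conductor D))" "coprime l (int (conductor D))"
  shows "kronecker D (k * l) = kronecker D k * kronecker D l"
proof -
  have "chi2 (two_part D) (k * l) = chi2 (two_part D) k * chi2 (two_part D) l"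
    using chi2_mult[of k l] coprime_conductorD(2)[OF assms(1)] coprime_conductorD(2)[OF assms(2)]
    by (cases "D mod 4 = 1") (auto simp: two_part_def chi2_def)
  moreover have "(\<Prod>p\<in>odd_primes D. Legendre (k * l) (int p)) =
      (\<Prod>p\<in>odd_primes D. Legendre k (int p)) * (\<Prod>p\<in>odd_primes D. Legendre l (int p))"
    unfolding prod.distrib[symmetric]
    by (intro prod.cong refl Legendre_mult) (auto dest: odd_primesD)
  ultimately show ?thesis by (simp add: kronecker_def)
qed

lemma chi2_two_part_cong:
  assumes "squarefree D" and *: "[k = k'] (mod int (conductor_2 D))"
  shows "chi2 (two_part D) k = chi2 (two_part D) k'"
proof (cases "D mod 4 = 1")
  case True
  then show ?thesis by (simp add: two_part_def chi2_def)
next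
  case False
  show ?thesis
  proof (cases "odd D")
    case True
    with False have "D mod 4 = 3" by presburger
    then have "two_part D = -1" by (simp add: two_part_def)
    moreover have "[k = k'] (mod 4)" using * True False by (simp add: conductor_2_def)
    ultimately show ?thesis using chi2_minus_1_cong by simp
  next
    case even: False
    have "[k = k'] (mod 8)" using * False even by (simp add: conductor_2_def)
    then show ?thesis by (rule chi2_cong)
  qed
qed

lemma kronecker_cong:
  assumes "squarefree D" "[k = k'] (mod int (conductor D))"
  shows "kronecker D k = kronecker D k'"
proof -
  have "[k = k'] (mod int (conductor_2 D))"
    by (rule cong_dvd_modulus[OF assms(2)]) (simp add: conductor_eq[OF assms(1)])
  then have "chi2 (two_part D) k = chi2 (two_part D) k'"
    by (rule chi2_two_part_cong[OF assms(1)])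
  moreover have "Legendre k (int l) = Legendre k' (int l)" if "l \<in> odd_primes D" for l
    using cong_dvd_modulus[OF assms(2)] odd_primes_dvd_conductor[OF that]
    by (intro Legendre_cong) simp
  ultimately show ?thesis by (simp add: kronecker_def)
qed

lemma coprime_4_8_iff:
  "coprime 4 (n :: nat) \<longleftrightarrow> odd n" "coprime 8 n \<longleftrightarrow> odd n"
  "coprime n 4 \<longleftrightarrow> odd n" "coprime n 8 \<longleftrightarrow> odd n"
  using coprime_power_left_iff[of 2 2 n] coprime_power_left_iff[of 2 3 n]
  by (simp_all add: coprime_commute)

text \<open>The conductor can fail to divide m at an odd prime l or at 2. In each case u is chosen
  by Chinese remaindering to be nontrivial for the one local character concerned and trivial for all
  others.\<close>

lemma kronecker_primitive:
  assumes D: "squarefree D" and m: "m > 0" and "\<not> conductor D dvd m"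
  obtains u :: nat where "coprime u m" "coprime u (conductor D)" "[u = 1] (mod m)" "kronecker D (int u) = -1"
proof -
  let ?P = "\<Prod>l\<in>odd_primes D. l"
  have odd_P: "odd (\<Prod>l\<in>S. l)" if "S \<subseteq> odd_primes D" for S
    using that finite_subset[OF that finite_odd_primes]
    by (auto simp: even_prod_iff dest: odd_primesD(3))
  have Leg1: "Legendre (int u) (int l) = 1" if "[u = 1] (mod l)" "l \<in> odd_primes D" for u l
  proof -
    have "[int u = 1] (mod int l)" using that(1) by (metis cong_int_iff of_nat_1)
    then have "Legendre (int u) (int l) = Legendre 1 (int l)" by (rule Legendre_cong)
    also have "\<dots> = 1"
      using odd_primesD(2)[OF that(2)] by (auto simp: Legendre_def QuadRes_def cong_0_iff intro: exI[of _ 1])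
    finally show ?thesis .
  qed
  show ?thesis
  proof (cases "\<forall>l\<in>odd_primes D. l dvd m")
    case False
    then obtain l where l: "l \<in> odd_primes D" "\<not> l dvd m" by auto
    note lp = odd_primesD[OF l(1)]
    define S where "S = odd_primes D - {l}"
    \<comment> \<open>The factor 8 forces the 2-part of the character to be 1 at u, whatever the
      power of 2 in m.\<close>
    define n where "n = 8 * m * (\<Prod>l\<in>S. l)"
    obtain u0 where u0: "Legendre (int u0) (int l) = -1" using exists_Legendre_minus_1[OF lp(1,2)] .
    have "coprime l (\<Prod>l\<in>S. l)"
      by (intro prod_coprime_right primes_coprime lp(1)) (auto simp: S_def dest: odd_primesD)
    moreover have "coprime l 8" using lp(3) unfolding coprime_4_8_iff .
    moreover have "coprime l m" using lp(1) l(2) by (rule prime_imp_coprime)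
    ultimately have cop: "coprime l n" by (simp add: n_def)
    then obtain u where u: "[u = u0] (mod l)" "[u = 1] (mod n)"
      using binary_chinese_remainder_nat[of l n u0 1] by blast
    have dv: "[u = 1] (mod k)" if "k dvd n" for k
      using u(2) that by (rule cong_dvd_modulus_nat)
    have Pl: "?P = l * (\<Prod>l\<in>S. l)"
      unfolding S_def using l(1) by (intro prod.remove) auto
    have Lu: "Legendre (int u) (int l) = -1"
      using u(1) u0 Legendre_cong[of "int u" "int u0" "int l"] by (simp add: cong_int_iff)
    then have "\<not> l dvd u" using Legendre_eq_0_iff[of "int u" "int l"] by auto
    then have ul: "coprime u l" using prime_imp_coprime[OF lp(1), of u] by (simp add: coprime_commute)
    have un: "coprime u n" using u(2) by (metis cong_imp_coprime cong_sym coprime_1_left)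
    show ?thesis
    proof (rule that[of u])
      show "coprime u m" using un by (simp add: n_def)
      have "conductor D dvd n * l"
        unfolding conductor_eq[OF D] Pl n_def conductor_2_def
        by (auto intro!: mult_dvd_mono simp: mult_ac)
      moreover have "coprime u (n * l)" using un ul by simp
      ultimately show "coprime u (conductor D)" by (metis coprime_mult_right_iff dvdE)
      show "[u = 1] (mod m)" by (rule dv) (simp add: n_def)
      have "[int u = 1] (mod 8)" using dv[of 8] by (simp add: n_def flip: cong_int_iff)
      then have "chi2 (two_part D) (int u) = 1"
        using chi2_cong[of "int u" 1 "two_part D"] by (simp add: chi2_def)
      moreover have "(\<Prod>l\<in>S. Legendre (int u) (int l)) = 1"
      proof (intro prod.neutral ballI Leg1 dv)
        fix x assume x: "x \<in> S"
        then show "x dvd n" unfolding n_def by (intro dvd_mult dvd_prodI) (auto simp: S_def)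
      qed (auto simp: S_def)
      ultimately show "kronecker D (int u) = -1"
        using Lu prod.remove[OF finite_odd_primes l(1), of "\<lambda>l. Legendre (int u) (int l)"]
        by (simp add: kronecker_def S_def)
    qed
  next
    case True
    have "(\<Prod>l\<in>S. l) dvd m" if "finite S" "S \<subseteq> odd_primes D" for S
      using that
    proof (induction S)
      case (insert l S)
      have "coprime l (\<Prod>l\<in>S. l)"
      proof (intro prod_coprime_right primes_coprime)
        fix k assume "k \<in> S"
        with insert.prems show "prime l" "prime k" by (auto intro: odd_primesD(1))
        show "l \<noteq> k" using insert.hyps(2) \<open>k \<in> S\<close> by auto
      qed
      with insert True show ?case by (simp add: divides_mult)
    qed simp
    then have P: "?P dvd m" by simp
    have c2: "\<not> conductor_2 D dvd m"
    proof
      assume *: "conductor_2 D dvd m"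
      have "coprime (conductor_2 D) ?P"
        using odd_P[of "odd_primes D"] by (simp add: conductor_2_def coprime_4_8_iff)
      then have "conductor D dvd m"
        unfolding conductor_eq[OF D] using * P by (intro divides_mult)
      with assms(3) show False by simp
    qed
    then have D4: "D mod 4 \<noteq> 1" by (auto simp: conductor_2_def)
    define e where "e = multiplicity 2 m"
    obtain m' where m': "m = 2 ^ e * m'" "odd m'"
      using multiplicity_decompose'[of m 2] m by (auto simp: e_def)
    \<comment> \<open>3 is 1 modulo 2 but nontrivial for the character modulo 4; 5 is 1 modulo 4 but
      nontrivial for both characters of conductor 8. So u is 1 modulo the power of 2 in m, which is
      too small for the conductor.\<close>
    define c :: nat where "c = (if odd D then 3 else 5)"
    have "coprime 8 (m' * ?P)"
      using odd_P[of "odd_primes D"] m'(2) unfolding coprime_4_8_iff by simp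
    then obtain u where u: "[u = c] (mod 8)" "[u = 1] (mod m' * ?P)"
      using binary_chinese_remainder_nat[of 8 "m' * ?P" c 1] by blast
    have e: "e < (if odd D then 2 else 3)"
    proof (rule ccontr)
      assume "\<not> ?thesis"
      then have "2 ^ (if odd D then 2 else 3) dvd (2 ^ e :: nat)" by (intro le_imp_power_dvd) simp
      then have "conductor_2 D dvd m"
        using D4 unfolding m'(1) by (auto simp: conductor_2_def split: if_splits)
      with c2 show False by simp
    qed
    then have "e = 0 \<or> e = 1 \<or> (e = 2 \<and> even D)" by (auto split: if_splits)
    then have "[u = 1] (mod 2 ^ e)"
      using u(1) unfolding Cong.cong_def c_def by (elim disjE conjE; simp split: if_splits; presburger)
    moreover have "[u = 1] (mod m')" using u(2) by (rule cong_dvd_modulus_nat) simp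
    ultimately have um: "[u = 1] (mod m)"
      unfolding m'(1) using m'(2) by (intro coprime_cong_mult_nat) simp_all
    have "coprime u (m' * ?P)" using u(2) by (metis cong_imp_coprime cong_sym coprime_1_left)
    moreover have "odd u" using u(1) unfolding Cong.cong_def c_def by (simp split: if_splits; presburger)
    then have "coprime u 4" "coprime u 8" by (simp_all add: coprime_4_8_iff)
    ultimately have "coprime u (conductor D)"
      unfolding conductor_eq[OF D] conductor_2_def by simp
    moreover have "coprime u m" using um by (metis cong_imp_coprime cong_sym coprime_1_left)
    moreover have "Legendre (int u) (int l) = 1" if "l \<in> odd_primes D" for l
    proof (rule Leg1[OF cong_dvd_modulus_nat[OF u(2)] that])
      show "l dvd m' * ?P" using that by (intro dvd_mult dvd_prodI) auto
    qed
    moreover have "chi2 (two_part D) (int u) = -1"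
    proof -
      have "[int u = int c] (mod 8)" using u(1) by (simp flip: cong_int_iff)
      then have "chi2 (two_part D) (int u) = chi2 (two_part D) (int c)" by (rule chi2_cong)
      also have "\<dots> = -1" using D4 squarefree_mod_4[OF D]
        unfolding two_part_def chi2_def c_def by (auto; presburger)
      finally show ?thesis .
    qed
    ultimately show ?thesis using that[of u] um by (simp add: kronecker_def)
  qed
qed

section \<open>The cyclotomic character and the square root of the discriminant\<close>

text \<open>The exponent k of the image of \<open>zeta n\<close> is a unit by injectivity: with g =
  gcd k n, the power n/g of \<open>zeta n\<close> is sent to 1, hence is 1.\<close>

lemma cyc_char_props:
  assumes \<sigma>: "\<sigma> \<in> Gal_Q" and n: "n > 0"
  shows "cyc_char n \<sigma> \<in> zmod_units n" "\<sigma> (zeta n) = zeta n ^ nat (cyc_char n \<sigma>)"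
    "j \<in> zmod_units n \<Longrightarrow> \<sigma> (zeta n) = zeta n ^ nat j \<Longrightarrow> cyc_char n \<sigma> = j"
proof -
  have "\<sigma> (zeta n) ^ n = 1"
    using Gal_Q_power[OF \<sigma>, of "zeta n" n] n by (simp add: Gal_Q_simps[OF \<sigma>])
  then obtain k where k: "k < n" "\<sigma> (zeta n) = zeta n ^ k"
    by (rule root_unity_eq_zeta_power[OF n])
  have "coprime k n"
  proof -
    define g where "g = gcd k n"
    have g: "g dvd k" "g dvd n" "g > 0" using n by (auto simp: g_def)
    have "\<sigma> (zeta n ^ (n div g)) = zeta n ^ (k * (n div g))"
      by (simp add: Gal_Q_power[OF \<sigma>] k(2) power_mult)
    also have "k * (n div g) = n * (k div g)" using g by (metis div_mult_swap mult.commute)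
    also have "zeta n ^ \<dots> = \<sigma> 1" using n by (simp add: power_mult Gal_Q_simps[OF \<sigma>])
    finally have "\<sigma> (zeta n ^ (n div g)) = \<sigma> 1" .
    moreover have "inj_on \<sigma> Qbar" using \<sigma> by (auto simp: Gal_Q_def bij_betw_def)
    ultimately have "zeta n ^ (n div g) = zeta n ^ 0" by (auto dest: inj_onD)
    then have "n dvd n div g" unfolding zeta_power_cong_iff[OF n] by (simp add: cong_0_iff)
    moreover have "n div g > 0" using g n by (auto elim!: dvdE)
    ultimately have "n \<le> n div g" by (rule dvd_imp_le)
    then have "g = 1" using n g(3) by (metis div_less_dividend leD less_one nat_neq_iff)
    then show ?thesis unfolding g_def coprime_iff_gcd_eq_1 .
  qed
  then have "int k \<in> zmod_units n" using k(1) by (simp add: zmod_units_def)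
  moreover have uniq: "j = j'" if "j \<in> zmod_units n" "j' \<in> zmod_units n"
    "zeta n ^ nat j = zeta n ^ nat j'" for j j'
  proof -
    have "nat j mod n = nat j' mod n" using that zeta_power_cong_iff[OF n] by (simp add: Cong.cong_def)
    moreover have "nat j < n" "nat j' < n" using that by (auto simp: zmod_units_def)
    ultimately show ?thesis using that by (auto simp: zmod_units_def)
  qed
  ultimately have "\<exists>!k. k \<in> zmod_units n \<and> \<sigma> (zeta n) = zeta n ^ nat k"
    using k(2) by (intro ex1I[of _ "int k"]) auto
  from theI'[OF this]
  show *: "cyc_char n \<sigma> \<in> zmod_units n" "\<sigma> (zeta n) = zeta n ^ nat (cyc_char n \<sigma>)"
    by (simp_all add: cyc_char_def)
  show "cyc_char n \<sigma> = j" if "j \<in> zmod_units n" "\<sigma> (zeta n) = zeta n ^ nat j"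
    by (rule uniq) (use * that in auto)
qed

locale quadratic_discriminant =
  fixes a b D s :: int
  assumes Delta: "Delta a b = D * s\<^sup>2" "s \<noteq> 0" and sqf: "squarefree D"
begin

text \<open>\<open>csqrt\<close> picks one of the two roots; which one is immaterial, since an
  automorphism acts on both by the same sign.\<close>

lemma sqrt_Delta:
  obtains \<gamma> where "quad_elem (conductor D) D (kronecker D) \<gamma>"
    "csqrt (of_int (Delta a b)) = of_int s * \<gamma> \<or> csqrt (of_int (Delta a b)) = of_int (- s) * \<gamma>"
proof -
  obtain \<gamma> where \<gamma>: "quad_elem (conductor D) D (kronecker D) \<gamma>" using exists_quad_elem[OF sqf] .
  have "(csqrt (of_int (Delta a b)))\<^sup>2 = (of_int s * \<gamma>)\<^sup>2"
    using \<gamma> by (simp add: quad_elem_def Delta power_mult_distrib mult.commute)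
  then have "csqrt (of_int (Delta a b)) = of_int s * \<gamma> \<or> csqrt (of_int (Delta a b)) = of_int (- s) * \<gamma>"
    unfolding power2_eq_iff by simp
  with \<gamma> that show ?thesis by blast
qed

lemma sqrt_Delta_nonzero: "csqrt (of_int (Delta a b)) \<noteq> 0"
  using Delta sqf by auto

lemma Gal_Q_sqrt_Delta:
  assumes "\<sigma> \<in> Gal_Q" "coprime k (conductor D)" "\<sigma> (zeta (conductor D)) = zeta (conductor D) ^ k"
  shows "\<sigma> (csqrt (of_int (Delta a b))) = of_int (kronecker D (int k)) * csqrt (of_int (Delta a b))"
proof -
  obtain \<gamma> where \<gamma>: "quad_elem (conductor D) D (kronecker D) \<gamma>"
    "csqrt (of_int (Delta a b)) = of_int s * \<gamma> \<or> csqrt (of_int (Delta a b)) = of_int (- s) * \<gamma>"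
    using sqrt_Delta .
  have Q: "\<gamma> \<in> Qbar" using \<gamma>(1) Q_adjoin_zeta_Qbar by (auto simp: quad_elem_def)
  have "\<sigma> \<gamma> = of_int (kronecker D (int k)) * \<gamma>"
    using \<gamma>(1) assms unfolding quad_elem_def by blast
  then have "\<sigma> (of_int c * \<gamma>) = of_int (kronecker D (int k)) * (of_int c * \<gamma>)" for c
    using Gal_Q_simps(2)[OF assms(1) Qbar_simps(3)[of c] Q] Gal_Q_simps(3)[OF assms(1), of c] by simp
  then show ?thesis using \<gamma>(2) by metis
qed

lemma sqrt_Delta_in: "csqrt (of_int (Delta a b)) \<in> Q_adjoin (zeta (conductor D))"
proof -
  obtain \<gamma> where \<gamma>: "quad_elem (conductor D) D (kronecker D) \<gamma>"
    "csqrt (of_int (Delta a b)) = of_int s * \<gamma> \<or> csqrt (of_int (Delta a b)) = of_int (- s) * \<gamma>"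
    using sqrt_Delta .
  have "of_int c * \<gamma> \<in> Q_adjoin (zeta (conductor D))" for c
    using \<gamma>(1) by (intro is_subfieldD(4) is_subfield_Q_adjoin is_subfield_of_int) (simp add: quad_elem_def)
  with \<gamma>(2) show ?thesis by metis
qed

text \<open>An automorphism whose exponent is 1 modulo n fixes the n-th cyclotomic field pointwise.
  If the conductor did not divide n, one of these would negate the square root.\<close>

lemma conductor_dvd:
  assumes "n > 0" and sub: "Q_adjoin (csqrt (of_int (Delta a b))) \<subseteq> Q_adjoin (zeta n)"
  shows "conductor D dvd n"
proof (rule ccontr)
  let ?r = "csqrt (of_int (Delta a b))"
  assume "\<not> conductor D dvd n"
  then obtain u where u: "coprime u n" "coprime u (conductor D)" "[u = 1] (mod n)"
      "kronecker D (int u) = -1"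
    using kronecker_primitive[OF sqf assms(1)] by metis
  \<comment> \<open>A common multiple of both moduli, so that a single exponent u governs both roots
    of unity.\<close>
  let ?N = "n * conductor D"
  have N: "?N > 0" using assms(1) conductor_pos[OF sqf] by simp
  obtain \<sigma> where \<sigma>: "\<sigma> \<in> Gal_Q" "\<sigma> (zeta ?N) = zeta ?N ^ u"
    using Gal_Q_zeta_power[OF N, of u] u(1,2) by auto
  have z: "\<sigma> (zeta d) = zeta d ^ u" if "d dvd ?N" for d
    using \<sigma> by (simp add: zeta_div[OF that N] Gal_Q_power flip: power_mult) (simp add: mult.commute)
  have "zeta n ^ u = zeta n ^ 1" using u(3) by (simp only: zeta_power_cong_iff[OF assms(1)])
  then have fix_n: "\<sigma> (zeta n) = zeta n" using z[of n] by simp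
  let ?K = "{x \<in> Qbar. \<sigma> x = x}"
  have inv: "\<sigma> (inverse x) = inverse x" "\<sigma> (- x) = - x" if "x \<in> Qbar" "\<sigma> x = x" for x
  proof -
    have "inverse x \<in> Qbar" using that(1) by (auto simp: Qbar_def)
    then have "\<sigma> (x * inverse x) = x * \<sigma> (inverse x)" "\<sigma> (inverse x * x) = \<sigma> (inverse x) * x"
      using Gal_Q_simps(2)[OF \<sigma>(1)] that by auto
    then show "\<sigma> (inverse x) = inverse x"
      by (cases "x = 0") (auto simp: Gal_Q_simps[OF \<sigma>(1)] field_simps)
    show "\<sigma> (- x) = - x"
      using Gal_Q_simps(2)[OF \<sigma>(1) Qbar_simps(3)[of "-1"] that(1)] Gal_Q_simps(3)[OF \<sigma>(1), of "-1"] that(2)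
      by simp
  qed
  have "is_subfield ?K"
    unfolding is_subfield_def
    using Gal_Q_simps[OF \<sigma>(1)] inv by (auto simp: Qbar_def)
  then have "Q_adjoin (zeta n) \<subseteq> ?K"
    using fix_n by (intro Q_adjoin_minimal) auto
  then have "\<sigma> ?r = ?r" using sub Q_adjoin_base[of ?r] by auto
  moreover have "\<sigma> ?r = - ?r"
    using Gal_Q_sqrt_Delta[OF \<sigma>(1) u(2) z] u(4) by simp
  ultimately show False using sqrt_Delta_nonzero by simp
qed

theorem d_E_eq: "d_E a b = conductor D"
  unfolding d_E_def
proof (rule Least_equality)
  show "0 < conductor D \<and> Q_adjoin (csqrt (of_int (Delta a b))) \<subseteq> Q_adjoin (zeta (conductor D))"
    using conductor_pos[OF sqf] sqrt_Delta_in Q_adjoin_minimal is_subfield_Q_adjoin by blast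
  fix n assume "0 < n \<and> Q_adjoin (csqrt (of_int (Delta a b))) \<subseteq> Q_adjoin (zeta n)"
  then show "conductor D \<le> n" using conductor_dvd by (auto intro: dvd_imp_le)
qed

text \<open>Every unit k is the cyclotomic character of some automorphism, and its effect on the
  nonzero square root determines the value at k. This gives the uniqueness behind the definite
  description.\<close>

theorem alpha_E_eq:
  assumes "k \<in> zmod_units (conductor D)"
  shows "alpha_E a b k = kronecker D k"
proof -
  let ?d = "conductor D" and ?r = "csqrt (of_int (Delta a b))"
  let ?\<alpha> = "restrict (kronecker D) (zmod_units ?d)"
  have d: "?d > 0" by (rule conductor_pos[OF sqf])
  have units: "k * l mod int ?d \<in> zmod_units ?d" if "k \<in> zmod_units ?d" "l \<in> zmod_units ?d" for k l
    using that d by (auto simp: zmod_units_def)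
  have "alpha_E a b = ?\<alpha>"
    unfolding alpha_E_def d_E_eq
  proof (rule the_equality, intro conjI ballI)
    show "?\<alpha> \<in> zmod_units ?d \<rightarrow>\<^sub>E {1, -1}"
      using kronecker_cases by (auto simp: zmod_units_def)
    show "?\<alpha> (k * l mod int ?d) = ?\<alpha> k * ?\<alpha> l" if "k \<in> zmod_units ?d" "l \<in> zmod_units ?d" for k l
    proof -
      have "kronecker D (k * l mod int ?d) = kronecker D (k * l)"
        by (rule kronecker_cong[OF sqf]) simp
      also have "\<dots> = kronecker D k * kronecker D l"
        using that by (intro kronecker_mult) (auto simp: zmod_units_def)
      finally show ?thesis using that units[OF that] by simp
    qed
    have unit_nat: "coprime (nat k) ?d" "int (nat k) = k" if "k \<in> zmod_units ?d" for k
      using that by (auto simp: zmod_units_def simp flip: coprime_int_iff)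
    show "\<sigma> ?r = of_int (?\<alpha> (cyc_char ?d \<sigma>)) * ?r" if "\<sigma> \<in> Gal_Q" for \<sigma>
      using Gal_Q_sqrt_Delta[OF that _ cyc_char_props(2)[OF that d]] unit_nat cyc_char_props(1)[OF that d]
      by simp
    fix \<beta> assume \<beta>: "\<beta> \<in> zmod_units ?d \<rightarrow>\<^sub>E {1, -1}
       \<and> (\<forall>k\<in>zmod_units ?d. \<forall>l\<in>zmod_units ?d. \<beta> (k * l mod int ?d) = \<beta> k * \<beta> l)
       \<and> (\<forall>\<sigma>\<in>Gal_Q. \<sigma> ?r = of_int (\<beta> (cyc_char ?d \<sigma>)) * ?r)"
    show "\<beta> = ?\<alpha>"
    proof
      fix k
      show "\<beta> k = ?\<alpha> k"
      proof (cases "k \<in> zmod_units ?d")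
        case False
        then show ?thesis using \<beta> by (auto simp: PiE_def extensional_def)
      next
        case True
        obtain \<sigma> where \<sigma>: "\<sigma> \<in> Gal_Q" "\<sigma> (zeta ?d) = zeta ?d ^ nat k"
          using Gal_Q_zeta_power[OF d unit_nat(1)[OF True]] .
        have "cyc_char ?d \<sigma> = k" by (rule cyc_char_props(3)[OF \<sigma>(1) d True \<sigma>(2)])
        then have "\<sigma> ?r = of_int (\<beta> k) * ?r" using \<beta> \<sigma>(1) by auto
        moreover have "\<sigma> ?r = of_int (kronecker D k) * ?r"
          using Gal_Q_sqrt_Delta[OF \<sigma>(1) unit_nat(1)[OF True] \<sigma>(2)] unit_nat(2)[OF True] by simp
        ultimately show ?thesis using sqrt_Delta_nonzero True by simp
      qed
    qed
  qed
  then show ?thesis using assms by simp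
qed

end

section \<open>Singular matrices modulo prime powers\<close>

text \<open>Quadruples stand for matrices here: as products of intervals they allow nested sums,
  expansion in digits and explicit reindexing.\<close>

definition quads :: "nat \<Rightarrow> (int \<times> int \<times> int \<times> int) set" where
  "quads n = {0..<int n} \<times> {0..<int n} \<times> {0..<int n} \<times> {0..<int n}"

definition qsum :: "nat \<Rightarrow> (int \<Rightarrow> int \<Rightarrow> int \<Rightarrow> int \<Rightarrow> int) \<Rightarrow> int" where
  "qsum n F = (\<Sum>(a, b, c, d)\<in>quads n. F a b c d)"

definition sing_sum :: "nat \<Rightarrow> (int \<Rightarrow> int \<Rightarrow> int \<Rightarrow> int \<Rightarrow> int) \<Rightarrow> int" where
  "sing_sum n F = qsum n (\<lambda>a b c d. if int n dvd a * d - b * c then F a b c d else 0)"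

definition periodic :: "nat \<Rightarrow> (int \<Rightarrow> int \<Rightarrow> int \<Rightarrow> int \<Rightarrow> int) \<Rightarrow> bool" where
  "periodic n F \<longleftrightarrow> (\<forall>a b c d. F (a mod int n) (b mod int n) (c mod int n) (d mod int n) = F a b c d)"

lemma finite_quads [simp]: "finite (quads n)"
  by (simp add: quads_def)

lemma card_quads: "card (quads n) = n ^ 4"
  by (simp add: quads_def card_cartesian_product power_numeral_reduce)

lemma qsum_const [simp]: "qsum n (\<lambda>a b c d. x) = int n ^ 4 * x"
  by (simp add: qsum_def card_quads case_prod_unfold)

lemma qsum_cong:
  "(\<And>a b c d. (a, b, c, d) \<in> quads n \<Longrightarrow> F a b c d = G a b c d) \<Longrightarrow> qsum n F = qsum n G"
  unfolding qsum_def by (intro sum.cong) auto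

lemma qsum_add: "qsum n (\<lambda>a b c d. F a b c d + G a b c d) = qsum n F + qsum n G"
  by (simp add: qsum_def case_prod_unfold sum.distrib)

lemma qsum_mult: "qsum n (\<lambda>a b c d. k * F a b c d) = k * qsum n F"
  by (simp add: qsum_def case_prod_unfold sum_distrib_left)

lemma digit_range:
  assumes "x \<in> {0..<int n}" "y \<in> {0..<int k}"
  shows "x + int n * y \<in> {0..<int (n * k)}"
proof -
  have "int n * y \<le> int n * (int k - 1)" using assms by (intro mult_left_mono) auto
  then show ?thesis using assms by (auto simp: algebra_simps)
qed

lemma div_digit_range:
  assumes "z \<in> {0..<int (n * k)}"
  shows "z div int n \<in> {0..<int k}"
proof -
  have n: "int n > 0" using assms by (cases n) auto
  have "z div int n < int k"
  proof (rule ccontr)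
    assume "\<not> ?thesis"
    then have "int n * int k \<le> int n * (z div int n)" using n by (intro mult_left_mono) auto
    also have "\<dots> \<le> z" using n minus_mod_eq_mult_div[of z "int n"] by (simp flip: minus_mod_eq_mult_div)
    finally show False using assms by simp
  qed
  with assms n show ?thesis by (simp add: pos_imp_zdiv_nonneg_iff)
qed

text \<open>Each residue modulo n k is a + n x for unique digits a < n and x < k.\<close>

lemma qsum_split:
  "qsum (n * k) F = qsum n (\<lambda>a b c d. qsum k (\<lambda>x y z w.
     F (a + int n * x) (b + int n * y) (c + int n * z) (d + int n * w)))"
proof (cases "n = 0")
  case True
  then show ?thesis by (simp add: qsum_def quads_def)
next
  case False
  have "qsum n (\<lambda>a b c d. qsum k (\<lambda>x y z w.
      F (a + int n * x) (b + int n * y) (c + int n * z) (d + int n * w))) =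
    (\<Sum>((a, b, c, d), (x, y, z, w))\<in>quads n \<times> quads k.
      F (a + int n * x) (b + int n * y) (c + int n * z) (d + int n * w))"
    unfolding qsum_def sum.cartesian_product[symmetric] by (simp add: case_prod_unfold)
  also have "\<dots> = qsum (n * k) F"
  proof -
    define I where "I m = {0..<int m}" for m
    have quads: "quads m = I m \<times> I m \<times> I m \<times> I m" for m by (simp add: quads_def I_def)
    have I: "x + int n * y \<in> I (n * k)" "(x + int n * y) mod int n = x" "(x + int n * y) div int n = y"
      if "x \<in> I n" "y \<in> I k" for x y
      using that digit_range[of x n y k] by (auto simp: I_def)
    have J: "z mod int n \<in> I n" "z div int n \<in> I k" if "z \<in> I (n * k)" for z
      using that div_digit_range[of z n k] False by (auto simp: I_def)
    have K: "x mod int n = x" if "x \<in> I n" for x using that by (simp add: I_def)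
    show ?thesis
      unfolding qsum_def
      by (rule sum.reindex_bij_witness[where
            i = "\<lambda>(a, b, c, d). ((a mod int n, b mod int n, c mod int n, d mod int n),
                   (a div int n, b div int n, c div int n, d div int n))" and
            j = "\<lambda>((a, b, c, d), (x, y, z, w)). (a + int n * x, b + int n * y, c + int n * z, d + int n * w)"])
         (auto simp: quads I J K)
  qed
  finally show ?thesis by simp
qed

lemma periodicD:
  assumes "periodic n F"
  shows "F (a mod int n) (b mod int n) (c mod int n) (d mod int n) = F a b c d"
    "F (a + int n * x) (b + int n * y) (c + int n * z) (d + int n * w) = F a b c d"
proof -
  show *: "F (a mod int n) (b mod int n) (c mod int n) (d mod int n) = F a b c d" for a b c d
    using assms by (simp add: periodic_def)
  show "F (a + int n * x) (b + int n * y) (c + int n * z) (d + int n * w) = F a b c d"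
    using *[of "a + int n * x" "b + int n * y" "c + int n * z" "d + int n * w"] *[of a b c d] by simp
qed

lemma qsum_periodic:
  "periodic n F \<Longrightarrow> qsum (n * k) F = int k ^ 4 * qsum n F"
  unfolding qsum_split by (simp add: periodicD(2) qsum_mult)

lemma periodic_if_det:
  assumes "periodic n F" "N dvd int n"
  shows "periodic n (\<lambda>a b c d. if N dvd a * d - b * c then F a b c d else 0)"
proof -
  have "N dvd (a mod int n) * (d mod int n) - (b mod int n) * (c mod int n) \<longleftrightarrow> N dvd a * d - b * c" for a b c d
  proof -
    have "[(a mod int n) * (d mod int n) - (b mod int n) * (c mod int n) = a * d - b * c] (mod int n)"
      by (intro cong_diff cong_mult) simp_all
    then show ?thesis using assms(2) by (meson cong_dvd_iff cong_dvd_modulus)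
  qed
  then show ?thesis using periodicD(1)[OF assms(1)] unfolding periodic_def by simp
qed

lemma sum_of_bool_ex1:
  assumes "finite A" "\<exists>!x. x \<in> A \<and> P x"
  shows "(\<Sum>x\<in>A. if P x then 1 else 0 :: int) = 1"
proof -
  from assms(2) obtain x where "{y \<in> A. P y} = {x}" by blast
  then have "card {y \<in> A. P y} = 1" by simp
  then show ?thesis using assms(1) by (simp add: sum.If_cases Int_def)
qed

section \<open>Counting singular lifts\<close>

text \<open>The number of matrices modulo l^(i+1) that are singular there and reduce to the given
  one modulo l.\<close>

definition sing_lifts :: "nat \<Rightarrow> nat \<Rightarrow> int \<Rightarrow> int \<Rightarrow> int \<Rightarrow> int \<Rightarrow> int" where
  "sing_lifts l i a b c d = qsum (l ^ i) (\<lambda>x y z w. if int (l ^ Suc i) dvd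
     (a + int l * x) * (d + int l * w) - (b + int l * y) * (c + int l * z) then 1 else 0)"

lemma sing_lifts_swap:
  "sing_lifts l i a b c d = sing_lifts l i c d a b" (is ?rows)
  "sing_lifts l i a b c d = sing_lifts l i b a d c" (is ?cols)
proof -
  show ?rows unfolding sing_lifts_def qsum_def
    by (rule sum.reindex_bij_witness[where i = "\<lambda>(x, y, z, w). (z, w, x, y)" and j = "\<lambda>(x, y, z, w). (z, w, x, y)"])
       (auto simp: quads_def algebra_simps dvd_diff_commute)
  show ?cols unfolding sing_lifts_def qsum_def
    by (rule sum.reindex_bij_witness[where i = "\<lambda>(x, y, z, w). (y, x, w, z)" and j = "\<lambda>(x, y, z, w). (y, x, w, z)"])
       (auto simp: quads_def algebra_simps dvd_diff_commute)
qed

text \<open>Hensel's lemma in the linear case: after division by l the condition on w is a linear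
  congruence with unit coefficient a.\<close>

lemma unique_lift:
  assumes l: "prime l" and a: "\<not> int l dvd a" and det: "int l dvd a * d - m"
  shows "\<exists>!w. w \<in> {0..<int (l ^ i)} \<and> int (l ^ Suc i) dvd a * (d + int l * w) - m"
proof (rule ex_ex1I)
  have l0: "int l > 0" using prime_gt_0_nat[OF l] by simp
  have "coprime a (int l)"
    using a l by (metis coprime_commute prime_imp_coprime prime_nat_int_transfer)
  then have cop: "coprime a (int (l ^ i))" by simp
  from det obtain t where t: "a * d - m = int l * t" by (elim dvdE)
  obtain a' where a': "[a * a' = 1] (mod int (l ^ i))"
    using cong_solve_coprime_int[OF cop] by blast
  have key: "int (l ^ Suc i) dvd a * (d + int l * w) - m \<longleftrightarrow> int (l ^ i) dvd t + a * w" for w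
  proof -
    have "a * (d + int l * w) - m = int l * (t + a * w)" using t by (simp add: algebra_simps)
    then show ?thesis using l0 by simp
  qed
  let ?w = "(- a' * t) mod int (l ^ i)"
  have "[t + a * ?w = t + a * (- a' * t)] (mod int (l ^ i))"
    by (intro cong_add cong_mult) simp_all
  also have "t + a * (- a' * t) = t - (a * a') * t" by (simp add: algebra_simps)
  also have "[t - (a * a') * t = t - 1 * t] (mod int (l ^ i))"
    by (intro cong_diff cong_mult a') simp_all
  finally have "int (l ^ i) dvd t + a * ?w" by (simp add: cong_0_iff)
  moreover have "?w \<in> {0..<int (l ^ i)}" using l0 by simp
  ultimately show "\<exists>w. w \<in> {0..<int (l ^ i)} \<and> int (l ^ Suc i) dvd a * (d + int l * w) - m"
    unfolding key by blast
  fix w w' assume w: "w \<in> {0..<int (l ^ i)} \<and> int (l ^ Suc i) dvd a * (d + int l * w) - m"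
    and w': "w' \<in> {0..<int (l ^ i)} \<and> int (l ^ Suc i) dvd a * (d + int l * w') - m"
  then have "int (l ^ i) dvd (t + a * w) - (t + a * w')" unfolding key by (intro dvd_diff) auto
  then have "int (l ^ i) dvd a * (w - w')" by (simp add: algebra_simps)
  then have "int (l ^ i) dvd w - w'" using cop by (metis coprime_commute coprime_dvd_mult_right_iff)
  then have "[w = w'] (mod int (l ^ i))" by (simp add: cong_iff_dvd_diff)
  then show "w = w'" using w w' by (simp add: Cong.cong_def)
qed

text \<open>The digits of a, b, c are free and that of d is then determined, whence l^(3i).\<close>

lemma sing_lifts_unit:
  assumes l: "prime l" and a: "\<not> int l dvd a"
  shows "sing_lifts l i a b c d = (if int l dvd a * d - b * c then int l ^ (3 * i) else 0)"
proof -
  let ?I = "{0..<int (l ^ i)}"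
  let ?P = "\<lambda>x y z w. int (l ^ Suc i) dvd
     (a + int l * x) * (d + int l * w) - (b + int l * y) * (c + int l * z)"
  have inner: "(\<Sum>w\<in>?I. if ?P x y z w then 1 else 0) = (if int l dvd a * d - b * c then 1 else 0 :: int)"
    for x y z
  proof -
    have eq: "(a + int l * x) * d - (b + int l * y) * (c + int l * z) =
        a * d - b * c + int l * (x * d - b * z - y * c - int l * y * z)" by (simp add: algebra_simps)
    have dv: "int l dvd (a + int l * x) * d - (b + int l * y) * (c + int l * z) \<longleftrightarrow> int l dvd a * d - b * c"
      unfolding eq by (simp add: dvd_add_left_iff)
    show ?thesis
    proof (cases "int l dvd a * d - b * c")
      case True
      have "\<not> int l dvd a + int l * x" using a by (simp add: dvd_add_left_iff)
      from unique_lift[OF l this, of d "(b + int l * y) * (c + int l * z)" i] True dv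
      show ?thesis using True by (subst sum_of_bool_ex1) auto
    next
      case False
      have "\<not> ?P x y z w" for w
      proof
        assume "?P x y z w"
        then have "int l dvd (a + int l * x) * (d + int l * w) - (b + int l * y) * (c + int l * z)"
          by (rule dvd_trans[rotated]) simp
        moreover have "(a + int l * x) * (d + int l * w) - (b + int l * y) * (c + int l * z) =
          (a + int l * x) * d - (b + int l * y) * (c + int l * z) + int l * (w * (a + int l * x))"
          by (simp add: algebra_simps)
        ultimately have "int l dvd (a + int l * x) * d - (b + int l * y) * (c + int l * z)"
          by (simp only: dvd_add_left_iff dvd_triv_left)
        with False dv show False by simp
      qed
      then show ?thesis using False by simp
    qed
  qed
  have "sing_lifts l i a b c d = (\<Sum>x\<in>?I. \<Sum>y\<in>?I. \<Sum>z\<in>?I. \<Sum>w\<in>?I. if ?P x y z w then 1 else 0)"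
    unfolding sing_lifts_def qsum_def quads_def sum.cartesian_product[symmetric] by simp
  also have "\<dots> = int l ^ (3 * i) * (if int l dvd a * d - b * c then 1 else 0)"
    unfolding inner by (simp add: power_mult power3_eq_cube power_mult_distrib)
  finally show ?thesis by simp
qed

text \<open>Swapping rows or columns moves a unit entry to the upper left corner and changes the
  determinant by a sign at most.\<close>

lemma sing_lifts_nonzero:
  assumes l: "prime l" and "\<not> (int l dvd a \<and> int l dvd b \<and> int l dvd c \<and> int l dvd d)"
  shows "sing_lifts l i a b c d = (if int l dvd a * d - b * c then int l ^ (3 * i) else 0)"
proof -
  consider "\<not> int l dvd a" | "\<not> int l dvd b" | "\<not> int l dvd c" | "\<not> int l dvd d" using assms(2) by blast
  then show ?thesis
  proof cases
    case 1
    then show ?thesis by (rule sing_lifts_unit[OF l])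
  next
    case 2
    then show ?thesis
      using sing_lifts_unit[OF l 2, of i a d c] sing_lifts_swap(2)[of l i a b c d]
      by (simp add: dvd_diff_commute)
  next
    case 3
    then show ?thesis
      using sing_lifts_unit[OF l 3, of i d a b] sing_lifts_swap(1)[of l i a b c d]
      by (simp add: dvd_diff_commute mult.commute)
  next
    case 4
    then show ?thesis
      using sing_lifts_unit[OF l 4, of i c b a] sing_lifts_swap(1)[of l i a b c d] sing_lifts_swap(2)[of l i c d a b]
      by (simp add: mult.commute)
  qed
qed

text \<open>All matrices that are nonzero modulo l follow the uniform count of lifts. The zero
  matrix alone deviates, and its term is split off.\<close>

lemma sing_sum_prime_power:
  assumes l: "prime l" and F: "periodic l F"
  shows "sing_sum (l ^ Suc i) F =
    int l ^ (3 * i) * (sing_sum l F - F 0 0 0 0) + F 0 0 0 0 * sing_lifts l i 0 0 0 0"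
proof -
  have l0: "l > 0" by (rule prime_gt_0_nat[OF l])
  let ?L = "\<lambda>a b c d. if int l dvd a * d - b * c then int l ^ (3 * i) else 0"
  have "sing_sum (l ^ Suc i) F = qsum l (\<lambda>a b c d. F a b c d * sing_lifts l i a b c d)"
    unfolding sing_sum_def power_Suc qsum_split sing_lifts_def
    by (simp add: periodicD(2)[OF F] qsum_mult[symmetric] if_distrib cong: if_cong)
  also have "\<dots> = qsum l (\<lambda>a b c d. int l ^ (3 * i) * (if int l dvd a * d - b * c then F a b c d else 0)
      + (if (a, b, c, d) = (0, 0, 0, 0) then F 0 0 0 0 * (sing_lifts l i 0 0 0 0 - int l ^ (3 * i)) else 0))"
  proof (rule qsum_cong)
    fix a b c d assume "(a, b, c, d) \<in> quads l"
    then have "x \<in> {0..<int l}" if "x \<in> {a, b, c, d}" for x using that by (auto simp: quads_def)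
    then have zero: "int l dvd x \<longleftrightarrow> x = 0" if "x \<in> {a, b, c, d}" for x
      using that by (metis atLeastLessThan_iff dvd_0_right zdvd_not_zless order_le_less)
    show "F a b c d * sing_lifts l i a b c d =
      int l ^ (3 * i) * (if int l dvd a * d - b * c then F a b c d else 0)
      + (if (a, b, c, d) = (0, 0, 0, 0) then F 0 0 0 0 * (sing_lifts l i 0 0 0 0 - int l ^ (3 * i)) else 0)"
    proof (cases "(a, b, c, d) = (0, 0, 0, 0)")
      case True
      then show ?thesis by (simp add: algebra_simps)
    next
      case False
      then have "sing_lifts l i a b c d = ?L a b c d"
        by (intro sing_lifts_nonzero[OF l]) (auto simp: zero)
      then show ?thesis unfolding if_not_P[OF False] by simp
    qed
  qed
  also have "\<dots> = int l ^ (3 * i) * sing_sum l F + F 0 0 0 0 * (sing_lifts l i 0 0 0 0 - int l ^ (3 * i))"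
  proof -
    have "qsum l (\<lambda>a b c d. if (a, b, c, d) = (0, 0, 0, 0) then x else 0) =
        (\<Sum>q\<in>quads l. if q = (0, 0, 0, 0) then x else 0)" for x
      unfolding qsum_def by (intro sum.cong) (auto split: if_splits)
    moreover have "(0, 0, 0, 0) \<in> quads l" using l0 by (simp add: quads_def)
    ultimately have "qsum l (\<lambda>a b c d. if (a, b, c, d) = (0, 0, 0, 0) then x else 0) = x" for x
      by simp
    then show ?thesis unfolding qsum_add qsum_mult sing_sum_def by simp
  qed
  finally show ?thesis by (simp add: algebra_simps)
qed

text \<open>A lift of zero is l X, with determinant l^2 det X. The condition concerns X modulo l^k
  while X ranges modulo l^(k+1), whence the factor l^4.\<close>

lemma sing_lifts_zero:
  assumes "l > 0"
  shows "sing_lifts l 0 0 0 0 0 = 1"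
    "sing_lifts l (Suc k) 0 0 0 0 = int l ^ 4 * sing_sum (l ^ k) (\<lambda>a b c d. 1)"
proof -
  show "sing_lifts l 0 0 0 0 0 = 1"
    by (simp add: sing_lifts_def qsum_def quads_def)
  have "sing_lifts l (Suc k) 0 0 0 0 =
      qsum (l ^ k * l) (\<lambda>x y z w. if int (l ^ k) dvd x * w - y * z then 1 else 0)"
  proof -
    have "int l * x * (int l * w) - int l * y * (int l * z) = int l * (int l * (x * w - y * z))" for x y z w
      by (simp add: algebra_simps)
    then show ?thesis
      using assms by (simp add: sing_lifts_def mult.commute[of l])
  qed
  also have "\<dots> = int l ^ 4 * sing_sum (l ^ k) (\<lambda>a b c d. 1)"
    unfolding sing_sum_def by (rule qsum_periodic[OF periodic_if_det]) (auto simp: periodic_def)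
  finally show "sing_lifts l (Suc k) 0 0 0 0 = int l ^ 4 * sing_sum (l ^ k) (\<lambda>a b c d. 1)" .
qed

section \<open>Weights that depend on the trace\<close>

lemma unique_solution:
  assumes "coprime b (int n)" "n > 0"
  shows "\<exists>!c. c \<in> {0..<int n} \<and> int n dvd x - b * c"
proof (rule ex_ex1I)
  obtain b' where b': "[b * b' = 1] (mod int n)"
    using cong_solve_coprime_int[OF assms(1)] by blast
  have "[b * ((b' * x) mod int n) = b * (b' * x)] (mod int n)"
    by (intro cong_mult) simp_all
  also have "b * (b' * x) = (b * b') * x" by simp
  also have "[(b * b') * x = 1 * x] (mod int n)" by (intro cong_mult b') simp
  finally have "int n dvd x - b * ((b' * x) mod int n)"
    by (simp add: cong_iff_dvd_diff dvd_diff_commute[of _ x])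
  then show "\<exists>c. c \<in> {0..<int n} \<and> int n dvd x - b * c"
    using assms(2) by (intro exI[of _ "(b' * x) mod int n"]) simp
  fix c c' assume c: "c \<in> {0..<int n} \<and> int n dvd x - b * c" and c': "c' \<in> {0..<int n} \<and> int n dvd x - b * c'"
  then have "int n dvd (x - b * c') - (x - b * c)" by (blast intro: dvd_diff)
  then have "int n dvd b * (c - c')" by (simp add: algebra_simps)
  then have "int n dvd c - c'" using assms(1) by (metis coprime_commute coprime_dvd_mult_right_iff)
  then have "[c = c'] (mod int n)" by (simp add: cong_iff_dvd_diff)
  then show "c = c'" using c c' by (simp add: Cong.cong_def)
qed

lemma sum_periodic_shift:
  fixes g :: "int \<Rightarrow> int"
  assumes "\<And>t. g (t mod int n) = g t" "n > 0"
  shows "(\<Sum>d\<in>{0..<int n}. g (a + d)) = (\<Sum>d\<in>{0..<int n}. g d)"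
  by (rule sum.reindex_bij_witness[where i = "\<lambda>d. (d - a) mod int n" and j = "\<lambda>d. (a + d) mod int n"])
     (use assms in \<open>auto simp: mod_simps\<close>)

lemma qsum_nested:
  "qsum n F = (\<Sum>a\<in>{0..<int n}. \<Sum>d\<in>{0..<int n}. \<Sum>b\<in>{0..<int n}. \<Sum>c\<in>{0..<int n}. F a b c d)"
proof -
  let ?I = "{0..<int n}"
  have "qsum n F = (\<Sum>a\<in>?I. \<Sum>b\<in>?I. \<Sum>c\<in>?I. \<Sum>d\<in>?I. F a b c d)"
    unfolding qsum_def quads_def sum.cartesian_product[symmetric] by simp
  also have "\<dots> = (\<Sum>a\<in>?I. \<Sum>b\<in>?I. \<Sum>d\<in>?I. \<Sum>c\<in>?I. F a b c d)"
    by (intro sum.cong refl sum.swap)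
  also have "\<dots> = (\<Sum>a\<in>?I. \<Sum>d\<in>?I. \<Sum>b\<in>?I. \<Sum>c\<in>?I. F a b c d)"
    by (intro sum.cong refl sum.swap)
  finally show ?thesis .
qed

text \<open>For fixed a and d, the equation b c = a d modulo l has l - 1 solutions if a d is nonzero
  and 2 l - 1 otherwise.\<close>

lemma sing_sum_trace:
  assumes l: "prime l" and g: "\<And>t. g (t mod int l) = g t"
  shows "sing_sum l (\<lambda>a b c d. g (a + d)) = (int l ^ 2 + int l) * (\<Sum>t\<in>{0..<int l}. g t) - int l * g 0"
proof -
  let ?I = "{0..<int l}" and ?G = "\<Sum>t\<in>{0..<int l}. g t"
  have l0: "l > 0" by (rule prime_gt_0_nat[OF l])
  have zero: "int l dvd x \<longleftrightarrow> x = 0" if "x \<in> ?I" for x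
    using that by (metis atLeastLessThan_iff dvd_0_right zdvd_not_zless order_le_less)
  have R: "(\<Sum>b\<in>?I. \<Sum>c\<in>?I. if int l dvd x - b * c then y else 0) =
      y * (int l - 1) + y * (if int l dvd x then int l else 0)" for x y
  proof -
    have "(\<Sum>c\<in>?I. if int l dvd x - b * c then y else 0) = y" if "b \<in> ?I - {0}" for b
    proof -
      have "\<not> int l dvd b" using zero[of b] that by auto
      then have "coprime b (int l)"
        using l by (metis coprime_commute prime_imp_coprime prime_nat_int_transfer)
      from sum_of_bool_ex1[OF _ unique_solution[OF this l0, of x]]
      have "(\<Sum>c\<in>?I. if int l dvd x - b * c then 1 else 0 :: int) = 1" by simp
      then have "y * (\<Sum>c\<in>?I. if int l dvd x - b * c then 1 else 0) = y" by simp
      then show ?thesis by (simp add: sum_distrib_left if_distrib cong: if_cong)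
    qed
    then have "(\<Sum>b\<in>?I - {0}. \<Sum>c\<in>?I. if int l dvd x - b * c then y else 0) = y * (int l - 1)"
      using l0 by (simp add: mult.commute)
    then show ?thesis
      using l0 by (subst sum.remove[of _ 0]) auto
  qed
  have prod: "int l dvd a * d \<longleftrightarrow> a = 0 \<or> d = 0" if "a \<in> ?I" "d \<in> ?I" for a d
    using l zero[OF that(1)] zero[OF that(2)] by (simp add: prime_dvd_mult_iff)
  have "sing_sum l (\<lambda>a b c d. g (a + d)) =
      (\<Sum>a\<in>?I. \<Sum>d\<in>?I. g (a + d) * (int l - 1) + g (a + d) * (if int l dvd a * d then int l else 0))"
    unfolding sing_sum_def qsum_nested R ..
  also have "\<dots> = (int l - 1) * (\<Sum>a\<in>?I. \<Sum>d\<in>?I. g (a + d))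
      + int l * (\<Sum>a\<in>?I. \<Sum>d\<in>?I. if int l dvd a * d then g (a + d) else 0)"
    unfolding sum.distrib sum_distrib_left
    by (intro arg_cong2[where f = "(+)"] sum.cong refl) auto
  also have "(\<Sum>a\<in>?I. \<Sum>d\<in>?I. g (a + d)) = int l * ?G"
    using sum_periodic_shift[of g l, OF g l0] by simp
  \<comment> \<open>The solutions of a d = 0 form two axes, each running once through all traces;
    their common origin must not be counted twice.\<close>
  also have "(\<Sum>a\<in>?I. \<Sum>d\<in>?I. if int l dvd a * d then g (a + d) else 0) = ?G + (?G - g 0)"
  proof -
    have "(\<Sum>d\<in>?I. if int l dvd a * d then g (a + d) else 0) = g a" if "a \<in> ?I - {0}" for a
    proof -
      have "(\<Sum>d\<in>?I. if int l dvd a * d then g (a + d) else 0) = (\<Sum>d\<in>?I. if d = 0 then g a else 0)"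
        using that by (intro sum.cong) (auto simp: prod)
      then show ?thesis using l0 by simp
    qed
    then have "(\<Sum>a\<in>?I - {0}. \<Sum>d\<in>?I. if int l dvd a * d then g (a + d) else 0) = ?G - g 0"
      using l0 by (simp add: sum_diff1)
    then show ?thesis using l0 by (subst sum.remove[of _ 0]) auto
  qed
  finally show ?thesis by (simp add: algebra_simps power2_eq_square)
qed

text \<open>The extra factor l avoids a negative exponent at i = 0. The class of zero leads from i
  back to i - 2, which explains the two base cases.\<close>

lemma sing_sum_1:
  assumes l: "prime l"
  shows "int l * sing_sum (l ^ i) (\<lambda>a b c d. 1) = int l ^ (3 * i) * (int l + 1) - int l ^ (2 * i)"
proof (induction i rule: less_induct)
  case (less i)
  have l0: "l > 0" by (rule prime_gt_0_nat[OF l])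
  have one: "sing_sum l (\<lambda>a b c d. 1) = int l ^ 3 + int l ^ 2 - int l"
    using sing_sum_trace[OF l, of "\<lambda>_. 1"] by (simp add: algebra_simps power_numeral_reduce)
  consider "i = 0" | "i = 1" | k where "i = Suc (Suc k)" by (metis One_nat_def not0_implies_Suc)
  then show ?case
  proof cases
    case 1
    then show ?thesis by (simp add: sing_sum_def qsum_def quads_def)
  next
    case 2
    then show ?thesis by (simp add: one algebra_simps power_numeral_reduce)
  next
    case 3
    have rec: "sing_sum (l ^ i) (\<lambda>a b c d. 1) =
       int l ^ (3 * Suc k) * (int l ^ 3 + int l ^ 2 - int l - 1) + int l ^ 4 * sing_sum (l ^ k) (\<lambda>a b c d. 1)"
      unfolding 3 by (subst sing_sum_prime_power[OF l])
        (simp_all add: periodic_def one sing_lifts_zero[OF l0])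
    have "int l * sing_sum (l ^ i) (\<lambda>a b c d. 1) =
        int l * int l ^ (3 * Suc k) * (int l ^ 3 + int l ^ 2 - int l - 1)
        + int l ^ 4 * (int l * sing_sum (l ^ k) (\<lambda>a b c d. 1))"
      unfolding rec by (simp add: algebra_simps)
    also have "int l * sing_sum (l ^ k) (\<lambda>a b c d. 1) = int l ^ (3 * k) * (int l + 1) - int l ^ (2 * k)"
      by (rule less.IH) (simp add: 3)
    finally show ?thesis
      unfolding 3 by (simp add: algebra_simps power_add power_numeral_reduce)
  qed
qed

lemma sing_lifts_zero_eq:
  assumes l: "prime l"
  shows "int l ^ 3 * sing_lifts l i 0 0 0 0 = int l ^ (3 * Suc i) * (int l + 1) - int l ^ (2 * i + 4)"
proof (cases i)
  case 0
  then show ?thesis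
    using sing_lifts_zero(1)[OF prime_gt_0_nat[OF l]] by (simp add: algebra_simps power_numeral_reduce)
next
  case (Suc k)
  have "int l ^ 3 * sing_lifts l i 0 0 0 0 = int l ^ 6 * (int l * sing_sum (l ^ k) (\<lambda>a b c d. 1))"
    unfolding Suc sing_lifts_zero(2)[OF prime_gt_0_nat[OF l]] by (simp add: power_numeral_reduce)
  also have "\<dots> = int l ^ 6 * (int l ^ (3 * k) * (int l + 1) - int l ^ (2 * k))"
    by (simp only: sing_sum_1[OF l])
  finally show ?thesis
    unfolding Suc by (simp add: algebra_simps power_add power_numeral_reduce)
qed

text \<open>The hypotheses make the uniform part -(l + 1) l^(3i). The leading term in the number of
  lifts of zero cancels it exactly, and the secondary term survives.\<close>

lemma sing_sum_prime_power_eq: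
  assumes l: "prime l" and F: "periodic l F" "F 0 0 0 0 = 1" "sing_sum l F = - int l"
  shows "sing_sum (l ^ Suc i) F = - (int l ^ (2 * i + 1))"
proof -
  have "int l ^ 3 * sing_sum (l ^ Suc i) F =
      int l ^ (3 * Suc i) * (- int l - 1) + int l ^ 3 * sing_lifts l i 0 0 0 0"
    unfolding sing_sum_prime_power[OF l F(1)] F(2,3) by (simp add: algebra_simps power_add)
  also have "\<dots> = int l ^ 3 * (- (int l ^ (2 * i + 1)))"
    unfolding sing_lifts_zero_eq[OF l] by (simp add: algebra_simps power_add power_numeral_reduce)
  finally show ?thesis using prime_gt_0_nat[OF l] by (simp only: mult_cancel_left) simp
qed

text \<open>For singular B the weight is the indicator that 1 - B is invertible, so this sum is the
  cardinality of \<open>Psi\<close> at a prime power.\<close>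

lemma sing_sum_trace_not_1:
  assumes l: "prime l"
  shows "int l ^ 2 * sing_sum (l ^ Suc i) (\<lambda>a b c d. if int l dvd 1 - (a + d) then 0 else 1) =
     int l ^ (3 * Suc i) * (int l ^ 2 - 1) - int l ^ (2 * i + 3)"
proof -
  let ?g = "\<lambda>t. if int l dvd 1 - t then 0 else 1 :: int"
  have l1: "l > 1" by (rule prime_gt_1_nat[OF l])
  have g: "?g (t mod int l) = ?g t" for t
    by (simp add: dvd_eq_mod_eq_0 mod_simps)
  have "(\<Sum>t\<in>{0..<int l}. ?g t) = (\<Sum>t\<in>{0..<int l}. 1 - (if t = 1 then 1 else 0))"
  proof (intro sum.cong refl)
    fix t assume "t \<in> {0..<int l}"
    then have "int l dvd 1 - t \<longleftrightarrow> t = 1"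
      using l1 by (metis dvd_0_right diff_self cong_iff_dvd_diff cong_less_imp_eq_int atLeastLessThan_iff
          cong_sym_eq of_nat_1 of_nat_less_iff zero_le_one)
    then show "?g t = 1 - (if t = 1 then 1 else 0)" by simp
  qed
  also have "\<dots> = int l - 1" using l1 by (simp add: sum_subtractf)
  finally have G: "sing_sum l (\<lambda>a b c d. ?g (a + d)) = (int l ^ 2 + int l) * (int l - 1) - int l"
    using sing_sum_trace[of l ?g, OF l g] l1 by simp
  have per: "periodic l (\<lambda>a b c d. ?g (a + d))"
  proof -
    have "[1 - (a mod int l + d mod int l) = 1 - (a + d)] (mod int l)" for a d
      by (intro cong_diff cong_add) simp_all
    from cong_dvd_iff[OF this] show ?thesis unfolding periodic_def by simp
  qed
  have g0: "?g (0 + 0) = 1" using l1 by simp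
  have "int l ^ 3 * sing_sum (l ^ Suc i) (\<lambda>a b c d. ?g (a + d)) =
     int l ^ (3 * Suc i) * ((int l ^ 2 + int l) * (int l - 1) - int l - 1) + int l ^ 3 * sing_lifts l i 0 0 0 0"
    unfolding sing_sum_prime_power[OF l per] G g0 by (simp add: algebra_simps power_add)
  also have "\<dots> = int l * (int l ^ (3 * Suc i) * (int l ^ 2 - 1) - int l ^ (2 * i + 3))"
    unfolding sing_lifts_zero_eq[OF l] by (simp add: algebra_simps power_add power_numeral_reduce)
  finally have "int l * (int l ^ 2 * sing_sum (l ^ Suc i) (\<lambda>a b c d. ?g (a + d))) =
      int l * (int l ^ (3 * Suc i) * (int l ^ 2 - 1) - int l ^ (2 * i + 3))"
    by (simp add: power_numeral_reduce mult.assoc)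
  then show ?thesis using l1 by (simp only: mult_cancel_left) simp
qed

section \<open>Two-adic character sums\<close>

lemma sing_sum_add: "sing_sum n (\<lambda>a b c d. F a b c d + G a b c d) = sing_sum n F + sing_sum n G"
  unfolding sing_sum_def qsum_add[symmetric] by (intro qsum_cong) simp

lemma sing_sum_uminus: "sing_sum n (\<lambda>a b c d. - F a b c d) = - sing_sum n F"
  unfolding sing_sum_def qsum_def by (auto simp flip: sum_negf intro!: sum.cong)

lemma sing_sum_cong:
  assumes "\<And>a b c d. (a, b, c, d) \<in> quads n \<Longrightarrow> int n dvd a * d - b * c \<Longrightarrow> F a b c d = G a b c d"
  shows "sing_sum n F = sing_sum n G"
  unfolding sing_sum_def using assms by (intro qsum_cong) auto

lemma sing_sum_eq_sum:
  assumes "\<And>a b c d. \<not> P a b c d \<Longrightarrow> F a b c d = 0"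
  shows "sing_sum n F = (\<Sum>(a, b, c, d) \<in> {(a, b, c, d) \<in> quads n. int n dvd a * d - b * c \<and> P a b c d}. F a b c d)"
  unfolding sing_sum_def qsum_def
  by (rule sum.mono_neutral_cong_right) (auto split: if_splits intro: ccontr assms)

text \<open>If \<open>b\<close> is a unit then \<open>(a, b, c, d) \<mapsto> (a, b, c + a s/b, d + s)\<close> preserves singularity and
  shifts the trace by \<open>s\<close>.\<close>

lemma sing_sum_shift_cancel:
  assumes n: "n = 2 ^ Suc i" and s: "even s" and g: "\<And>t. g (t mod int n) = g t" "\<And>t. g (t + s) = - g t"
  shows "sing_sum n (\<lambda>a b c d. if odd b \<or> odd c then g (a + d) else 0) = 0"
proof -
  let ?N = "int n"
  have N: "?N > 0" "even ?N" by (simp_all add: n)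
  have parity: "even (x mod ?N) \<longleftrightarrow> even x" for x using N(2) by (simp add: dvd_mod_iff)
  have "\<exists>v. odd b \<longrightarrow> [b * v = 1] (mod ?N)" for b
    using cong_solve_coprime_int[of b ?N] by (cases "odd b") (auto simp: n coprime_commute)
  then obtain v where v: "odd b \<Longrightarrow> [b * v b = 1] (mod ?N)" for b by metis
  define T where "T = {(a, b, c, d) \<in> quads n. ?N dvd a * d - b * c \<and> (odd b \<or> odd c)}"
  \<comment> \<open>If b is even, c is the unit and takes its role. As u is even, b remains even in
    that branch, so that -u undoes the shift by the same branch.\<close>
  define \<phi> where "\<phi> u q = (case q of (a, b, c, d) \<Rightarrow>
     if odd b then (a, b, (c + a * u * v b) mod ?N, (d + u) mod ?N)
     else (a, (b + a * u * v c) mod ?N, c, (d + u) mod ?N))" for u and q :: "int \<times> int \<times> int \<times> int"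
  have det: "[a * ((d + u) mod ?N) - b * ((c + a * u * v b) mod ?N) = a * d - b * c] (mod ?N)" if "odd b" for a b c d u
  proof -
    have "[a * ((d + u) mod ?N) - b * ((c + a * u * v b) mod ?N) = a * (d + u) - b * (c + a * u * v b)] (mod ?N)"
      by (intro cong_diff cong_mult) simp_all
    also have "a * (d + u) - b * (c + a * u * v b) = a * d - b * c + (a * u - a * u * (b * v b))"
      by (simp add: algebra_simps)
    also have "[a * d - b * c + (a * u - a * u * (b * v b)) = a * d - b * c + (a * u - a * u * 1)] (mod ?N)"
      by (intro cong_add cong_diff cong_mult v that) simp_all
    finally show ?thesis by simp
  qed
  have maps: "\<phi> u q \<in> T" if q: "q \<in> T" and u: "even u" for u q
  proof -
    obtain a b c d where abcd: "q = (a, b, c, d)" by (cases q) auto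
    show ?thesis
    proof (cases "odd b")
      case True
      then show ?thesis
        using q N det[OF True, of a d u c] by (auto simp: abcd T_def \<phi>_def quads_def cong_dvd_iff)
    next
      case False
      then have "odd c" using q by (auto simp: abcd T_def)
      then show ?thesis
        using q N False u det[of c a d u b]
        by (auto simp: abcd T_def \<phi>_def quads_def parity mult.commute[of _ c] cong_dvd_iff)
    qed
  qed
  have inv: "\<phi> (- u) (\<phi> u q) = q" if q: "q \<in> T" and u: "even u" for u q
  proof -
    obtain a b c d where abcd: "q = (a, b, c, d)" by (cases q) auto
    have "x mod ?N = x" if "x \<in> {a, b, c, d}" for x
      using q that by (auto simp: abcd T_def quads_def)
    then show ?thesis
      using u by (auto simp: abcd \<phi>_def parity mod_simps)
  qed
  define h where "h q = (case q of (a, b, c, d) \<Rightarrow> g (a + d))" for q :: "int \<times> int \<times> int \<times> int"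
  have trace: "h (\<phi> s q) = - h q" for q
  proof -
    obtain a b c d where abcd: "q = (a, b, c, d)" by (cases q) auto
    have "g (a + (d + s) mod ?N) = g (a + d + s)"
      by (metis g(1) mod_add_right_eq add.assoc)
    then show ?thesis by (auto simp: abcd h_def \<phi>_def g(2))
  qed
  have "sum h T = (\<Sum>q\<in>T. h (\<phi> s q))"
    by (rule sum.reindex_bij_witness[where i = "\<phi> s" and j = "\<phi> (- s)"])
       (use maps[of _ s] maps[of _ "- s"] inv[of _ s] inv[of _ "- s"] s in auto)
  also have "\<dots> = - sum h T" by (simp add: trace sum_negf)
  finally have "sum h T = 0" by simp
  moreover have "sing_sum n (\<lambda>a b c d. if odd b \<or> odd c then g (a + d) else 0) = sum h T"
    by (subst sing_sum_eq_sum[where P = "\<lambda>a b c d. odd b \<or> odd c"])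
       (auto simp: T_def h_def intro!: sum.cong)
  ultimately show ?thesis by simp
qed

text \<open>B -> -B keeps the determinant and all parities and negates the trace.\<close>

lemma sing_sum_neg_cancel:
  assumes n: "n > 0" "even n" and g: "\<And>t. g (t mod int n) = g t" "\<And>t. odd t \<Longrightarrow> g (- t) = - g t"
  shows "sing_sum n (\<lambda>a b c d. if even b \<and> even c \<and> odd (a + d) then g (a + d) else 0) = 0"
proof -
  let ?N = "int n"
  have parity: "even (x mod ?N) \<longleftrightarrow> even x" for x using n(2) by (simp add: dvd_mod_iff)
  define T where "T = {(a, b, c, d) \<in> quads n. ?N dvd a * d - b * c \<and> even b \<and> even c \<and> odd (a + d)}"
  define h where "h q = (case q of (a, b, c, d) \<Rightarrow> g (a + d))" for q :: "int \<times> int \<times> int \<times> int"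
  define \<phi> where "\<phi> q = (case q of (a, b, c, d) \<Rightarrow> ((- a) mod ?N, (- b) mod ?N, (- c) mod ?N, (- d) mod ?N))"
    for q :: "int \<times> int \<times> int \<times> int"
  have maps: "\<phi> q \<in> T" if q: "q \<in> T" for q
  proof -
    obtain a b c d where abcd: "q = (a, b, c, d)" by (cases q) auto
    have "[((- a) mod ?N) * ((- d) mod ?N) - ((- b) mod ?N) * ((- c) mod ?N) = (- a) * (- d) - (- b) * (- c)] (mod ?N)"
      by (intro cong_diff cong_mult) simp_all
    then show ?thesis
      using q n by (auto simp: abcd T_def \<phi>_def quads_def parity cong_dvd_iff)
  qed
  have inv: "\<phi> (\<phi> q) = q" if q: "q \<in> T" for q
  proof -
    obtain a b c d where abcd: "q = (a, b, c, d)" by (cases q) auto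
    have "x mod ?N = x" if "x \<in> {a, b, c, d}" for x
      using q that by (auto simp: abcd T_def quads_def)
    then show ?thesis by (auto simp: abcd \<phi>_def mod_simps)
  qed
  have trace: "h (\<phi> q) = - h q" if q: "q \<in> T" for q
  proof -
    obtain a b c d where abcd: "q = (a, b, c, d)" by (cases q) auto
    have "g ((- a) mod ?N + (- d) mod ?N) = g (- (a + d))"
      by (metis g(1) mod_add_eq minus_add_distrib)
    then show ?thesis using q g(2)[of "a + d"] by (auto simp: abcd h_def \<phi>_def T_def)
  qed
  have "sum h T = (\<Sum>q\<in>T. h (\<phi> q))"
    by (rule sum.reindex_bij_witness[where i = \<phi> and j = \<phi>]) (use maps inv in auto)
  also have "\<dots> = - sum h T" by (simp add: trace sum_negf)
  finally have "sum h T = 0" by simp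
  moreover have "sing_sum n (\<lambda>a b c d. if even b \<and> even c \<and> odd (a + d) then g (a + d) else 0) = sum h T"
    by (subst sing_sum_eq_sum[where P = "\<lambda>a b c d. even b \<and> even c \<and> odd (a + d)"])
       (auto simp: T_def h_def intro!: sum.cong)
  ultimately show ?thesis by simp
qed

section \<open>Matrices with even entries\<close>

lemma quads_2: "quads 2 = {0, 1} \<times> {0, 1} \<times> {0, 1} \<times> {0, 1}"
proof -
  have "{0..<int 2} = {0, 1}" by auto
  then show ?thesis unfolding quads_def by simp
qed

lemma qsum_2: "qsum 2 F = (\<Sum>a\<in>{0, 1}. \<Sum>b\<in>{0, 1}. \<Sum>c\<in>{0, 1}. \<Sum>d\<in>{0, 1}. F a b c d)"
  unfolding qsum_def quads_2 sum.cartesian_product[symmetric] by simp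

lemma sing_sum_all_even:
  "sing_sum (2 ^ Suc i) (\<lambda>a b c d. if even a \<and> even b \<and> even c \<and> even d then g (a + d) else 0) =
   qsum (2 ^ i) (\<lambda>x y z w. if 2 ^ Suc i dvd 4 * (x * w - y * z) then g (2 * (x + w)) else 0)"
proof -
  have "2 * x * (2 * w) - 2 * y * (2 * z) = 4 * (x * w - y * z)" for x y z w :: int
    by (simp add: algebra_simps)
  then show ?thesis
    unfolding sing_sum_def power_Suc qsum_split qsum_2
    by (simp add: qsum_def case_prod_unfold distrib_left cong: if_cong)
qed

definition sgn2 :: "int \<Rightarrow> int" where
  "sgn2 t = (if even t then 1 else -1)"

text \<open>What the cancellations leave of the sums for the characters modulo 4 and 8: an all-even
  matrix 2X carries the weight (-1)^(tr X).\<close>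

definition even_sum :: "nat \<Rightarrow> int" where
  "even_sum i = qsum (2 ^ i) (\<lambda>x y z w. if 2 ^ Suc i dvd 4 * (x * w - y * z) then sgn2 (x + w) else 0)"

lemma two_power_dvd_4: "(2 :: int) ^ Suc (Suc (Suc k)) dvd 4 * t \<longleftrightarrow> 2 ^ Suc k dvd t"
proof -
  have "(2 :: int) ^ Suc (Suc (Suc k)) = 4 * 2 ^ Suc k" by simp
  then show ?thesis by (simp only: dvd_times_left_cancel_iff)
qed

text \<open>The summand depends on the entries modulo 2^(k+1), while these range modulo 2^(k+2);
  hence 16 = 2^4.\<close>

lemma qsum_two_power_4:
  assumes "periodic (2 ^ Suc k) F"
  shows "qsum (2 ^ Suc (Suc k)) (\<lambda>x y z w. if 2 ^ Suc (Suc (Suc k)) dvd 4 * (x * w - y * z) then F x y z w else 0) =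
    16 * sing_sum (2 ^ Suc k) F"
proof -
  have "qsum (2 ^ Suc k * 2) (\<lambda>x y z w. if int (2 ^ Suc k) dvd x * w - y * z then F x y z w else 0) =
      int 2 ^ 4 * sing_sum (2 ^ Suc k) F"
    unfolding sing_sum_def by (rule qsum_periodic[OF periodic_if_det[OF assms]]) simp
  then show ?thesis unfolding two_power_dvd_4 by (simp add: mult.commute)
qed

text \<open>The condition 4 | 4 det X is void, and (-1)^(tr X) sums to 0 over all X modulo 2. This
  is the origin of the exceptional exponents 2 (character modulo 4) and 4 (character modulo
  8).\<close>

lemma even_sum_1: "even_sum 1 = 0"
proof -
  have "even_sum 1 = qsum 2 (\<lambda>x y z w. sgn2 (x + w))"
    unfolding even_sum_def by simp
  also have "\<dots> = 0" unfolding qsum_2 by (simp add: sgn2_def)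
  finally show ?thesis .
qed

lemma even_sum_ge_2: "even_sum (Suc (Suc k)) = - (2 ^ (2 * k + 5))"
proof -
  have per: "periodic 2 (\<lambda>a b c d. sgn2 (a + d))"
    by (simp add: periodic_def sgn2_def)
  have "sing_sum 2 (\<lambda>a b c d. sgn2 (a + d)) = - int 2"
    unfolding sing_sum_def qsum_2 by (simp add: sgn2_def)
  from sing_sum_prime_power_eq[OF two_is_prime_nat per _ this, of k]
  have "sing_sum (2 ^ Suc k) (\<lambda>a b c d. sgn2 (a + d)) = - (2 ^ (2 * k + 1))"
    by (simp add: sgn2_def)
  moreover have "periodic (2 ^ Suc k) (\<lambda>a b c d. sgn2 (a + d))"
    by (simp add: periodic_def sgn2_def dvd_mod_iff)
  ultimately show ?thesis
    unfolding even_sum_def using qsum_two_power_4 by (simp add: power_add)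
qed

section \<open>Sums involving the sign character\<close>

text \<open>For B singular modulo 2, 1 - B is invertible iff the trace is even. It is then the
  identity if B is 0 and an involution, of sign -1, otherwise.\<close>

definition eps_weight :: "int \<Rightarrow> int \<Rightarrow> int \<Rightarrow> int \<Rightarrow> int" where
  "eps_weight a b c d = (if odd (a + d) then 0
     else if even a \<and> even b \<and> even c \<and> even d then 1 else -1)"

lemma sing_sum_eps_weight_trivial:
  "sing_sum (2 ^ Suc i) eps_weight = - (2 ^ (2 * i + 1))"
proof -
  have "periodic 2 eps_weight"
    by (simp add: periodic_def eps_weight_def)
  moreover have "sing_sum 2 eps_weight = - int 2"
    unfolding sing_sum_def qsum_2 by (simp add: eps_weight_def)
  ultimately show ?thesis
    using sing_sum_prime_power_eq[OF two_is_prime_nat, of eps_weight i] by (simp add: eps_weight_def)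
qed

text \<open>The sign change of the character under a trace shift by \<open>s\<close> cancels all B
  with b or c odd, leaving B = 2X.\<close>

lemma sing_sum_eps_weight_reduce:
  fixes \<alpha> :: "int \<Rightarrow> int"
  assumes s: "even s" "\<And>t. even t \<Longrightarrow> \<alpha> (1 - (t + s)) = - \<alpha> (1 - t)"
    and \<alpha>: "\<And>t. \<alpha> (1 - t mod 2 ^ Suc i) = \<alpha> (1 - t)"
  shows "sing_sum (2 ^ Suc i) (\<lambda>a b c d. eps_weight a b c d * \<alpha> (1 - (a + d))) =
    qsum (2 ^ i) (\<lambda>x y z w. if 2 ^ Suc i dvd 4 * (x * w - y * z) then \<alpha> (1 - 2 * (x + w)) else 0)"
proof -
  define g where "g t = (if even t then \<alpha> (1 - t) else 0)" for t
  let ?E = "\<lambda>a b c d. if even a \<and> even b \<and> even c \<and> even d then g (a + d) else 0"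
  let ?O = "\<lambda>a b c d. if odd b \<or> odd c then g (a + d) else 0"
  have "sing_sum (2 ^ Suc i) (\<lambda>a b c d. eps_weight a b c d * \<alpha> (1 - (a + d))) =
      sing_sum (2 ^ Suc i) (\<lambda>a b c d. ?E a b c d + - ?O a b c d)"
  proof (rule sing_sum_cong)
    fix a b c d :: int
    assume "int (2 ^ Suc i) dvd a * d - b * c"
    then have "2 dvd a * d - b * c" by (rule dvd_trans[rotated]) simp
    then show "eps_weight a b c d * \<alpha> (1 - (a + d)) = ?E a b c d + - ?O a b c d"
      by (auto simp: eps_weight_def g_def)
  qed
  also have "\<dots> = sing_sum (2 ^ Suc i) ?E - sing_sum (2 ^ Suc i) ?O"
    by (simp only: sing_sum_add sing_sum_uminus)
  also have "sing_sum (2 ^ Suc i) ?O = 0"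
    by (rule sing_sum_shift_cancel[OF refl s(1)])
       (use s \<alpha> in \<open>auto simp: g_def dvd_mod_iff\<close>)
  finally show ?thesis unfolding sing_sum_all_even by (simp add: g_def cong: if_cong)
qed

lemma sing_sum_eps_weight_4:
  assumes "i \<ge> 1" and \<alpha>: "\<And>t. \<alpha> (1 - 2 * t) = sgn2 t"
    and per: "\<And>t. \<alpha> (1 - t mod 2 ^ Suc i) = \<alpha> (1 - t)"
  shows "sing_sum (2 ^ Suc i) (\<lambda>a b c d. eps_weight a b c d * \<alpha> (1 - (a + d))) =
    (if i = 1 then 0 else - (2 ^ (2 * i + 1)))"
proof -
  have shift: "\<alpha> (1 - (t + 2)) = - \<alpha> (1 - t)" if even: "even t" for t
  proof -
    obtain u where u: "t = 2 * u" using even by (elim evenE)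
    have "1 - (t + 2) = 1 - 2 * (u + 1)" "1 - t = 1 - 2 * u" by (simp_all add: u)
    then show ?thesis by (simp only: \<alpha>) (simp add: sgn2_def)
  qed
  have "even (2 :: int)" by simp
  then have "sing_sum (2 ^ Suc i) (\<lambda>a b c d. eps_weight a b c d * \<alpha> (1 - (a + d))) = even_sum i"
    unfolding even_sum_def \<alpha>[symmetric] by (rule sing_sum_eps_weight_reduce[OF _ shift per])
  moreover have "i = 1 \<or> (\<exists>k. i = Suc (Suc k))" using assms(1) by presburger
  ultimately show ?thesis using even_sum_1 even_sum_ge_2 by (auto simp: numeral_eq_Suc)
qed

text \<open>After B = 2X the character of tr X still changes sign under a shift by 2, so the
  argument is repeated for X. It collapses for i = 2, where det X need only be even, and for i = 3
  by \<open>even_sum_1\<close>.\<close>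

lemma sing_sum_eps_weight_8:
  assumes "i \<ge> 2" and \<alpha>: "\<And>t. \<alpha> (1 - 4 * t) = sgn2 t" "\<And>t. \<alpha> (1 - 2 * (t + 2)) = - \<alpha> (1 - 2 * t)"
    and per: "\<And>t. \<alpha> (t mod 8) = \<alpha> t"
  shows "sing_sum (2 ^ Suc i) (\<lambda>a b c d. eps_weight a b c d * \<alpha> (1 - (a + d))) =
    (if i = 2 \<or> i = 3 then 0 else - (2 ^ (2 * i + 1)))"
proof -
  define h where "h t = \<alpha> (1 - 2 * t)" for t
  have h2: "h (t + 2) = - h t" for t unfolding h_def by (rule \<alpha>(2))
  have cong: "\<alpha> x = \<alpha> y" if "[x = y] (mod 8)" for x y
    using that per[of x] per[of y] by (simp add: Cong.cong_def)
  have "\<alpha> (1 - (t + 4)) = - \<alpha> (1 - t)" if even: "even t" for t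
  proof -
    obtain u where u: "t = 2 * u" using even by (elim evenE)
    have "1 - (t + 4) = 1 - 2 * (u + 2)" "1 - t = 1 - 2 * u" by (simp_all add: u)
    then show ?thesis using \<alpha>(2)[of u] by (simp only:)
  qed
  moreover have "\<alpha> (1 - t mod 2 ^ Suc i) = \<alpha> (1 - t)" for t
  proof (rule cong)
    have "(8 :: int) dvd 2 ^ Suc i"
      using le_imp_power_dvd[of 3 "Suc i" "2 :: int"] assms(1) by simp
    moreover have "[1 - t mod 2 ^ Suc i = 1 - t] (mod 2 ^ Suc i)"
      by (intro cong_diff) simp_all
    ultimately show "[1 - t mod 2 ^ Suc i = 1 - t] (mod 8)" by (rule cong_dvd_modulus[rotated])
  qed
  ultimately have *: "sing_sum (2 ^ Suc i) (\<lambda>a b c d. eps_weight a b c d * \<alpha> (1 - (a + d))) =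
    qsum (2 ^ i) (\<lambda>x y z w. if 2 ^ Suc i dvd 4 * (x * w - y * z) then h (x + w) else 0)"
    unfolding h_def by (intro sing_sum_eps_weight_reduce[of 4]) simp_all
  show ?thesis
  proof (cases "i = 2")
    case True
    \<comment> \<open>Raising one digit by 1 shifts the argument by 2 and flips the sign, so the
      four digits cancel in pairs.\<close>
    have zero: "qsum 2 (\<lambda>x y z w. h (t + 2 * x + 2 * w)) = 0" for t
      unfolding qsum_2 using h2[of t] h2[of "t + 2"] by (simp add: add_ac)
    have dv: "(8 :: int) dvd 4 * t \<longleftrightarrow> even t" for t
      using two_power_dvd_4[of 0 t] by simp
    have "qsum (2 ^ i) (\<lambda>x y z w. if 2 ^ Suc i dvd 4 * (x * w - y * z) then h (x + w) else 0) =
        qsum (2 * 2) (\<lambda>x y z w. if even (x * w - y * z) then h (x + w) else 0)"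
    proof -
      have "(2 :: int) ^ Suc 2 = 8" "(2 :: nat) ^ 2 = 2 * 2" by simp_all
      then show ?thesis by (simp only: True dv)
    qed
    also have "\<dots> = qsum 2 (\<lambda>a b c d. if even (a * d - b * c) then
        qsum 2 (\<lambda>x y z w. h (a + d + 2 * x + 2 * w)) else 0)"
      unfolding qsum_split by (intro qsum_cong) (auto simp: add_ac)
    also have "\<dots> = 0"
      unfolding zero if_cancel by simp
    finally show ?thesis unfolding * using True by simp
  next
    case False
    then obtain k where k: "i = Suc (Suc (Suc k))"
      using assms(1) by (metis Suc_leD Suc_le_D numeral_2_eq_2 le_antisym not_less_eq_eq)
    let ?n = "2 ^ Suc (Suc k) :: nat"
    have h4: "h (t + 4 * u) = h t" for t u
      unfolding h_def by (rule cong) (simp add: cong_iff_dvd_diff algebra_simps)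
    have h_mod: "h (t mod int ?n) = h t" for t
    proof -
      have "t = t mod int ?n + 4 * (2 ^ k * (t div int ?n))"
        using mult_div_mod_eq[of "int ?n" t] by (simp add: algebra_simps)
      then show ?thesis using h4 by metis
    qed
    have per_h: "periodic ?n (\<lambda>a b c d. h (a + d))"
      unfolding periodic_def by (metis h_mod mod_add_eq)
    let ?E = "\<lambda>a b c d. if even a \<and> even b \<and> even c \<and> even d then h (a + d) else 0"
    let ?O = "\<lambda>a b c d. if odd b \<or> odd c then h (a + d) else 0"
    \<comment> \<open>Odd traces had weight 0 for B but do occur for X; with b and c even they form
      a third class.\<close>
    let ?T = "\<lambda>a b c d. if even b \<and> even c \<and> odd (a + d) then h (a + d) else 0"
    have "sing_sum ?n (\<lambda>a b c d. h (a + d)) = sing_sum ?n (\<lambda>a b c d. (?E a b c d + ?O a b c d) + ?T a b c d)"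
    proof (rule sing_sum_cong)
      fix a b c d :: int
      assume "int ?n dvd a * d - b * c"
      then have "2 dvd a * d - b * c" by (rule dvd_trans[rotated]) simp
      then show "h (a + d) = (?E a b c d + ?O a b c d) + ?T a b c d" by auto
    qed
    also have "\<dots> = sing_sum ?n ?E + sing_sum ?n ?O + sing_sum ?n ?T"
      by (simp only: sing_sum_add)
    also have "sing_sum ?n ?O = 0"
      by (rule sing_sum_shift_cancel[OF refl, of 2]) (use h_mod h2 in auto)
    also have "sing_sum ?n ?T = 0"
    proof (rule sing_sum_neg_cancel)
      fix t :: int assume "odd t"
      then obtain u where u: "t = 2 * u + 1" by (elim oddE)
      \<comment> \<open>\<open>h\<close> has period 4, and -t = t + 2 modulo 4 for odd t.\<close>
      have "h (- t) = h (- t + 4 * (u + 1))" by (simp only: h4)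
      also have "- t + 4 * (u + 1) = t + 2" by (simp add: u)
      finally show "h (- t) = - h t" by (simp add: h2)
    qed (use h_mod in auto)
    also have "sing_sum ?n ?E = even_sum (Suc k)"
    proof -
      have "h (2 * t) = sgn2 t" for t using \<alpha>(1)[of t] by (simp add: h_def)
      then show ?thesis unfolding sing_sum_all_even even_sum_def by (simp only:)
    qed
    finally have "sing_sum ?n (\<lambda>a b c d. h (a + d)) = even_sum (Suc k)" by simp
    then have "sing_sum (2 ^ Suc i) (\<lambda>a b c d. eps_weight a b c d * \<alpha> (1 - (a + d))) = 16 * even_sum (Suc k)"
      unfolding * unfolding k qsum_two_power_4[OF per_h] by (simp only:)
    then show ?thesis
      using even_sum_1 even_sum_ge_2 by (cases k) (auto simp: k power_add)
  qed
qed

section \<open>Matrices over residue rings\<close>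

no_notation fps_nth (infixl "$" 75) \<comment> \<open>clashes with matrix entries\<close>

definition mat4 :: "int \<Rightarrow> int \<Rightarrow> int \<Rightarrow> int \<Rightarrow> int^2^2" where
  "mat4 a b c d = vector [vector [a, b], vector [c, d]]"

lemma mat4_nth [simp]:
  "mat4 a b c d $ 1 $ 1 = a" "mat4 a b c d $ 1 $ 2 = b" "mat4 a b c d $ 2 $ 1 = c" "mat4 a b c d $ 2 $ 2 = d"
  by (simp_all add: mat4_def)

lemma mat_eqI:
  fixes A B :: "int^2^2"
  assumes "A $ 1 $ 1 = B $ 1 $ 1" "A $ 1 $ 2 = B $ 1 $ 2" "A $ 2 $ 1 = B $ 2 $ 1" "A $ 2 $ 2 = B $ 2 $ 2"
  shows "A = B"
proof -
  have "A $ i $ j = B $ i $ j" for i j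
    using assms exhaust_2[of i] exhaust_2[of j] by (elim disjE) simp_all
  then show ?thesis by (simp add: vec_eq_iff)
qed

lemma mat4_collapse [simp]: "mat4 (A $ 1 $ 1) (A $ 1 $ 2) (A $ 2 $ 1) (A $ 2 $ 2) = A"
  by (rule mat_eqI) simp_all

lemma det_mat4 [simp]: "det (mat4 a b c d) = a * d - b * c"
  by (simp add: det_2)

lemma mat_1_eq: "mat 1 = mat4 1 0 0 1"
  by (rule mat_eqI) (simp_all add: mat_def)

lemma mat4_diff: "mat4 a b c d - mat4 a' b' c' d' = mat4 (a - a') (b - b') (c - c') (d - d')"
  by (rule mat_eqI) simp_all

lemma red_mat_nth [simp]: "red_mat n A $ i $ j = A $ i $ j mod int n"
  by (simp add: red_mat_def)

lemma red_mat_mat4: "red_mat n (mat4 a b c d) = mat4 (a mod int n) (b mod int n) (c mod int n) (d mod int n)"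
  by (rule mat_eqI) simp_all

definition mats :: "nat \<Rightarrow> (int^2^2) set" where
  "mats n = {A. \<forall>i j. A $ i $ j \<in> {0..<int n}}"

lemma mat4_in_mats [simp]: "mat4 a b c d \<in> mats n \<longleftrightarrow> (a, b, c, d) \<in> quads n"
  by (auto simp: mats_def quads_def forall_2)

lemma red_mat_in_mats [simp]: "n > 0 \<Longrightarrow> red_mat n A \<in> mats n"
  by (simp add: mats_def)

lemma red_mat_id: "A \<in> mats n \<Longrightarrow> red_mat n A = A"
  by (rule mat_eqI) (simp_all add: mats_def)

lemma red_mat_red_mat: "d dvd n \<Longrightarrow> red_mat d (red_mat n A) = red_mat d A"
  by (rule mat_eqI) (simp_all add: mod_mod_cancel)

lemma det_red_mat: "[det (red_mat n A) = det A] (mod int n)"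
  unfolding det_2 red_mat_nth by (intro cong_diff cong_mult) simp_all

lemma GL2_eq: "GL2 n = {A \<in> mats n. coprime (det A) (int n)}"
  by (auto simp: GL2_def mats_def)

lemma bij_betw_quads_mats: "bij_betw (\<lambda>(a, b, c, d). mat4 a b c d) (quads n) (mats n)"
  by (rule bij_betw_byWitness[where f' = "\<lambda>A. (A $ 1 $ 1, A $ 1 $ 2, A $ 2 $ 1, A $ 2 $ 2)"])
     (auto simp: mats_def quads_def forall_2)

lemma finite_mats [simp]: "finite (mats n)"
  using bij_betw_finite[OF bij_betw_quads_mats] by simp

lemma card_mats: "card (mats n) = n ^ 4"
  using bij_betw_same_card[OF bij_betw_quads_mats] by (simp add: card_quads)

lemma sum_mats: "(\<Sum>A\<in>mats n. F A) = qsum n (\<lambda>a b c d. F (mat4 a b c d))"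
  unfolding qsum_def sum.reindex_bij_betw[OF bij_betw_quads_mats, symmetric] by (simp add: case_prod_unfold)

lemma sum_mats_one_minus:
  assumes "n > 0"
  shows "(\<Sum>A\<in>mats n. F A) = qsum n (\<lambda>a b c d. F (red_mat n (mat4 (1 - a) (- b) (- c) (1 - d))))"
proof -
  have "(\<Sum>A\<in>mats n. F A) = (\<Sum>A\<in>mats n. F (red_mat n (mat 1 - A)))"
  proof -
    have "red_mat n (mat 1 - red_mat n (mat 1 - A)) = A" if A: "A \<in> mats n" for A
    proof -
      have "red_mat n (mat 1 - red_mat n (mat 1 - A)) = red_mat n A"
        by (rule mat_eqI) (simp_all add: mod_simps)
      then show ?thesis by (simp add: red_mat_id[OF A])
    qed
    then show ?thesis
      by (intro sum.reindex_bij_witness[where i = "\<lambda>A. red_mat n (mat 1 - A)" and j = "\<lambda>A. red_mat n (mat 1 - A)"])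
        (use assms in auto)
  qed
  then show ?thesis unfolding sum_mats mat_1_eq mat4_diff by simp
qed

section \<open>Local sums over \<open>Psi\<close>\<close>

lemma Psi_eq: "Psi n = {A \<in> mats n. coprime (det A) (int n) \<and> int n dvd det (mat 1 - A)}"
  by (auto simp: Psi_def GL2_eq cong_0_iff)

lemma finite_Psi [simp]: "finite (Psi n)" "finite (GL2 n)"
  by (simp_all add: Psi_eq GL2_eq)

lemma coprime_prime_power_iff:
  assumes "prime l"
  shows "coprime x (int (l ^ Suc i)) \<longleftrightarrow> \<not> int l dvd x"
proof -
  have "prime (int l)" using assms by simp
  then have "coprime x (int l) \<longleftrightarrow> \<not> int l dvd x"
    by (metis coprime_commute prime_imp_coprime coprime_absorb_left not_prime_unit)
  then show ?thesis by (simp add: coprime_power_right_iff del: power_Suc)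
qed

lemma det_one_minus_cong:
  assumes "int N dvd a * d - b * c"
  shows "[det (red_mat N (mat4 (1 - a) (- b) (- c) (1 - d))) = 1 - (a + d)] (mod int N)"
proof -
  have "[det (red_mat N (mat4 (1 - a) (- b) (- c) (1 - d))) = (1 - a) * (1 - d) - b * c] (mod int N)"
    using det_red_mat[of N "mat4 (1 - a) (- b) (- c) (1 - d)"] by simp
  moreover have "(1 - a) * (1 - d) - b * c = 1 - (a + d) + (a * d - b * c)" by (simp add: algebra_simps)
  moreover have "[1 - (a + d) + (a * d - b * c) = 1 - (a + d) + 0] (mod int N)"
    using assms by (intro cong_add) (simp_all add: cong_0_iff)
  ultimately show ?thesis by (metis add.right_neutral cong_trans)
qed

text \<open>For singular B, invertibility of 1 - B means that l does not divide 1 - tr B. It is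
  encoded as weight 0, so that the summation range stays that of \<open>sing_sum\<close>.\<close>

lemma sum_Psi:
  assumes l: "prime l" and N: "N = l ^ Suc i"
  shows "(\<Sum>A\<in>Psi N. f A) = sing_sum N (\<lambda>a b c d. if int l dvd 1 - (a + d) then 0
     else f (red_mat N (mat4 (1 - a) (- b) (- c) (1 - d))))"
proof -
  have N0: "N > 0" using prime_gt_0_nat[OF l] by (simp add: N)
  have "(\<Sum>A\<in>Psi N. f A) = (\<Sum>A\<in>mats N. if A \<in> Psi N then f A else 0)"
    unfolding sum.If_cases[OF finite_mats] by (auto simp: Psi_eq intro!: sum.cong)
  also have "\<dots> = sing_sum N (\<lambda>a b c d. if int l dvd 1 - (a + d) then 0
     else f (red_mat N (mat4 (1 - a) (- b) (- c) (1 - d))))"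
    unfolding sum_mats_one_minus[OF N0] sing_sum_def
  proof (rule qsum_cong)
    fix a b c d
    let ?A = "red_mat N (mat4 (1 - a) (- b) (- c) (1 - d))"
    have "[det (mat 1 - ?A) = det (mat 1 - mat4 (1 - a) (- b) (- c) (1 - d))] (mod int N)"
      unfolding det_2 mat_1_eq by (intro cong_diff cong_mult) (simp_all add: Cong.cong_def mod_simps)
    then have 1: "int N dvd det (mat 1 - ?A) \<longleftrightarrow> int N dvd a * d - b * c"
      by (simp add: cong_dvd_iff mat_1_eq mat4_diff)
    show "(if ?A \<in> Psi N then f ?A else 0) = (if int N dvd a * d - b * c then
        (if int l dvd 1 - (a + d) then 0 else f ?A) else 0)"
    proof (cases "int N dvd a * d - b * c")
      case True
      have "[det ?A = 1 - (a + d)] (mod int N)" by (rule det_one_minus_cong[OF True])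
      then have "[det ?A = 1 - (a + d)] (mod int l)" by (rule cong_dvd_modulus) (simp add: N)
      then have "int l dvd det ?A \<longleftrightarrow> int l dvd 1 - (a + d)" by (rule cong_dvd_iff)
      then show ?thesis
        using True 1 N0 coprime_prime_power_iff[OF l, of "det ?A" i] by (simp add: Psi_eq N[symmetric] del: power_Suc)
    next
      case False
      then show ?thesis using 1 by (simp add: Psi_eq)
    qed
  qed
  finally show ?thesis .
qed

lemma card_Psi_prime_power:
  assumes l: "prime l"
  shows "int l ^ 2 * int (card (Psi (l ^ Suc i))) = int l ^ (3 * Suc i) * (int l ^ 2 - 1) - int l ^ (2 * i + 3)"
proof -
  have "int (card (Psi (l ^ Suc i))) = (\<Sum>A\<in>Psi (l ^ Suc i). 1)" by simp
  also have "\<dots> = sing_sum (l ^ Suc i) (\<lambda>a b c d. if int l dvd 1 - (a + d) then 0 else 1)"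
    by (rule sum_Psi[OF l refl])
  finally show ?thesis using sing_sum_trace_not_1[OF l, of i] by simp
qed

text \<open>Invertibility depends on the matrix modulo l only: each of the l (l - 1)^2 (l + 1)
  classes has l^(4i) lifts.\<close>

lemma card_GL2_prime_power:
  assumes l: "prime l"
  shows "int (card (GL2 (l ^ Suc i))) = int l ^ (4 * i) * (int l ^ 4 - int l ^ 3 - int l ^ 2 + int l)"
proof -
  have "int (card (GL2 (l ^ Suc i))) = (\<Sum>A\<in>mats (l ^ Suc i). if int l dvd det A then 0 else 1)"
  proof -
    have "GL2 (l ^ Suc i) = {A \<in> mats (l ^ Suc i). \<not> int l dvd det A}"
      unfolding GL2_eq coprime_prime_power_iff[OF l] ..
    then show ?thesis by (simp add: sum.If_cases Int_def del: power_Suc)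
  qed
  also have "\<dots> = qsum (l * l ^ i) (\<lambda>a b c d. 1 + - (if int l dvd a * d - b * c then 1 else 0))"
    unfolding sum_mats power_Suc by (intro qsum_cong) simp
  also have "\<dots> = int (l ^ i) ^ 4 * qsum l (\<lambda>a b c d. 1 + - (if int l dvd a * d - b * c then 1 else 0))"
  proof (rule qsum_periodic)
    have "periodic l (\<lambda>a b c d. if int l dvd a * d - b * c then 1 else 0)"
      by (rule periodic_if_det) (simp_all add: periodic_def)
    then show "periodic l (\<lambda>a b c d. 1 + - (if int l dvd a * d - b * c then 1 else 0))"
      by (simp only: periodic_def) blast
  qed
  also have "qsum l (\<lambda>a b c d. 1 + - (if int l dvd a * d - b * c then 1 else 0)) =
      int l ^ 4 - sing_sum l (\<lambda>a b c d. 1)"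
    unfolding sing_sum_def qsum_add using qsum_mult[of l "-1" "\<lambda>a b c d. if int l dvd a * d - b * c then 1 else 0"] by simp
  also have "sing_sum l (\<lambda>a b c d. 1) = int l ^ 3 + int l ^ 2 - int l"
    using sing_sum_trace[OF l, of "\<lambda>_. 1"] by (simp add: algebra_simps power_numeral_reduce)
  finally show ?thesis by (simp add: power_mult mult.commute[of 4] algebra_simps)
qed

text \<open>The symbol vanishes by itself where 1 - B is not invertible. Since it sums to 0 over all
  traces, \<open>sing_sum_trace\<close> gives -l modulo l.\<close>

lemma sum_Psi_Legendre:
  assumes l: "prime l" "l > 2"
  shows "(\<Sum>A\<in>Psi (l ^ Suc i). Legendre (det A) (int l)) = - (int l ^ (2 * i + 1))"
proof -
  let ?N = "l ^ Suc i"
  let ?L = "\<lambda>t. Legendre (1 - t) (int l)"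
  have per: "?L (t mod int l) = ?L t" for t
    by (intro Legendre_cong cong_diff) simp_all
  have "(\<Sum>A\<in>Psi ?N. Legendre (det A) (int l)) = sing_sum ?N (\<lambda>a b c d. ?L (a + d))"
    unfolding sum_Psi[OF l(1) refl]
  proof (rule sing_sum_cong)
    fix a b c d :: int
    assume "int ?N dvd a * d - b * c"
    from det_one_minus_cong[OF this]
    have "[det (red_mat ?N (mat4 (1 - a) (- b) (- c) (1 - d))) = 1 - (a + d)] (mod int l)"
      by (rule cong_dvd_modulus) simp
    from Legendre_cong[OF this] Legendre_eq_0_iff[of "1 - (a + d)" "int l"]
    show "(if int l dvd 1 - (a + d) then 0 else Legendre (det (red_mat ?N (mat4 (1 - a) (- b) (- c) (1 - d)))) (int l)) = ?L (a + d)"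
      by auto
  qed
  also have "\<dots> = - (int l ^ (2 * i + 1))"
  proof (rule sing_sum_prime_power_eq[OF l(1)])
    show "periodic l (\<lambda>a b c d. ?L (a + d))"
      unfolding periodic_def by (intro allI Legendre_cong cong_diff cong_add) simp_all
    have one: "Legendre 1 (int l) = 1"
      using l(2) by (auto simp: Legendre_def QuadRes_def cong_0_iff intro: exI[of _ 1])
    then show "?L (0 + 0) = 1" by simp
    have "(\<Sum>t\<in>{0..<int l}. ?L t) = (\<Sum>t\<in>{0..<int l}. Legendre t (int l))"
    proof (rule sum.reindex_bij_witness[where i = "\<lambda>t. (1 - t) mod int l" and j = "\<lambda>t. (1 - t) mod int l"])
      fix t show "Legendre ((1 - t) mod int l) (int l) = ?L t" by (rule Legendre_cong) simp
    qed (use l in \<open>auto simp: mod_simps\<close>)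
    also have "\<dots> = (\<Sum>x<l. Legendre (int x) (int l))"
      by (rule sum.reindex_bij_witness[where i = int and j = nat]) auto
    finally have "(\<Sum>t\<in>{0..<int l}. ?L t) = 0" using sum_Legendre[OF l] by simp
    then show "sing_sum l (\<lambda>a b c d. ?L (a + d)) = - int l"
      using sing_sum_trace[of l ?L, OF l(1) per] one by simp
  qed
  finally show ?thesis .
qed

section \<open>The sign character on matrices modulo 2\<close>

definition vec2 :: "int \<Rightarrow> int \<Rightarrow> int^2" where
  "vec2 x y = vector [x, y]"

lemma vec2_nth [simp]: "vec2 x y $ 1 = x" "vec2 x y $ 2 = y"
  by (simp_all add: vec2_def)

lemma vec_eq_vec2_iff: "v = vec2 x y \<longleftrightarrow> v $ 1 = x \<and> v $ 2 = y"
  by (auto simp: vec_eq_iff forall_2)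

lemma F2_nonzero_eq: "F2_nonzero = {vec2 1 0, vec2 0 1, vec2 1 1}"
proof -
  have "v \<in> F2_nonzero \<longleftrightarrow> v = vec2 1 0 \<or> v = vec2 0 1 \<or> v = vec2 1 1" for v
    by (auto simp: F2_nonzero_def vec_eq_vec2_iff forall_2 vec_eq_iff[of v 0])
  then show ?thesis by blast
qed

lemma eps2_transposition:
  assumes "\<And>v. v \<in> F2_nonzero \<Longrightarrow> (\<chi> i. (A *v v) $ i mod 2) = Transposition.transpose x y v"
    and "x \<in> F2_nonzero" "y \<in> F2_nonzero" "x \<noteq> y"
  shows "eps2 A = -1"
proof -
  have "(\<lambda>v. if v \<in> F2_nonzero then (\<chi> i. (A *v v) $ i mod 2) else v) = Transposition.transpose x y"
    using assms by (auto simp: fun_eq_iff Transposition.transpose_def)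
  then show ?thesis using assms(4) by (simp add: eps2_def sign_swap_id)
qed

text \<open>Elements of order 3 need no evaluation: for B singular of even trace, 1 - B is the
  identity or an involution.\<close>

lemma eps2_values:
  "eps2 (mat4 1 0 0 1) = 1" "eps2 (mat4 1 1 0 1) = -1" "eps2 (mat4 1 0 1 1) = -1" "eps2 (mat4 0 1 1 0) = -1"
proof -
  have mv: "(\<chi> i. (mat4 a b c d *v v) $ i mod 2) = vec2 ((a * v $ 1 + b * v $ 2) mod 2) ((c * v $ 1 + d * v $ 2) mod 2)"
    for a b c d v
    by (simp add: vec_eq_vec2_iff matrix_vector_mult_def sum_2)
  have "(\<lambda>v. if v \<in> F2_nonzero then (\<chi> i. (mat4 1 0 0 1 *v v) $ i mod 2) else v) = id"
    unfolding mv by (auto simp: fun_eq_iff F2_nonzero_eq)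
  then show "eps2 (mat4 1 0 0 1) = 1" by (simp add: eps2_def)
  have ne: "vec2 1 0 \<noteq> vec2 0 1" "vec2 1 0 \<noteq> vec2 1 1" "vec2 0 1 \<noteq> vec2 1 1"
    by (simp_all add: vec_eq_vec2_iff)
  show "eps2 (mat4 1 1 0 1) = -1"
    by (rule eps2_transposition[of _ "vec2 0 1" "vec2 1 1"])
       (use ne in \<open>auto simp: mv F2_nonzero_eq Transposition.transpose_def\<close>)
  show "eps2 (mat4 1 0 1 1) = -1"
    by (rule eps2_transposition[of _ "vec2 1 0" "vec2 1 1"])
       (use ne in \<open>auto simp: mv F2_nonzero_eq Transposition.transpose_def\<close>)
  show "eps2 (mat4 0 1 1 0) = -1"
    by (rule eps2_transposition[of _ "vec2 1 0" "vec2 0 1"])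
       (use ne in \<open>auto simp: mv F2_nonzero_eq Transposition.transpose_def\<close>)
qed

lemma eps2_one_minus:
  assumes "even (a + d)" "even (a * d - b * c)"
  shows "eps2 (red_mat 2 (mat4 (1 - a) (- b) (- c) (1 - d))) = eps_weight a b c d"
proof -
  have m: "(1 - x) mod 2 = (if even x then 1 else 0)" "(- x) mod 2 = (if even x then 0 else 1)" for x :: int
    by presburger+
  have eq: "red_mat 2 (mat4 (1 - a) (- b) (- c) (1 - d)) =
      mat4 (if even a then 1 else 0) (if even b then 0 else 1) (if even c then 0 else 1) (if even d then 1 else 0)"
    unfolding red_mat_mat4 by (simp add: m)
  show ?thesis
    using assms unfolding eq eps_weight_def by (auto simp: eps2_values)
qed

lemma sum_Psi_eps2:
  assumes N: "N = 2 ^ Suc i" and e: "\<And>x y. [x = y] (mod int N) \<Longrightarrow> chi2 e x = chi2 e y"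
  shows "(\<Sum>A\<in>Psi N. eps2 (red_mat 2 A) * chi2 e (det A)) =
    sing_sum N (\<lambda>a b c d. eps_weight a b c d * chi2 e (1 - (a + d)))"
  unfolding sum_Psi[OF two_is_prime_nat N]
proof (rule sing_sum_cong)
  fix a b c d :: int
  let ?A = "mat4 (1 - a) (- b) (- c) (1 - d)"
  assume dv: "int N dvd a * d - b * c"
  from e[OF det_one_minus_cong[OF this]] have "chi2 e (det (red_mat N ?A)) = chi2 e (1 - (a + d))" .
  moreover have "red_mat 2 (red_mat N ?A) = red_mat 2 ?A" by (rule red_mat_red_mat) (simp add: N)
  moreover have "even (a * d - b * c)" using dv by (rule dvd_trans[rotated]) (simp add: N)
  ultimately show "(if int 2 dvd 1 - (a + d) then 0 else eps2 (red_mat 2 (red_mat N ?A)) * chi2 e (det (red_mat N ?A))) =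
      eps_weight a b c d * chi2 e (1 - (a + d))"
    using eps2_one_minus[of a d b c] by (cases "even (a + d)") (simp_all add: eps_weight_def)
qed

lemma sum_Psi_eps2_1:
  "(\<Sum>A\<in>Psi (2 ^ Suc i). eps2 (red_mat 2 A) * chi2 1 (det A)) = - (2 ^ (2 * i + 1))"
proof -
  have "chi2 1 x = 1" for x by (simp add: chi2_def)
  then show ?thesis
    using sum_Psi_eps2[OF refl, of i 1] sing_sum_eps_weight_trivial[of i] by (simp del: power_Suc)
qed

lemma two_power_dvd_int: "k \<le> Suc i \<Longrightarrow> (2 :: int) ^ k dvd int (2 ^ Suc i)"
  using le_imp_power_dvd[of k "Suc i" "2 :: int"] by simp

lemma sum_Psi_eps2_minus_1:
  assumes "i \<ge> 1"
  shows "(\<Sum>A\<in>Psi (2 ^ Suc i). eps2 (red_mat 2 A) * chi2 (-1) (det A)) = (if i = 1 then 0 else - (2 ^ (2 * i + 1)))"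
proof -
  have dv: "(4 :: int) dvd int (2 ^ Suc i)" using two_power_dvd_int[of 2 i] assms by simp
  have cong: "chi2 (-1) x = chi2 (-1) y" if "[x = y] (mod int (2 ^ Suc i))" for x y
    using that dv by (intro chi2_minus_1_cong) (rule cong_dvd_modulus)
  have "chi2 (-1) (1 - 2 * t) = sgn2 t" for t
  proof -
    have "(1 - 2 * t) mod 4 = 1 \<longleftrightarrow> even t" by presburger
    then show ?thesis by (simp add: chi2_def sgn2_def)
  qed
  moreover have "chi2 (-1) (1 - t mod 2 ^ Suc i) = chi2 (-1) (1 - t)" for t
    by (rule cong) (simp add: cong_diff del: power_Suc)
  ultimately show ?thesis
    using sum_Psi_eps2[OF refl cong] sing_sum_eps_weight_4[of i "chi2 (-1)", OF assms] by presburger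
qed

lemma sum_Psi_eps2_2:
  assumes "i \<ge> 2" "e \<in> {2, -2}"
  shows "(\<Sum>A\<in>Psi (2 ^ Suc i). eps2 (red_mat 2 A) * chi2 e (det A)) = (if i = 2 \<or> i = 3 then 0 else - (2 ^ (2 * i + 1)))"
proof -
  have dv: "(8 :: int) dvd int (2 ^ Suc i)" using two_power_dvd_int[of 3 i] assms by simp
  have cong: "chi2 e x = chi2 e y" if "[x = y] (mod int (2 ^ Suc i))" for x y
    using that dv by (intro chi2_cong) (rule cong_dvd_modulus)
  have "(1 - 4 * t) mod 8 = (if even t then 1 else 5)" for t :: int by presburger
  then have 1: "chi2 e (1 - 4 * t) = sgn2 t" for t
    using assms(2) by (auto simp: chi2_def sgn2_def)
  have 2: "chi2 e (1 - 2 * (t + 2)) = - chi2 e (1 - 2 * t)" for t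
  proof -
    have shift: "(1 - 2 * (t + 2)) mod 8 = ((1 - 2 * t) mod 8 + 4) mod 8" by presburger
    have "(1 - 2 * t) mod 8 = 1 \<or> (1 - 2 * t) mod 8 = 3 \<or> (1 - 2 * t) mod 8 = 5 \<or> (1 - 2 * t) mod 8 = 7"
      by presburger
    then show ?thesis using assms(2) unfolding chi2_def shift by (elim disjE) auto
  qed
  have 3: "chi2 e (t mod 8) = chi2 e t" for t by (rule chi2_cong) simp
  show ?thesis
    using sum_Psi_eps2[OF refl cong] sing_sum_eps_weight_8[of i "chi2 e", OF assms(1) 1 2 3] by (simp only:)
qed

section \<open>Chinese remaindering for matrices\<close>

text \<open>Injectivity is checked entry by entry; surjectivity follows because both sides have (m
  n)^4 elements.\<close>

lemma bij_betw_mats_coprime: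
  assumes "coprime m n" "m > 0" "n > 0"
  shows "bij_betw (\<lambda>A. (red_mat m A, red_mat n A)) (mats (m * n)) (mats m \<times> mats n)"
proof -
  let ?f = "\<lambda>A. (red_mat m A, red_mat n A)"
  have inj: "inj_on ?f (mats (m * n))"
  proof (rule inj_onI)
    fix A B assume AB: "A \<in> mats (m * n)" "B \<in> mats (m * n)" "?f A = ?f B"
    have "A $ i $ j = B $ i $ j" for i j
    proof -
      have "red_mat m A $ i $ j = red_mat m B $ i $ j" "red_mat n A $ i $ j = red_mat n B $ i $ j"
        using AB(3) by auto
      then have "[A $ i $ j = B $ i $ j] (mod int m)" "[A $ i $ j = B $ i $ j] (mod int n)"
        by (simp_all add: Cong.cong_def)
      then have "[A $ i $ j = B $ i $ j] (mod (int m * int n))"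
        using assms(1) by (intro coprime_cong_mult) simp_all
      moreover have "A $ i $ j \<in> {0..<int m * int n}" "B $ i $ j \<in> {0..<int m * int n}"
        using AB(1,2) by (auto simp: mats_def)
      ultimately show ?thesis by (simp add: Cong.cong_def)
    qed
    then show "A = B" by (simp add: vec_eq_iff)
  qed
  have "?f ` mats (m * n) = mats m \<times> mats n"
    by (rule card_subset_eq)
       (use assms in \<open>auto simp: card_image[OF inj] card_mats card_cartesian_product power_mult_distrib\<close>)
  with inj show ?thesis by (simp add: bij_betw_def)
qed

lemma sum_mats_coprime:
  fixes F G :: "int^2^2 \<Rightarrow> int"
  assumes "coprime m n" "m > 0" "n > 0"
  shows "(\<Sum>A\<in>mats (m * n). F (red_mat m A) * G (red_mat n A)) = (\<Sum>A\<in>mats m. F A) * (\<Sum>A\<in>mats n. G A)"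
proof -
  have "(\<Sum>A\<in>mats m. F A) * (\<Sum>A\<in>mats n. G A) = (\<Sum>(A, B)\<in>mats m \<times> mats n. F A * G B)"
    by (simp add: sum_product sum.cartesian_product)
  also have "\<dots> = (\<Sum>A\<in>mats (m * n). F (red_mat m A) * G (red_mat n A))"
    unfolding sum.reindex_bij_betw[OF bij_betw_mats_coprime[OF assms], symmetric] by simp
  finally show ?thesis by simp
qed

lemma sum_mats_prod:
  fixes w :: "nat \<Rightarrow> int^2^2 \<Rightarrow> int"
  assumes "finite S" "\<And>l. l \<in> S \<Longrightarrow> prime l"
  shows "(\<Sum>A\<in>mats (\<Prod>l\<in>S. l ^ e l). \<Prod>l\<in>S. w l (red_mat (l ^ e l) A)) = (\<Prod>l\<in>S. \<Sum>A\<in>mats (l ^ e l). w l A)"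
  using assms
proof (induction S)
  case empty
  then show ?case by (simp add: card_mats)
next
  case (insert l S)
  let ?n = "\<Prod>l\<in>S. l ^ e l"
  have pos: "l ^ e l > 0" "?n > 0"
    using insert.prems by (auto intro!: prod_pos simp: prime_gt_0_nat)
  have cop: "coprime (l ^ e l) ?n"
    using insert.hyps insert.prems
    by (intro prod_coprime_right) (auto simp: coprime_power_left_iff coprime_power_right_iff intro!: primes_coprime)
  define G where "G B = (\<Prod>k\<in>S. w k (red_mat (k ^ e k) B))" for B
  have "(\<Prod>k\<in>S. w k (red_mat (k ^ e k) A)) = G (red_mat ?n A)" for A
    unfolding G_def using insert.hyps(1)
    by (intro prod.cong refl arg_cong[where f = "w _"] red_mat_red_mat[symmetric] dvd_prodI) auto
  then have "(\<Sum>A\<in>mats (\<Prod>k\<in>insert l S. k ^ e k). \<Prod>k\<in>insert l S. w k (red_mat (k ^ e k) A)) =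
      (\<Sum>A\<in>mats (l ^ e l * ?n). w l (red_mat (l ^ e l) A) * G (red_mat ?n A))"
    using insert.hyps by simp
  also have "\<dots> = (\<Sum>A\<in>mats (l ^ e l). w l A) * (\<Sum>A\<in>mats ?n. G A)"
    by (rule sum_mats_coprime[OF cop pos])
  also have "(\<Sum>A\<in>mats ?n. G A) = (\<Prod>k\<in>S. \<Sum>A\<in>mats (k ^ e k). w k A)"
    unfolding G_def using insert by simp
  finally show ?case using insert.hyps by simp
qed

section \<open>Profinite lifts and the adelic level\<close>

text \<open>If a prime p divided both n and the cofactor, p times the maximum would be a larger
  element of the same set.\<close>

lemma gcd_inf_props:
  assumes "m > 0"
  shows "gcd_inf m n dvd m" "prime p \<Longrightarrow> p dvd gcd_inf m n \<Longrightarrow> p dvd n"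
    "coprime (m div gcd_inf m n) n" "gcd_inf m n > 0"
    "d dvd m \<Longrightarrow> (\<And>p. prime p \<Longrightarrow> p dvd d \<Longrightarrow> p dvd n) \<Longrightarrow> d dvd gcd_inf m n"
    "coprime (gcd_inf m n) (m div gcd_inf m n)" "gcd_inf m n * (m div gcd_inf m n) = m"
proof -
  define S where "S = {d. d dvd m \<and> (\<forall>p. prime p \<and> p dvd d \<longrightarrow> p dvd n)}"
  have fin: "finite S" using assms by (auto simp: S_def)
  have "1 \<in> S" by (auto simp: S_def)
  define g where "g = gcd_inf m n"
  have g_Max: "g = Max S" by (simp add: g_def gcd_inf_def S_def)
  have "g \<in> S" unfolding g_Max using fin \<open>1 \<in> S\<close> by (intro Max_in) auto
  then have 1: "g dvd m" and 2: "\<And>p. prime p \<Longrightarrow> p dvd g \<Longrightarrow> p dvd n" by (auto simp: S_def)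
  have g0: "g > 0" using 1 assms by (auto intro!: Nat.gr0I)
  have m: "g * (m div g) = m" using 1 by simp
  have m0: "m div g > 0" using m assms by (auto intro!: Nat.gr0I)
  have 3: "coprime (m div g) n"
  proof (rule ccontr)
    assume "\<not> coprime (m div g) n"
    then obtain p where p: "prime p" "p dvd m div g" "p dvd n"
      by (metis coprime_iff_gcd_eq_1 gcd_greatest_iff prime_factor_nat)
    have "g * p dvd g * (m div g)" using p(2) by (rule mult_dvd_mono[OF dvd_refl])
    then have "g * p dvd m" unfolding m .
    moreover have "q dvd n" if "prime q" "q dvd g * p" for q
      using that 2 p by (metis prime_dvd_mult_iff primes_dvd_imp_eq)
    ultimately have "g * p \<in> S" by (simp add: S_def)
    then have "g * p \<le> g" unfolding g_Max using fin by (intro Max_ge) auto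
    then show False using g0 prime_gt_1_nat[OF p(1)] by simp
  qed
  have cop: "coprime d (m div g)" if "\<And>p. prime p \<Longrightarrow> p dvd d \<Longrightarrow> p dvd n" for d
  proof (rule ccontr)
    assume "\<not> coprime d (m div g)"
    then obtain p where p: "prime p" "p dvd d" "p dvd m div g"
      by (metis coprime_iff_gcd_eq_1 gcd_greatest_iff prime_factor_nat)
    then have "p dvd n" using that by blast
    with 3 p show False by (metis coprime_common_divisor not_prime_unit)
  qed
  show "d dvd gcd_inf m n" if "d dvd m" "\<And>p. prime p \<Longrightarrow> p dvd d \<Longrightarrow> p dvd n"
    using cop[OF that(2)] that(1) m unfolding g_def[symmetric]
    by (metis coprime_dvd_mult_left_iff)
  show "gcd_inf m n dvd m" "prime p \<Longrightarrow> p dvd gcd_inf m n \<Longrightarrow> p dvd n" "coprime (m div gcd_inf m n) n"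
    "gcd_inf m n > 0" "coprime (gcd_inf m n) (m div gcd_inf m n)" "gcd_inf m n * (m div gcd_inf m n) = m"
    using 1 2 3 g0 cop[OF 2] m by (simp_all only: g_def)
qed

lemma coprime_if_primes_dvd:
  assumes "coprime x (int n)" "\<And>p. prime p \<Longrightarrow> p dvd d \<Longrightarrow> p dvd n" "d > 0"
  shows "coprime x (int d)"
proof (rule ccontr)
  assume "\<not> coprime x (int d)"
  then have "gcd (nat \<bar>x\<bar>) d \<noteq> 1"
    by (metis coprime_iff_gcd_eq_1 gcd_abs1_int gcd_int_int_eq int_nat_eq abs_ge_zero of_nat_1)
  then obtain p where p: "prime p" "p dvd nat \<bar>x\<bar>" "p dvd d"
    by (metis gcd_greatest_iff prime_factor_nat)
  from p(2) have "int p dvd int (nat \<bar>x\<bar>)" by (simp only: int_dvd_int_iff)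
  then have "int p dvd x" by simp
  moreover have "int p dvd int n" using assms(2) p by simp
  ultimately have "int p dvd x" "int p dvd int n" by simp_all
  with assms(1) have "is_unit (int p)" by (rule coprime_common_divisor)
  with p(1) show False by simp
qed

lemma red_mat_in_GL2:
  assumes "n > 0" "coprime (det A) (int n)"
  shows "red_mat n A \<in> GL2 n"
  using assms cong_imp_coprime[OF cong_sym[OF det_red_mat[of n A]]] by (simp add: GL2_eq)

lemma red_mat_cong:
  "(\<And>i j. [A $ i $ j = B $ i $ j] (mod int n)) \<Longrightarrow> red_mat n A = red_mat n B"
  by (simp add: red_mat_def Cong.cong_def)

lemma GL2_hatD:
  assumes "M \<in> GL2_hat" "n > 0"
  shows "M n \<in> GL2 n" "d dvd n \<Longrightarrow> red_mat d (M n) = M d"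
  using assms by (auto simp: GL2_hat_def)

text \<open>With \<open>e\<close> the idempotent that is 1 at the primes dividing \<open>m\<close> and 0 elsewhere,
  \<open>1 + e (A - 1)\<close> lifts \<open>A\<close>.\<close>

lemma GL2_hat_lift:
  assumes m: "m > 0" and A: "A \<in> GL2 m"
  obtains M where "M \<in> GL2_hat" "M m = A"
proof -
  define n1 n2 where "n1 n = gcd_inf n m" and "n2 n = n div gcd_inf n m" for n
  have "\<exists>e. [e = 1] (mod int (n1 n)) \<and> [e = 0] (mod int (n2 n))" if "n > 0" for n
    using binary_chinese_remainder_int[of "int (n1 n)" "int (n2 n)" 1 0] gcd_inf_props(6)[OF that, of m]
    by (simp add: n1_def n2_def)
  then obtain e where e: "\<And>n. n > 0 \<Longrightarrow> [e n = 1] (mod int (n1 n))" "\<And>n. n > 0 \<Longrightarrow> [e n = 0] (mod int (n2 n))"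
    by metis
  define B where "B t = mat 1 + (\<chi> i j. t * (A $ i $ j - mat 1 $ i $ j))" for t :: int
  have B_cong: "[B t $ i $ j = B u $ i $ j] (mod k)" if "[t = u] (mod k)" for t u k i j
    unfolding B_def using that by (auto intro!: cong_add cong_mult)
  have det_cong: "[det (B t) = det (B u)] (mod k)" if "[t = u] (mod k)" for t u k
    unfolding det_2 using B_cong[OF that] by (intro cong_diff cong_mult)
  have B1: "B 1 = A" and B0: "B 0 = mat 1"
    by (simp_all add: B_def vec_eq_iff)
  define M where "M = restrict (\<lambda>n. red_mat n (B (e n))) {0<..}"
  have M: "M n = red_mat n (B (e n))" if "n > 0" for n using that by (simp add: M_def)
  have GL: "M n \<in> GL2 n" if n: "n > 0" for n
  proof -
    have "coprime (det A) (int (n1 n))"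
      unfolding n1_def
    proof (rule coprime_if_primes_dvd)
      show "coprime (det A) (int m)" using A by (simp add: GL2_eq)
    qed (rule gcd_inf_props[OF n]; assumption?)+
    then have "coprime (det (B (e n))) (int (n1 n))"
      using det_cong[OF e(1)[OF n]] B1 by (metis cong_imp_coprime cong_sym)
    moreover have "coprime (det (B (e n))) (int (n2 n))"
      using det_cong[OF e(2)[OF n]] B0 by (metis cong_imp_coprime cong_sym coprime_1_left det_I)
    moreover have "int n = int (n1 n) * int (n2 n)"
      using gcd_inf_props(7)[OF n, of m] by (simp add: n1_def n2_def flip: of_nat_mult)
    ultimately show ?thesis unfolding M[OF n] using n by (intro red_mat_in_GL2) simp_all
  qed
  have comp: "red_mat d (M n) = M d" if n: "n > 0" and d: "d dvd n" for n d
  proof -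
    have d0: "d > 0" using d n by (auto intro!: Nat.gr0I)
    \<comment> \<open>Compatibility: the two parts of d divide the corresponding parts of n, so the
      idempotents for n and d agree modulo both parts and hence modulo d.\<close>
    have "n1 d dvd n1 n"
      unfolding n1_def using gcd_inf_props(1)[OF d0, of m] gcd_inf_props(2)[OF d0, of _ m] d by (intro gcd_inf_props(5)[OF n]) (auto intro: dvd_trans)
    have "n2 d dvd n2 n"
    proof -
      have "coprime (n2 d) m" using gcd_inf_props(3)[OF d0] by (simp add: n2_def)
      have "coprime (int (n2 d)) (int (n1 n))"
        unfolding n1_def
      proof (rule coprime_if_primes_dvd)
        show "coprime (int (n2 d)) (int m)" using \<open>coprime (n2 d) m\<close> by simp
      qed (rule gcd_inf_props[OF n]; assumption?)+
      then have "coprime (n2 d) (n1 n)" by simp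
      moreover have "n2 d dvd n1 n * n2 n"
        using d gcd_inf_props(7)[OF n, of m] gcd_inf_props(7)[OF d0, of m]
        by (metis n1_def n2_def dvd_trans dvd_triv_right)
      ultimately show ?thesis by (simp add: coprime_dvd_mult_right_iff)
    qed
    have "[e n = e d] (mod int (n1 d))"
      using cong_dvd_modulus[OF e(1)[OF n], of "int (n1 d)"] e(1)[OF d0] \<open>n1 d dvd n1 n\<close>
      by (simp add: Cong.cong_def)
    moreover have "[e n = e d] (mod int (n2 d))"
      using cong_dvd_modulus[OF e(2)[OF n], of "int (n2 d)"] e(2)[OF d0] \<open>n2 d dvd n2 n\<close>
      by (simp add: Cong.cong_def)
    ultimately have "[e n = e d] (mod int (n1 d) * int (n2 d))"
      using gcd_inf_props(6)[OF d0, of m] by (intro coprime_cong_mult) (simp_all add: n1_def n2_def)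
    then have "[e n = e d] (mod int d)"
      using gcd_inf_props(7)[OF d0, of m] by (simp add: n1_def n2_def flip: of_nat_mult)
    then have "red_mat d (B (e n)) = red_mat d (B (e d))"
      by (intro red_mat_cong B_cong)
    then show ?thesis unfolding M[OF n] M[OF d0] by (simp add: red_mat_red_mat[OF d])
  qed
  have "M \<in> GL2_hat"
    unfolding GL2_hat_def using GL comp by (auto simp: M_def)
  moreover have "M m = A"
  proof -
    have "m dvd gcd_inf m m" by (rule gcd_inf_props(5)[OF m]) auto
    then have "[e m = 1] (mod int m)"
      using cong_dvd_modulus[OF e(1)[OF m], of "int m"] by (simp add: n1_def)
    then have "red_mat m (B (e m)) = red_mat m (B 1)" by (intro red_mat_cong B_cong)
    then show ?thesis using A by (simp add: M[OF m] B1 red_mat_id GL2_eq)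
  qed
  ultimately show ?thesis by (rule that)
qed

lemma GL2_lift:
  assumes "m > 0" "n > 0" "m dvd n" "A \<in> GL2 m"
  obtains B where "B \<in> GL2 n" "red_mat m B = A"
  using GL2_hat_lift[OF assms(1,4)] GL2_hatD[OF _ assms(2)] assms(3) by metis

lemma eps2_cases: "eps2 A \<in> {1, -1}"
  by (simp add: eps2_def sign_def)

text \<open>Left multiplication by diag(u, 1): a way to change the determinant by u without
  disturbing reductions where u is 1.\<close>

definition scale_row :: "int \<Rightarrow> int^2^2 \<Rightarrow> int^2^2" where
  "scale_row u A = mat4 (u * A $ 1 $ 1) (u * A $ 1 $ 2) (A $ 2 $ 1) (A $ 2 $ 2)"

lemma det_scale_row: "det (scale_row u A) = u * det A"
  by (simp add: scale_row_def det_2[of A] algebra_simps)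

lemma red_mat_scale_row:
  assumes "[u = 1] (mod int n)"
  shows "red_mat n (scale_row u A) = red_mat n A"
proof -
  have "[u * x = x] (mod int n)" for x
    using cong_mult[OF assms cong_refl[of x]] by simp
  then show ?thesis by (intro mat_eqI) (simp_all add: scale_row_def Cong.cong_def)
qed

lemma red_mat_scale_row_inverse:
  assumes "[u * v = 1] (mod int n)" "A \<in> mats n"
  shows "red_mat n (scale_row u (red_mat n (scale_row v A))) = A"
proof -
  have "(u * (v * x mod int n)) mod int n = x mod int n" for x
  proof -
    have "[u * (v * x mod int n) = u * (v * x)] (mod int n)" by (intro cong_mult) simp_all
    also have "u * (v * x) = (u * v) * x" by simp
    also have "[(u * v) * x = 1 * x] (mod int n)" by (intro cong_mult assms(1)) simp
    finally show ?thesis by (simp add: Cong.cong_def)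
  qed
  then have "red_mat n (scale_row u (red_mat n (scale_row v A))) = red_mat n A"
    by (intro mat_eqI) (simp_all add: scale_row_def)
  then show ?thesis by (simp add: red_mat_id[OF assms(2)])
qed

section \<open>Reductions of \<open>H_E\<close> and its level\<close>

context quadratic_discriminant
begin

definition level :: nat where
  "level = lcm 2 (conductor D)"

lemma level_props: "level > 0" "2 dvd level" "conductor D dvd level" "level dvd m \<longleftrightarrow> 2 dvd m \<and> conductor D dvd m"
  using conductor_pos[OF sqf] by (auto simp: level_def lcm_pos_nat)

lemma kronecker_red_mat:
  assumes "conductor D dvd n"
  shows "kronecker D (det (red_mat n A)) = kronecker D (det A)"
  by (rule kronecker_cong[OF sqf cong_dvd_modulus[OF det_red_mat]]) (use assms in simp)

lemma H_E_eq: "H_E a b = {M \<in> GL2_hat. eps2 (M 2) = kronecker D (det (M (conductor D)))}"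
proof -
  have "alpha_E a b (det (M (conductor D)) mod int (conductor D)) = kronecker D (det (M (conductor D)))"
    if "M \<in> GL2_hat" for M
  proof -
    have "coprime (det (M (conductor D))) (int (conductor D))"
      using GL2_hatD(1)[OF that conductor_pos[OF sqf]] by (simp add: GL2_eq)
    then have "det (M (conductor D)) mod int (conductor D) \<in> zmod_units (conductor D)"
      using conductor_pos[OF sqf] by (simp add: zmod_units_def)
    from alpha_E_eq[OF this] show ?thesis
      using kronecker_cong[OF sqf, of "det (M (conductor D)) mod int (conductor D)" "det (M (conductor D))"] by simp
  qed
  then show ?thesis unfolding H_E_def d_E_eq by auto
qed

lemma in_H_E_iff:
  assumes "M \<in> GL2_hat" "n > 0" "level dvd n"
  shows "M \<in> H_E a b \<longleftrightarrow> eps2 (red_mat 2 (M n)) = kronecker D (det (M n))"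
proof -
  have d: "2 dvd n" "conductor D dvd n" using assms(3) level_props(4) by auto
  have "kronecker D (det (M (conductor D))) = kronecker D (det (M n))"
    using kronecker_red_mat[of "conductor D" "M n"] GL2_hatD(2)[OF assms(1,2) d(2)] by simp
  then show ?thesis
    unfolding H_E_eq using assms(1) GL2_hatD(2)[OF assms(1,2) d(1)] by simp
qed

lemma kronecker_det_cases:
  assumes "A \<in> GL2 n" "conductor D dvd n"
  shows "kronecker D (det A) \<in> {1, -1}"
proof (rule kronecker_cases)
  have "coprime (det A) (int n)" using assms(1) by (simp add: GL2_eq)
  moreover have "int (conductor D) dvd int n" using assms(2) by simp
  ultimately show "coprime (det A) (int (conductor D))" by (metis coprime_mult_right_iff dvdE)
qed

lemma red_group_level:
  assumes "m > 0" "level dvd m"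
  shows "red_group (H_E a b) m = {A \<in> GL2 m. eps2 (red_mat 2 A) = kronecker D (det A)}"
proof (intro equalityI subsetI)
  fix A assume "A \<in> red_group (H_E a b) m"
  then obtain M where M: "M \<in> H_E a b" "A = M m" by (auto simp: red_group_def)
  then have "M \<in> GL2_hat" by (simp add: H_E_eq)
  then show "A \<in> {A \<in> GL2 m. eps2 (red_mat 2 A) = kronecker D (det A)}"
    using M in_H_E_iff[OF _ assms] GL2_hatD(1)[OF _ assms(1)] by simp
next
  fix A assume A: "A \<in> {A \<in> GL2 m. eps2 (red_mat 2 A) = kronecker D (det A)}"
  then obtain M where "M \<in> GL2_hat" "M m = A" using GL2_hat_lift[OF assms(1), of A] by auto
  then show "A \<in> red_group (H_E a b) m"
    using A in_H_E_iff[OF _ assms, of M] unfolding red_group_def by force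
qed

text \<open>Lift A to a modulus divisible by the level and repair the defining relation there
  without touching A. For even m the Kronecker symbol is flipped by a unit that is 1 modulo m; for
  odd m the reduction modulo 2 is free.\<close>

lemma red_group_not_level:
  assumes m: "m > 0" and nl: "\<not> level dvd m"
  shows "red_group (H_E a b) m = GL2 m"
proof (intro equalityI subsetI)
  fix A assume "A \<in> red_group (H_E a b) m"
  then show "A \<in> GL2 m" using GL2_hatD(1)[OF _ m] by (auto simp: red_group_def H_E_eq)
next
  fix A assume A: "A \<in> GL2 m"
  let ?n = "2 * m * conductor D"
  have n: "?n > 0" "m dvd ?n" "level dvd ?n" "2 dvd ?n" "conductor D dvd ?n"
    using m conductor_pos[OF sqf] by (simp_all add: level_props(4))
  obtain B where B: "B \<in> GL2 ?n" "red_mat m B = A" using GL2_lift[OF m n(1,2) A] .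
  have cop_B: "coprime (det B) (int ?n)" using B(1) by (simp add: GL2_eq)
  have "\<exists>B'\<in>GL2 ?n. red_mat m B' = A \<and> eps2 (red_mat 2 B') = kronecker D (det B')"
  proof (cases "even m")
    case True
    then have "\<not> conductor D dvd m" using nl level_props(4) by simp
    then obtain u where u: "coprime u m" "coprime u (conductor D)" "[u = 1] (mod m)" "kronecker D (int u) = -1"
      using kronecker_primitive[OF sqf m] by metis
    have u1: "[int u = 1] (mod int m)" using u(3) by (metis cong_int_iff of_nat_1)
    then have u2: "[int u = 1] (mod int 2)" by (rule cong_dvd_modulus) (use True in simp)
    show ?thesis
    proof (cases "eps2 (red_mat 2 B) = kronecker D (det B)")
      case False
      let ?B = "red_mat ?n (scale_row (int u) B)"
      have "coprime u 2" using u(1) True by (metis coprime_mult_right_iff dvdE)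
      then have "coprime (int u) (int ?n)" using u(1,2) by simp
      then have GL: "?B \<in> GL2 ?n"
        using cop_B by (intro red_mat_in_GL2 n(1)) (simp add: det_scale_row)
      have "coprime (det B) (int (conductor D))" using cop_B by simp
      then have "kronecker D (det ?B) = - kronecker D (det B)"
        using u(2,4) by (simp add: kronecker_red_mat[OF n(5)] det_scale_row kronecker_mult)
      moreover have "red_mat 2 ?B = red_mat 2 B" "red_mat m ?B = A"
        using red_mat_scale_row[OF u2] red_mat_scale_row[OF u1] B(2)
        by (simp_all add: red_mat_red_mat[OF n(4)] red_mat_red_mat[OF n(2)])
      moreover have "eps2 (red_mat 2 B) = - kronecker D (det B)"
        using False eps2_cases[of "red_mat 2 B"] kronecker_det_cases[OF B(1) n(5)] by auto
      ultimately show ?thesis using GL by (intro bexI[of _ ?B]) simp_all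
    qed (use B in blast)
  next
    case False
    \<comment> \<open>\<open>n1\<close> is the 2-part of the modulus and m divides
      \<open>n2\<close>, so B may be replaced at \<open>n1\<close> alone.\<close>
    define n1 n2 where "n1 = gcd_inf ?n 2" and "n2 = ?n div gcd_inf ?n 2"
    note props = gcd_inf_props[OF n(1), where n = 2, folded n1_def n2_def]
    have n12: "n1 * n2 = ?n" "coprime n1 n2" "n1 > 0" "n2 > 0" "2 dvd n1"
    proof -
      show "2 dvd n1"
        unfolding n1_def by (rule gcd_inf_props(5)[OF n(1,4)])
      show 1: "n1 * n2 = ?n" by (rule props(7))
      show "n2 > 0" using 1 n(1) by (metis mult_is_0 neq0_conv)
      show "coprime n1 n2" "n1 > 0" by (rule props)+
    qed
    have "coprime (int m) (int n1)"
    proof (rule coprime_if_primes_dvd)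
      show "coprime (int m) (int 2)" using False by simp
    qed (rule props; assumption?)+
    then have "coprime m n1" by simp
    then have "m dvd n2" using n(2) unfolding n12(1)[symmetric] by (simp add: coprime_dvd_mult_right_iff)
    define k where "k = det B"
    \<comment> \<open>Both choices have determinant k, so the Kronecker symbol is unchanged; modulo
      2 they are the identity and a transposition.\<close>
    define X where "X = (if kronecker D k = 1 then mat4 k 0 0 1 else mat4 0 (- k) 1 0)"
    have det_X: "det X = k" by (simp add: X_def)
    have "odd k" using cop_B by (auto simp: k_def coprime_mult_right_iff)
    have eps_X: "eps2 (red_mat 2 X) = kronecker D k"
    proof -
      have "k mod 2 = 1" "(- k) mod 2 = 1" using \<open>odd k\<close> by presburger+
      then show ?thesis
        using eps2_values kronecker_det_cases[OF B(1) n(5)] by (auto simp: X_def red_mat_mat4 k_def)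
    qed
    have "(red_mat n1 X, red_mat n2 B) \<in> mats n1 \<times> mats n2" using n12 by simp
    then have "(red_mat n1 X, red_mat n2 B) \<in> (\<lambda>A. (red_mat n1 A, red_mat n2 A)) ` mats ?n"
      using bij_betw_imp_surj_on[OF bij_betw_mats_coprime[OF n12(2-4)]] unfolding n12(1) by simp
    then obtain C where C: "C \<in> mats ?n" "red_mat n1 C = red_mat n1 X" "red_mat n2 C = red_mat n2 B"
      by auto
    have "[det C = k] (mod int n1)" "[det C = k] (mod int n2)"
      using det_red_mat[of n1 C] det_red_mat[of n1 X] det_red_mat[of n2 C] det_red_mat[of n2 B]
      unfolding C(2,3) det_X k_def[symmetric] by (metis cong_sym cong_trans)+
    then have "[det C = k] (mod int n1 * int n2)" using n12(2) by (intro coprime_cong_mult) simp_all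
    then have det_C: "[det C = k] (mod int ?n)" unfolding n12(1)[symmetric] by simp
    then have "coprime (det C) (int ?n)" using cop_B by (metis k_def cong_imp_coprime cong_sym)
    then have "C \<in> GL2 ?n" using C(1) by (simp add: GL2_eq)
    moreover have "red_mat m C = A"
      using C(3) B(2) \<open>m dvd n2\<close> by (metis red_mat_red_mat)
    moreover have "red_mat 2 C = red_mat 2 X"
      using C(2) n12(5) by (metis red_mat_red_mat)
    moreover have "kronecker D (det C) = kronecker D k"
      by (rule kronecker_cong[OF sqf cong_dvd_modulus[OF det_C]]) (use n(5) in simp)
    ultimately show ?thesis using eps_X by (intro bexI[of _ C]) simp_all
  qed
  then obtain B' where B': "B' \<in> GL2 ?n" "red_mat m B' = A" "eps2 (red_mat 2 B') = kronecker D (det B')" by blast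
  obtain M where M: "M \<in> GL2_hat" "M ?n = B'" using GL2_hat_lift[OF n(1) B'(1)] .
  have "M \<in> H_E a b" using in_H_E_iff[OF M(1) n(1,3)] M(2) B'(3) by simp
  moreover have "M m = A" using GL2_hatD(2)[OF M(1) n(1,2)] M(2) B'(2) by simp
  ultimately show "A \<in> red_group (H_E a b) m" unfolding red_group_def by blast
qed

text \<open>If n works but is not divisible by \<open>level\<close>, the reduction modulo n is
  everything, and \<open>H_E\<close> would be the whole of \<open>GL2_hat\<close>. A single matrix
  refutes this.\<close>

theorem adelic_level_eq: "adelic_level (H_E a b) = level"
  unfolding adelic_level_def
proof (rule Least_equality)
  have "M \<in> H_E a b \<longleftrightarrow> M \<in> GL2_hat \<and> M level \<in> red_group (H_E a b) level" for M
    unfolding red_group_level[OF level_props(1) dvd_refl]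
    using in_H_E_iff[OF _ level_props(1) dvd_refl] GL2_hatD(1)[OF _ level_props(1)] by (auto simp: H_E_eq)
  then show "level > 0 \<and> H_E a b = {M \<in> GL2_hat. M level \<in> red_group (H_E a b) level}"
    using level_props(1) by blast
next
  fix n assume n: "0 < n \<and> H_E a b = {M \<in> GL2_hat. M n \<in> red_group (H_E a b) n}"
  have "level dvd n"
  proof (rule ccontr)
    assume "\<not> level dvd n"
    then have "red_group (H_E a b) n = GL2 n" using n by (intro red_group_not_level) auto
    then have all: "H_E a b = GL2_hat" using n GL2_hatD(1)[of _ n] by auto
    \<comment> \<open>Determinant 1 makes the Kronecker symbol 1, while the reduction modulo 2 is a
      transposition.\<close>
    let ?A = "red_mat level (mat4 0 (-1) 1 0)"
    have "?A \<in> GL2 level" by (rule red_mat_in_GL2[OF level_props(1)]) simp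
    then obtain M where M: "M \<in> GL2_hat" "M level = ?A" using GL2_hat_lift[OF level_props(1)] by blast
    then have "eps2 (red_mat 2 ?A) = kronecker D (det ?A)"
      using in_H_E_iff[OF M(1) level_props(1) dvd_refl] all by simp
    moreover have "eps2 (red_mat 2 ?A) = -1"
    proof -
      have "red_mat 2 ?A = red_mat 2 (mat4 0 (-1) 1 0)" by (rule red_mat_red_mat[OF level_props(2)])
      then show ?thesis by (simp add: red_mat_mat4 eps2_values)
    qed
    moreover have "kronecker D 1 = 1"
    proof -
      have "kronecker D (1 * 1) = kronecker D 1 * kronecker D 1" by (rule kronecker_mult) simp_all
      then show ?thesis using kronecker_cases[of 1 D] by auto
    qed
    then have "kronecker D (det ?A) = 1" by (simp add: kronecker_red_mat[OF level_props(3)])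
    ultimately show False by simp
  qed
  then show "level \<le> n" using n by (auto intro: dvd_imp_le)
qed

section \<open>The entanglement character\<close>

text \<open>For m divisible by the level, this is the sign character on \<open>GL2 m\<close> whose
  kernel is the reduction of \<open>H_E\<close>.\<close>

definition entangle :: "int^2^2 \<Rightarrow> int" where
  "entangle A = eps2 (red_mat 2 A) * kronecker D (det A)"

text \<open>Scaling a row by a unit that is 1 modulo 2 and has Kronecker symbol -1 permutes the
  group and negates every term.\<close>

lemma sum_GL2_entangle:
  assumes m: "m > 0" "level dvd m" and "D \<noteq> 1"
  shows "(\<Sum>A\<in>GL2 m. entangle A) = 0"
proof -
  have even_m: "2 dvd m" "conductor D dvd m" using m(2) level_props(4) by auto
  \<comment> \<open>A conductor that is not a multiple of 4 is the absolute value of D with D = 1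
    modulo 4; at most 2, it leaves only D = 1.\<close>
  have "\<not> conductor D dvd 2"
  proof
    assume c: "conductor D dvd 2"
    then have le: "conductor D \<le> 2" by (rule dvd_imp_le) simp
    have "D \<noteq> 0" using sqf by auto
    then have "D mod 4 = 1" using le by (auto simp: conductor_def split: if_splits)
    moreover from this le have "- 2 \<le> D" "D \<le> 2" by (auto simp: conductor_def)
    ultimately show False using \<open>D \<noteq> 1\<close> by presburger
  qed
  then obtain u0 where u0: "coprime u0 2" "coprime u0 (conductor D)" "[u0 = 1] (mod 2)" "kronecker D (int u0) = -1"
    using kronecker_primitive[OF sqf, of 2] by auto
  define m1 m2 where "m1 = gcd_inf m level" and "m2 = m div gcd_inf m level"
  note props = gcd_inf_props[OF m(1), where n = level, folded m1_def m2_def]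
  \<comment> \<open>\<open>u0\<close> is a unit modulo the level only; prescribing 1 modulo the
    coprime part \<open>m2\<close> makes it a unit modulo m.\<close>
  obtain u where u: "[u = int u0] (mod int level)" "[u = 1] (mod int m2)"
    using binary_chinese_remainder_int[of "int level" "int m2" "int u0" 1] props(3) by (auto simp: coprime_commute)
  have "coprime (int u0) (int level)"
  proof (rule coprime_if_primes_dvd[of _ "2 * conductor D"])
    show "coprime (int u0) (int (2 * conductor D))" using u0(1,2) by simp
    show "p dvd 2 * conductor D" if "p dvd level" for p
      using that unfolding level_def by (meson dvd_lcmI1 dvd_trans lcm_least dvd_triv_left dvd_triv_right)
  qed (rule level_props(1))
  then have "coprime u (int level)" using u(1) by (metis cong_imp_coprime cong_sym)
  then have "coprime u (int m1)" by (rule coprime_if_primes_dvd) (rule props; assumption?)+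
  moreover have "coprime u (int m2)" using u(2) by (metis cong_imp_coprime cong_sym coprime_1_left)
  ultimately have um: "coprime u (int m)" using props(7) by (metis coprime_mult_right_iff of_nat_mult)
  then obtain v where v: "[u * v = 1] (mod int m)" using cong_solve_coprime_int by blast
  have vu: "[v * u = 1] (mod int m)" using v by (simp add: mult.commute)
  have vm: "coprime v (int m)" using v by (metis cong_imp_coprime cong_sym coprime_1_left coprime_mult_left_iff)
  have u2: "[u = 1] (mod int 2)"
  proof -
    have "[u = int u0] (mod int 2)" by (rule cong_dvd_modulus[OF u(1)]) (use level_props(2) in presburger)
    moreover have "[int u0 = int 1] (mod int 2)" using u0(3) by (simp only: cong_int_iff)
    ultimately show ?thesis by (metis cong_trans of_nat_1)
  qed
  have ku: "kronecker D u = -1"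
    using kronecker_cong[OF sqf cong_dvd_modulus[OF u(1)]] level_props(3) u0(4) by simp
  have uc: "coprime u (int (conductor D))"
    using um even_m(2) by (metis coprime_mult_right_iff dvdE of_nat_mult)
  define \<phi> where "\<phi> t A = red_mat m (scale_row t A)" for t A
  have maps: "\<phi> t A \<in> GL2 m" if "coprime t (int m)" "A \<in> GL2 m" for t A
    unfolding \<phi>_def using that m(1) by (intro red_mat_in_GL2) (simp_all add: det_scale_row GL2_eq)
  have flip: "entangle (\<phi> u A) = - entangle A" if A: "A \<in> GL2 m" for A
  proof -
    have "coprime (det A) (int (conductor D))"
      using A even_m(2) by (metis (mono_tags, lifting) GL2_eq coprime_mult_right_iff dvdE mem_Collect_eq of_nat_mult)
    then have "kronecker D (det (\<phi> u A)) = - kronecker D (det A)"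
      unfolding \<phi>_def kronecker_red_mat[OF even_m(2)] det_scale_row by (simp add: kronecker_mult[OF uc] ku)
    moreover have "red_mat 2 (\<phi> u A) = red_mat 2 A"
      unfolding \<phi>_def red_mat_red_mat[OF even_m(1)] by (rule red_mat_scale_row[OF u2])
    ultimately show ?thesis by (simp add: entangle_def)
  qed
  have "(\<Sum>A\<in>GL2 m. entangle A) = (\<Sum>A\<in>GL2 m. entangle (\<phi> u A))"
  proof (rule sum.reindex_bij_witness[where i = "\<phi> u" and j = "\<phi> v"])
    fix A assume A: "A \<in> GL2 m"
    show "\<phi> u (\<phi> v A) = A" "\<phi> v (\<phi> u A) = A"
      unfolding \<phi>_def using A red_mat_scale_row_inverse[OF v] red_mat_scale_row_inverse[OF vu] by (auto simp: GL2_eq)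
    then show "entangle (\<phi> u (\<phi> v A)) = entangle A" by simp
    show "\<phi> v A \<in> GL2 m" "\<phi> u A \<in> GL2 m" by (rule maps; fact)+
  qed
  also have "\<dots> = - (\<Sum>A\<in>GL2 m. entangle A)" by (simp add: flip sum_negf)
  finally show ?thesis by simp
qed

end

section \<open>The average density\<close>

lemma bij_betw_residues_coprime:
  fixes m n :: nat
  assumes "coprime m n" "m > 0" "n > 0"
  shows "bij_betw (\<lambda>q. (q mod m, q mod n)) {..<m * n} ({..<m} \<times> {..<n})"
proof -
  let ?f = "\<lambda>q. (q mod m, q mod n)"
  have inj: "inj_on ?f {..<m * n}"
  proof (rule inj_onI)
    fix x y assume xy: "x \<in> {..<m * n}" "y \<in> {..<m * n}" "?f x = ?f y"
    then have "[x = y] (mod m * n)"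
      using assms(1) by (intro coprime_cong_mult_nat) (simp_all add: Cong.cong_def)
    then show "x = y" using xy by (simp add: Cong.cong_def)
  qed
  have "?f ` {..<m * n} = {..<m} \<times> {..<n}"
    by (rule card_subset_eq) (use assms in \<open>auto simp: card_image[OF inj] card_cartesian_product\<close>)
  with inj show ?thesis by (simp add: bij_betw_def)
qed

lemma sum_residues_coprime:
  fixes f g :: "nat \<Rightarrow> real"
  assumes "coprime m n" "m > 0" "n > 0"
  shows "(\<Sum>q<m * n. f (q mod m) * g (q mod n)) = (\<Sum>q<m. f q) * (\<Sum>q<n. g q)"
proof -
  have "(\<Sum>q<m. f q) * (\<Sum>q<n. g q) = (\<Sum>(p, q)\<in>{..<m} \<times> {..<n}. f p * g q)"
    by (simp add: sum_product sum.cartesian_product)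
  also have "\<dots> = (\<Sum>q<m * n. f (q mod m) * g (q mod n))"
    unfolding sum.reindex_bij_betw[OF bij_betw_residues_coprime[OF assms], symmetric] by simp
  finally show ?thesis by simp
qed

lemma sum_residues_prod:
  fixes w :: "nat \<Rightarrow> nat \<Rightarrow> real"
  assumes "finite S" "\<And>l. l \<in> S \<Longrightarrow> prime l"
  shows "(\<Sum>q<(\<Prod>l\<in>S. l ^ e l). \<Prod>l\<in>S. w l (q mod l ^ e l)) = (\<Prod>l\<in>S. \<Sum>q<l ^ e l. w l q)"
  using assms
proof (induction S)
  case empty
  then show ?case by simp
next
  case (insert l S)
  let ?n = "\<Prod>l\<in>S. l ^ e l"
  have pos: "l ^ e l > 0" "?n > 0"
    using insert.prems by (auto intro!: prod_pos simp: prime_gt_0_nat)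
  have cop: "coprime (l ^ e l) ?n"
    using insert.hyps insert.prems
    by (intro prod_coprime_right) (auto simp: coprime_power_left_iff coprime_power_right_iff intro!: primes_coprime)
  define G where "G q = (\<Prod>k\<in>S. w k (q mod k ^ e k))" for q
  have "(\<Prod>k\<in>S. w k (q mod k ^ e k)) = G (q mod ?n)" for q
    unfolding G_def using insert.hyps(1)
    by (intro prod.cong refl arg_cong[where f = "w _"] mod_mod_cancel[symmetric] dvd_prodI) auto
  then have "(\<Sum>q<(\<Prod>k\<in>insert l S. k ^ e k). \<Prod>k\<in>insert l S. w k (q mod k ^ e k)) =
      (\<Sum>q<l ^ e l * ?n. w l (q mod l ^ e l) * G (q mod ?n))"
    using insert.hyps by simp
  also have "\<dots> = (\<Sum>q<l ^ e l. w l q) * (\<Sum>q<?n. G q)"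
    by (rule sum_residues_coprime[OF cop pos])
  also have "(\<Sum>q<?n. G q) = (\<Prod>k\<in>S. \<Sum>q<k ^ e k. w k q)"
    unfolding G_def using insert by simp
  finally show ?case using insert.hyps by simp
qed

text \<open>\<open>C_div\<close> sums over 1..M, whereas Chinese remaindering uses 0..M-1; the ends
  agree modulo M.\<close>

lemma sum_shift_residues:
  fixes f :: "nat \<Rightarrow> real"
  assumes "f M = f 0" "M > 0"
  shows "(\<Sum>q\<in>{1..M}. f q) = (\<Sum>q<M. f q)"
proof -
  have "{1..M} = insert M {1..<M}" "{..<M} = insert 0 {1..<M}" using assms(2) by auto
  then show ?thesis using assms(1) by simp
qed

section \<open>Sums over the units modulo \<open>mbar m\<close>\<close>

definition half_exponent :: "nat \<Rightarrow> nat \<Rightarrow> nat" where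
  "half_exponent l m = (multiplicity l m + 1) div 2"

lemma multiplicity_pos_prime_factors:
  "l \<in> prime_factors (m :: nat) \<Longrightarrow> multiplicity l m > 0"
  by (simp add: prime_factors_multiplicity)

lemma coprime_prod_iff:
  fixes q :: "'a :: semiring_gcd"
  shows "finite S \<Longrightarrow> coprime q (\<Prod>l\<in>S. f l) \<longleftrightarrow> (\<forall>l\<in>S. coprime q (f l))"
  by (induction S rule: finite_induct) auto

lemma coprime_mbar_iff:
  "coprime q (mbar m) \<longleftrightarrow> (\<forall>l\<in>prime_factors m. \<not> l dvd q)"
proof -
  have "coprime q (mbar m) \<longleftrightarrow> (\<forall>l\<in>prime_factors m. coprime q (l ^ half_exponent l m))"
    unfolding mbar_def half_exponent_def by (rule coprime_prod_iff) simp
  also have "\<dots> \<longleftrightarrow> (\<forall>l\<in>prime_factors m. \<not> l dvd q)"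
  proof (intro ball_cong refl)
    fix l assume l: "l \<in> prime_factors m"
    then have "prime l" "half_exponent l m > 0"
      using multiplicity_pos_prime_factors[OF l] by (auto simp: half_exponent_def)
    then show "coprime q (l ^ half_exponent l m) \<longleftrightarrow> \<not> l dvd q"
      by (metis coprime_commute coprime_power_right_iff prime_imp_coprime coprime_absorb_left not_prime_unit neq0_conv)
  qed
  finally show ?thesis .
qed

text \<open>Coprimality to \<open>mbar m\<close> is a condition at each prime; as a factor 0 or 1 of
  the local weight it lets the sum factor.\<close>

lemma sum_coprime_mbar:
  assumes "\<And>l q. l \<in> prime_factors m \<Longrightarrow> g l (q mod l ^ half_exponent l m) = g l q"
  shows "(\<Sum>q | 1 \<le> q \<and> q \<le> mbar m \<and> coprime q (mbar m). \<Prod>l\<in>prime_factors m. g l q) =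
    (\<Prod>l\<in>prime_factors m. \<Sum>q<l ^ half_exponent l m. if l dvd q then 0 else g l q :: real)"
proof -
  let ?M = "mbar m"
  define w where "w l q = (if l dvd q then 0 else g l q)" for l q
  have M: "?M = (\<Prod>l\<in>prime_factors m. l ^ half_exponent l m)"
    by (simp add: mbar_def half_exponent_def)
  have M0: "?M > 0" unfolding M by (auto intro!: prod_pos simp: prime_gt_0_nat in_prime_factors_iff)
  have w: "w l (q mod l ^ half_exponent l m) = w l q" if l: "l \<in> prime_factors m" for l q
  proof -
    have "half_exponent l m > 0"
      using multiplicity_pos_prime_factors[OF l] by (simp add: half_exponent_def)
    then have "l dvd l ^ half_exponent l m" by simp
    then show ?thesis using assms[OF l] by (simp add: w_def dvd_mod_iff)
  qed
  have "(\<Sum>q | 1 \<le> q \<and> q \<le> ?M \<and> coprime q ?M. \<Prod>l\<in>prime_factors m. g l q) =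
      (\<Sum>q\<in>{1..?M}. \<Prod>l\<in>prime_factors m. w l (q mod l ^ half_exponent l m))"
  proof (rule sum.mono_neutral_cong_left)
    show "\<forall>q\<in>{1..?M} - {q. 1 \<le> q \<and> q \<le> ?M \<and> coprime q ?M}.
        (\<Prod>l\<in>prime_factors m. w l (q mod l ^ half_exponent l m)) = 0"
    proof
      fix q assume "q \<in> {1..?M} - {q. 1 \<le> q \<and> q \<le> ?M \<and> coprime q ?M}"
      then obtain l where l: "l \<in> prime_factors m" "l dvd q" by (auto simp: coprime_mbar_iff)
      then have "w l (q mod l ^ half_exponent l m) = 0" unfolding w[OF l(1)] by (simp add: w_def)
      then show "(\<Prod>l\<in>prime_factors m. w l (q mod l ^ half_exponent l m)) = 0"
        using l(1) by (intro prod_zero) auto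
    qed
    fix q assume "q \<in> {q. 1 \<le> q \<and> q \<le> ?M \<and> coprime q ?M}"
    then show "(\<Prod>l\<in>prime_factors m. g l q) = (\<Prod>l\<in>prime_factors m. w l (q mod l ^ half_exponent l m))"
      by (intro prod.cong refl) (simp add: w, simp add: w_def coprime_mbar_iff)
  qed auto
  also have "\<dots> = (\<Sum>q<?M. \<Prod>l\<in>prime_factors m. w l (q mod l ^ half_exponent l m))"
  proof (rule sum_shift_residues[OF _ M0])
    have "l ^ half_exponent l m dvd ?M" if "l \<in> prime_factors m" for l
      unfolding M using that by (intro dvd_prodI) auto
    then show "(\<Prod>l\<in>prime_factors m. w l (?M mod l ^ half_exponent l m)) =
      (\<Prod>l\<in>prime_factors m. w l (0 mod l ^ half_exponent l m))"
      by (intro prod.cong refl) (simp add: dvd_imp_mod_0)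
  qed
  also have "\<dots> = (\<Prod>l\<in>prime_factors m. \<Sum>q<l ^ half_exponent l m. w l q)"
    unfolding M by (rule sum_residues_prod) (auto simp: in_prime_factors_iff)
  finally show ?thesis by (simp add: w_def)
qed

lemma sum_units_prime_power:
  assumes l: "prime l" and c: "c > 0"
  shows "(\<Sum>q<l ^ c. if l dvd q then 0 else 1 :: real) = real l ^ (c - 1) * (real l - 1)"
proof -
  have "(\<Sum>q<l ^ c. if l dvd q then 0 else 1 :: real) = real (card {q\<in>{..<l ^ c}. \<not> l dvd q})"
    by (simp add: sum.If_cases Int_def)
  also have "card {q\<in>{..<l ^ c}. \<not> l dvd q} = card (totatives (l ^ c))"
  proof (rule bij_betw_same_card[of id])
    have iff: "coprime q (l ^ c) \<longleftrightarrow> \<not> l dvd q" for q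
      using l c by (metis coprime_commute coprime_power_right_iff prime_imp_coprime coprime_absorb_left not_prime_unit neq0_conv)
    have "{q\<in>{..<l ^ c}. \<not> l dvd q} = totatives (l ^ c)"
    proof (intro equalityI subsetI)
      fix q assume q: "q \<in> totatives (l ^ c)"
      then have "q \<noteq> l ^ c" using iff[of q] c by (auto simp: totatives_def)
      with q show "q \<in> {q\<in>{..<l ^ c}. \<not> l dvd q}" using iff[of q] by (auto simp: totatives_def)
    next
      fix q assume q: "q \<in> {q\<in>{..<l ^ c}. \<not> l dvd q}"
      then have "coprime q (l ^ c)" using iff[of q] by simp
      moreover have "q > 0" using q by (auto intro!: Nat.gr0I)
      ultimately show "q \<in> totatives (l ^ c)" using q unfolding totatives_def by simp
    qed
    then show "bij_betw id {q\<in>{..<l ^ c}. \<not> l dvd q} (totatives (l ^ c))" by simp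
  qed
  also have "\<dots> = totient (l ^ c)" by (simp add: totient_def)
  also have "\<dots> = l ^ (c - 1) * (l - 1)"
    using totient_prime_power[OF l c] by simp
  also have "real \<dots> = real l ^ (c - 1) * (real l - 1)"
    using prime_gt_0_nat[OF l] by (simp add: of_nat_diff Suc_leI)
  finally show ?thesis .
qed

text \<open>The average of the two values of \<open>omega_pp\<close> over the units equals the
  proportion of \<open>Psi\<close> in the full group; both sides are rational functions of l and A =
  l^(j-1).\<close>

lemma sum_omega_pp:
  assumes l: "prime l" and j: "j > 0"
  defines "c \<equiv> (j + 1) div 2"
  shows "(\<Sum>q<l ^ c. if l dvd q then 0 else omega_pp q l j) / (real l ^ (c - 1) * (real l - 1)) =
    real (card (Psi (l ^ j))) / real (card (GL2 (l ^ j)))"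
proof -
  have c: "c > 0" using j by (simp add: c_def)
  have l1: "l > 1" by (rule prime_gt_1_nat[OF l])
  have "l ^ c > 1" by (rule one_less_power[OF l1 c])
  define L where "L = real l"
  have L: "L > 1" using l1 by (simp add: L_def)
  obtain i where i: "j = Suc i" using j by (cases j) auto
  define f where "f = j div 2"
  \<comment> \<open>Ceiling and floor of j/2 add up to j, so A = B F with exponents c - 1 and
    f.\<close>
  have cf: "c - 1 + f = i" using j by (simp add: c_def f_def i)
  define A F B where "A = L ^ i" and "F = L ^ f" and "B = L ^ (c - 1)"
  have pos: "A > 0" "F > 0" "B > 0" using L by (simp_all add: A_def F_def B_def)
  have A_pow: "A ^ 2 = L ^ (2 * i)" "A ^ 3 = L ^ (3 * i)" "A ^ 4 = L ^ (4 * i)"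
    by (simp_all only: A_def power_mult[symmetric] mult.commute[of i])
  have AB: "A = B * F" by (simp add: A_def B_def F_def cf[symmetric] power_add)
  define X Y where "X = 1 / (L ^ (j - 1) * (L - 1))"
    and "Y = (L ^ (f + 1) + L ^ f - 1) / (L ^ (j + f - 1) * (L ^ 2 - 1))"
  have X: "X = 1 / (A * (L - 1))" by (simp add: X_def A_def i)
  have Y: "Y = (F * (L + 1) - 1) / (A * F * (L ^ 2 - 1))"
    by (simp add: Y_def A_def F_def i power_add algebra_simps)
  \<comment> \<open>For q < l^c, only q = 1 is congruent to 1; the weight is the constant X with one
    correction Y - X.\<close>
  have "(\<Sum>q<l ^ c. if l dvd q then 0 else omega_pp q l j) =
      (\<Sum>q<l ^ c. X * (if l dvd q then 0 else 1) + (if q = 1 then Y - X else 0))"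
  proof (intro sum.cong refl)
    fix q assume "q \<in> {..<l ^ c}"
    then have "q mod l ^ c = q" "1 mod l ^ c = 1" using \<open>l ^ c > 1\<close> by (simp_all only: lessThan_iff mod_less)
    then have "[q = 1] (mod l ^ c) \<longleftrightarrow> q = 1" by (simp only: Cong.cong_def)
    moreover have "\<not> l dvd 1" using l1 by simp
    ultimately show "(if l dvd q then 0 else omega_pp q l j) = X * (if l dvd q then 0 else 1) + (if q = 1 then Y - X else 0)"
      unfolding omega_pp_def c_def[symmetric] f_def[symmetric] X_def Y_def L_def by auto
  qed
  also have "\<dots> = X * (B * (L - 1)) + (Y - X)"
    unfolding sum.distrib sum_distrib_left[symmetric] sum_units_prime_power[OF l c]
    using \<open>l ^ c > 1\<close> by (simp add: B_def L_def)
  finally have "(\<Sum>q<l ^ c. if l dvd q then 0 else omega_pp q l j) / (B * (L - 1)) = X + (Y - X) / (B * (L - 1))"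
    using pos L by (simp add: add_divide_distrib)
  also have "Y - X = - 1 / (A * F * (L ^ 2 - 1))"
  proof -
    have "X = F * (L + 1) / (A * F * (L ^ 2 - 1))"
    proof -
      have "L ^ 2 - 1 = (L - 1) * (L + 1)" by (simp add: power2_eq_square algebra_simps)
      moreover have "L - 1 \<noteq> 0" "L + 1 \<noteq> 0" using L by auto
      ultimately show ?thesis using pos by (simp add: X)
    qed
    then show ?thesis unfolding Y by (simp only: diff_divide_distrib[symmetric]) simp
  qed
  also have "X + - 1 / (A * F * (L ^ 2 - 1)) / (B * (L - 1)) = 1 / (A * (L - 1)) - 1 / (A ^ 2 * (L - 1) * (L ^ 2 - 1))"
    unfolding X by (simp add: AB power2_eq_square mult_ac)
  also have "\<dots> = (L * A ^ 3 * (L ^ 2 - 1) - L * A ^ 2) / (L * A ^ 4 * (L - 1) * (L ^ 2 - 1))"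
  proof -
    have "L ^ 2 - 1 \<noteq> 0" using one_less_power[OF L, of 2] by simp
    moreover have "L - 1 \<noteq> 0" "A \<noteq> 0" "L \<noteq> 0" using pos L by auto
    moreover have "1 / (a * b) - 1 / (a ^ 2 * b * c) = (x * a ^ 3 * c - x * a ^ 2) / (x * a ^ 4 * b * c)"
      if "a \<noteq> 0" "b \<noteq> 0" "c \<noteq> 0" "x \<noteq> 0" for a b c x :: real
      using that by (simp add: field_simps power_numeral_reduce)
    ultimately show ?thesis by blast
  qed
  also have "L * A ^ 3 * (L ^ 2 - 1) - L * A ^ 2 = real (card (Psi (l ^ j)))"
  proof -
    have "real_of_int (int l ^ 2 * int (card (Psi (l ^ Suc i)))) =
        real_of_int (int l ^ (3 * Suc i) * (int l ^ 2 - 1) - int l ^ (2 * i + 3))"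
      by (simp only: card_Psi_prime_power[OF l])
    then have "L ^ 2 * real (card (Psi (l ^ j))) = L ^ (3 * Suc i) * (L ^ 2 - 1) - L ^ (2 * i + 3)"
      by (simp add: L_def i)
    also have "\<dots> = L ^ 2 * (L * A ^ 3 * (L ^ 2 - 1) - L * A ^ 2)"
      unfolding A_pow by (simp add: power_add algebra_simps power_numeral_reduce)
    finally show ?thesis using L by simp
  qed
  also have "L * A ^ 4 * (L - 1) * (L ^ 2 - 1) = real (card (GL2 (l ^ j)))"
  proof -
    have "real (card (GL2 (l ^ j))) = real_of_int (int (card (GL2 (l ^ Suc i))))" by (simp add: i)
    also have "\<dots> = L ^ (4 * i) * (L ^ 4 - L ^ 3 - L ^ 2 + L)"
      unfolding card_GL2_prime_power[OF l] by (simp add: L_def)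
    also have "\<dots> = L * A ^ 4 * (L - 1) * (L ^ 2 - 1)"
      unfolding A_pow by (simp add: algebra_simps power_numeral_reduce)
    finally show ?thesis by simp
  qed
  finally show ?thesis by (simp add: B_def L_def)
qed

text \<open>Numerator and totient both factor over the primes, so \<open>C_div\<close> is the
  density that a surjective image modulo m would have.\<close>

theorem C_div_eq_prod:
  "C_div m = (\<Prod>l\<in>prime_factors m. real (card (Psi (l ^ multiplicity l m))) / real (card (GL2 (l ^ multiplicity l m))))"
proof -
  have "real (totient (mbar m)) = (\<Sum>q | 1 \<le> q \<and> q \<le> mbar m \<and> coprime q (mbar m). \<Prod>l\<in>prime_factors m. 1)"
    by (simp add: totient_def totatives_def Suc_le_eq conj_assoc)
  also have "\<dots> = (\<Prod>l\<in>prime_factors m. \<Sum>q<l ^ half_exponent l m. if l dvd q then 0 else 1)"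
    by (rule sum_coprime_mbar) simp
  also have "\<dots> = (\<Prod>l\<in>prime_factors m. real l ^ (half_exponent l m - 1) * (real l - 1))"
    by (intro prod.cong refl sum_units_prime_power)
      (auto simp: half_exponent_def dest: multiplicity_pos_prime_factors)
  finally have tot: "real (totient (mbar m)) = (\<Prod>l\<in>prime_factors m. real l ^ (half_exponent l m - 1) * (real l - 1))" .
  have "(\<Sum>q | 1 \<le> q \<and> q \<le> mbar m \<and> coprime q (mbar m). omega q m) =
      (\<Prod>l\<in>prime_factors m. \<Sum>q<l ^ half_exponent l m. if l dvd q then 0 else omega_pp q l (multiplicity l m))"
    unfolding omega_def by (rule sum_coprime_mbar) (simp add: omega_pp_def half_exponent_def Cong.cong_def)
  then have "C_div m = (\<Prod>l\<in>prime_factors m. (\<Sum>q<l ^ half_exponent l m. if l dvd q then 0 else omega_pp q l (multiplicity l m))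
      / (real l ^ (half_exponent l m - 1) * (real l - 1)))"
    unfolding C_div_def tot by (simp add: prod_dividef)
  also have "\<dots> = (\<Prod>l\<in>prime_factors m. real (card (Psi (l ^ multiplicity l m))) / real (card (GL2 (l ^ multiplicity l m))))"
    unfolding half_exponent_def
    by (intro prod.cong refl sum_omega_pp) (auto dest: multiplicity_pos_prime_factors)
  finally show ?thesis .
qed

section \<open>Serre curves\<close>

lemma prod_prime_powers_dvd_iff:
  assumes "finite S" "\<And>l. l \<in> S \<Longrightarrow> prime l"
  shows "int (\<Prod>l\<in>S. l ^ e l) dvd x \<longleftrightarrow> (\<forall>l\<in>S. int (l ^ e l) dvd x)"
  using assms
proof (induction S)
  case (insert l S)
  have cop: "coprime (l ^ e l) (\<Prod>l\<in>S. l ^ e l)"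
    using insert.hyps insert.prems
    by (intro prod_coprime_right) (auto simp: coprime_power_left_iff coprime_power_right_iff intro!: primes_coprime)
  then have "coprime (int (l ^ e l)) (int (\<Prod>l\<in>S. l ^ e l))" by (simp only: coprime_int_iff)
  then have iff: "int (l ^ e l) * int (\<Prod>l\<in>S. l ^ e l) dvd x \<longleftrightarrow> int (l ^ e l) dvd x \<and> int (\<Prod>l\<in>S. l ^ e l) dvd x"
    by (meson divides_mult dvd_mult_left dvd_mult_right)
  have "int (\<Prod>k\<in>insert l S. k ^ e k) = int (l ^ e l) * int (\<Prod>k\<in>S. k ^ e k)"
    using insert.hyps by simp
  moreover have "int (\<Prod>k\<in>S. k ^ e k) dvd x \<longleftrightarrow> (\<forall>k\<in>S. int (k ^ e k) dvd x)"
    by (rule insert.IH) (use insert.prems in blast)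
  ultimately show ?case using iff by (simp only: ball_simps)
qed simp

lemma prime_powers_decomposition: "m > 0 \<Longrightarrow> (\<Prod>l\<in>prime_factors m. l ^ multiplicity l m) = (m :: nat)"
  by (simp add: prime_factorization_nat[symmetric])

lemma GL2_red_iff:
  assumes m: "m > 0" and A: "A \<in> mats m"
  shows "A \<in> GL2 m \<longleftrightarrow> (\<forall>l\<in>prime_factors m. red_mat (l ^ multiplicity l m) A \<in> GL2 (l ^ multiplicity l m))"
proof -
  define N where "N l = l ^ multiplicity l m" for l
  have "int m = (\<Prod>l\<in>prime_factors m. int (N l))"
    by (simp only: N_def prime_powers_decomposition[OF m] flip: of_nat_prod)
  then have "coprime (det A) (int m) \<longleftrightarrow> (\<forall>l\<in>prime_factors m. coprime (det A) (int (N l)))"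
    by (simp only: coprime_prod_iff finite_set_mset)
  moreover have "coprime (det (red_mat n A)) (int n) \<longleftrightarrow> coprime (det A) (int n)" for n
    using det_red_mat[of n A] by (metis cong_imp_coprime cong_sym)
  moreover have "N l > 0" if "l \<in> prime_factors m" for l
    using that by (auto simp: N_def prime_gt_0_nat in_prime_factors_iff)
  ultimately show ?thesis using A unfolding N_def[symmetric] by (simp add: GL2_eq)
qed

lemma Psi_red_iff:
  assumes m: "m > 0" and A: "A \<in> mats m"
  shows "A \<in> Psi m \<longleftrightarrow> (\<forall>l\<in>prime_factors m. red_mat (l ^ multiplicity l m) A \<in> Psi (l ^ multiplicity l m))"
proof -
  define N where "N l = l ^ multiplicity l m" for l
  have "[det (mat 1 - red_mat n A) = det (mat 1 - A)] (mod int n)" for n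
    unfolding det_2 by (intro cong_diff cong_mult) (simp_all add: Cong.cong_def mod_simps)
  then have "int n dvd det (mat 1 - red_mat n A) \<longleftrightarrow> int n dvd det (mat 1 - A)" for n
    by (rule cong_dvd_iff)
  moreover have "int m dvd det (mat 1 - A) \<longleftrightarrow> (\<forall>l\<in>prime_factors m. int (N l) dvd det (mat 1 - A))"
    using prod_prime_powers_dvd_iff[of "prime_factors m" "\<lambda>l. multiplicity l m" "det (mat 1 - A)"]
    unfolding prime_powers_decomposition[OF m] N_def by (simp only: finite_set_mset in_prime_factors_iff simp_thms)
  moreover have "A \<in> Psi n \<longleftrightarrow> A \<in> GL2 n \<and> int n dvd det (mat 1 - A)" for n A
    by (auto simp: Psi_eq GL2_eq)
  ultimately show ?thesis using GL2_red_iff[OF assms] unfolding N_def[symmetric] by auto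
qed

text \<open>Covers \<open>GL2\<close> and \<open>Psi\<close> alike: membership is a condition at
  each prime power and is absorbed into the local weight as a factor 0 or 1.\<close>

lemma sum_multiplicative_family:
  fixes w :: "nat \<Rightarrow> int^2^2 \<Rightarrow> int"
  assumes m: "m > 0" and sub: "\<And>n. X n \<subseteq> mats n"
    and X: "\<And>A. A \<in> mats m \<Longrightarrow> A \<in> X m \<longleftrightarrow> (\<forall>l\<in>prime_factors m. red_mat (l ^ multiplicity l m) A \<in> X (l ^ multiplicity l m))"
    and w: "\<And>l A. l \<in> prime_factors m \<Longrightarrow> w l (red_mat (l ^ multiplicity l m) A) = w l A"
  shows "(\<Sum>A\<in>X m. \<Prod>l\<in>prime_factors m. w l A) = (\<Prod>l\<in>prime_factors m. \<Sum>A\<in>X (l ^ multiplicity l m). w l A)"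
proof -
  define v where "v l A = (if A \<in> X (l ^ multiplicity l m) then w l A else 0)" for l A
  have "(\<Sum>A\<in>X m. \<Prod>l\<in>prime_factors m. w l A) =
      (\<Sum>A\<in>mats m. \<Prod>l\<in>prime_factors m. v l (red_mat (l ^ multiplicity l m) A))"
  proof (rule sum.mono_neutral_cong_left)
    show "\<forall>A\<in>mats m - X m. (\<Prod>l\<in>prime_factors m. v l (red_mat (l ^ multiplicity l m) A)) = 0"
    proof
      fix A assume "A \<in> mats m - X m"
      then obtain l where l: "l \<in> prime_factors m" "red_mat (l ^ multiplicity l m) A \<notin> X (l ^ multiplicity l m)"
        using X[of A] by auto
      then have "v l (red_mat (l ^ multiplicity l m) A) = 0" by (simp add: v_def)
      then show "(\<Prod>l\<in>prime_factors m. v l (red_mat (l ^ multiplicity l m) A)) = 0"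
        using l(1) by (intro prod_zero) auto
    qed
    fix A assume "A \<in> X m"
    then have "red_mat (l ^ multiplicity l m) A \<in> X (l ^ multiplicity l m)" if "l \<in> prime_factors m" for l
      using X[of A] sub[of m] that by auto
    then show "(\<Prod>l\<in>prime_factors m. w l A) = (\<Prod>l\<in>prime_factors m. v l (red_mat (l ^ multiplicity l m) A))"
      by (intro prod.cong refl) (simp add: v_def w)
  qed (use sub in auto)
  also have "\<dots> = (\<Prod>l\<in>prime_factors m. \<Sum>A\<in>mats (l ^ multiplicity l m). v l A)"
    using sum_mats_prod[of "prime_factors m" v "\<lambda>l. multiplicity l m"]
    unfolding prime_powers_decomposition[OF m] by (simp add: in_prime_factors_iff)
  also have "\<dots> = (\<Prod>l\<in>prime_factors m. \<Sum>A\<in>X (l ^ multiplicity l m). w l A)"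
    unfolding v_def using sub by (intro prod.cong refl sum.mono_neutral_cong_right) auto
  finally show ?thesis .
qed

lemma Psi_subset_GL2: "Psi n \<subseteq> GL2 n"
  by (auto simp: Psi_def)

lemma card_GL2_Psi_prod:
  assumes "m > 0"
  shows "card (GL2 m) = (\<Prod>l\<in>prime_factors m. card (GL2 (l ^ multiplicity l m)))"
    "card (Psi m) = (\<Prod>l\<in>prime_factors m. card (Psi (l ^ multiplicity l m)))"
proof -
  have sub: "GL2 n \<subseteq> mats n" "Psi n \<subseteq> mats n" for n by (auto simp: GL2_eq Psi_eq)
  have "int (card (GL2 m)) = int (\<Prod>l\<in>prime_factors m. card (GL2 (l ^ multiplicity l m)))"
    using sum_multiplicative_family[of m GL2 "\<lambda>_ _. 1", OF assms sub(1) GL2_red_iff[OF assms]] by simp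
  then show "card (GL2 m) = (\<Prod>l\<in>prime_factors m. card (GL2 (l ^ multiplicity l m)))" by (simp only: of_nat_eq_iff)
  have "int (card (Psi m)) = int (\<Prod>l\<in>prime_factors m. card (Psi (l ^ multiplicity l m)))"
    using sum_multiplicative_family[of m Psi "\<lambda>_ _. 1", OF assms sub(2) Psi_red_iff[OF assms]] by simp
  then show "card (Psi m) = (\<Prod>l\<in>prime_factors m. card (Psi (l ^ multiplicity l m)))" by (simp only: of_nat_eq_iff)
qed

lemma C_div_eq: "m > 0 \<Longrightarrow> C_div m = real (card (Psi m)) / real (card (GL2 m))"
  by (simp add: C_div_eq_prod card_GL2_Psi_prod prod_dividef)

lemma prime_factors_gcd_inf:
  fixes l m n :: nat
  assumes m: "m > 0"
  defines "m1 \<equiv> gcd_inf m n" and "m2 \<equiv> m div gcd_inf m n"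
  shows "prime_factors m1 = {l \<in> prime_factors m. l dvd n}" "prime_factors m2 = {l \<in> prime_factors m. \<not> l dvd n}"
    "l \<in> prime_factors m1 \<Longrightarrow> multiplicity l m1 = multiplicity l m"
    "l \<in> prime_factors m2 \<Longrightarrow> multiplicity l m2 = multiplicity l m"
proof -
  note props = gcd_inf_props[OF m, where n = n, folded m1_def m2_def]
  have m2: "m2 > 0" using props(7) m by (auto intro!: Nat.gr0I)
  have not2: "\<not> p dvd m2" if "prime p" "p dvd n" for p
    using that props(3) by (metis coprime_common_divisor not_prime_unit)
  have dvd: "p dvd m \<longleftrightarrow> p dvd m1 \<or> p dvd m2" if "prime p" for p
    using that props(7) prime_dvd_mult_iff by metis
  show pf1: "prime_factors m1 = {l \<in> prime_factors m. l dvd n}"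
    and pf2: "prime_factors m2 = {l \<in> prime_factors m. \<not> l dvd n}"
    using props(2,4) m m2 not2 dvd by (auto simp: in_prime_factors_iff)
  have mult: "multiplicity p m = multiplicity p m1 + multiplicity p m2" if "prime p" for p
    using prime_elem_multiplicity_mult_distrib[of p m1 m2] that props(4,7) m2 by simp
  show "multiplicity l m1 = multiplicity l m" if "l \<in> prime_factors m1"
    using that mult[of l] not2[of l] pf1 by (auto simp: in_prime_factors_iff not_dvd_imp_multiplicity_0)
  show "multiplicity l m2 = multiplicity l m" if "l \<in> prime_factors m2"
  proof -
    have l: "prime l" "\<not> l dvd n" using that pf2 by (auto simp: in_prime_factors_iff)
    then have "\<not> l dvd m1" using props(2) by metis
    then show ?thesis using mult[OF l(1)] by (simp add: not_dvd_imp_multiplicity_0)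
  qed
qed

section \<open>Local factors of the entanglement character and the density\<close>

context quadratic_discriminant
begin

lemma prime_dvd_level_iff:
  assumes l: "prime l"
  shows "l dvd level \<longleftrightarrow> l = 2 \<or> l \<in> odd_primes D"
proof
  assume "l dvd level"
  moreover have "level dvd 2 * conductor D" unfolding level_def by (intro lcm_least) simp_all
  ultimately have "l dvd 2 * conductor D" by (rule dvd_trans)
  then have "l dvd 2 \<or> l dvd conductor_2 D \<or> l dvd (\<Prod>l\<in>odd_primes D. l)"
    using l unfolding conductor_eq[OF sqf] by (simp add: prime_dvd_mult_iff)
  moreover have "l dvd 2 ^ 3" if "l dvd conductor_2 D"
    using that by (rule dvd_trans) (simp add: conductor_2_def)
  moreover have "l = 2" if "l dvd 2"
    using l that by (simp add: primes_dvd_imp_eq)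
  moreover have "l \<in> odd_primes D" if "l dvd (\<Prod>l\<in>odd_primes D. l)"
  proof -
    have "\<exists>k\<in>odd_primes D. l dvd k" using that l by (simp add: prime_dvd_prod_iff)
    then obtain k where k: "k \<in> odd_primes D" "l dvd k" by blast
    then have "l = k" using l odd_primesD(1) by (intro primes_dvd_imp_eq)
    with k show ?thesis by simp
  qed
  ultimately show "l = 2 \<or> l \<in> odd_primes D" using l prime_dvd_power[of l 2 3] by blast
next
  assume "l = 2 \<or> l \<in> odd_primes D"
  then show "l dvd level"
    using level_props(2,3) odd_primes_dvd_conductor[of l D] by (auto intro: dvd_trans)
qed

text \<open>The local components of \<open>entangle\<close>; the sign character, which lives modulo
  2, joins the 2-part of the Kronecker symbol.\<close>

definition local_weight :: "nat \<Rightarrow> int^2^2 \<Rightarrow> int" where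
  "local_weight l A = (if l = 2 then eps2 (red_mat 2 A) * chi2 (two_part D) (det A)
     else if l \<in> odd_primes D then Legendre (det A) (int l) else 1)"

text \<open>When the level divides m, these are the cases in which the local factor at 2
  vanishes.\<close>

definition exceptional :: "nat \<Rightarrow> bool" where
  "exceptional m \<longleftrightarrow> D mod 4 = 3 \<and> multiplicity 2 m = 2 \<or> D mod 4 = 2 \<and> multiplicity 2 m \<in> {3, 4}"

context
  fixes m :: nat
  assumes m: "m > 0" "level dvd m"
begin

lemma two_in: "2 \<in> prime_factors m"
  and odd_primes_sub: "odd_primes D \<subseteq> prime_factors m"
proof -
  show "2 \<in> prime_factors m"
    using m(1) dvd_trans[OF level_props(2) m(2)] by (simp add: in_prime_factors_iff)
  have "l dvd m" if "l \<in> odd_primes D" for l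
    by (rule dvd_trans[OF odd_primes_dvd_conductor[OF that] dvd_trans[OF level_props(3) m(2)]])
  then show "odd_primes D \<subseteq> prime_factors m"
    using m(1) odd_primesD(1) by (auto simp: in_prime_factors_iff)
qed

lemma conductor_2_dvd: "conductor_2 D dvd 2 ^ multiplicity 2 m"
proof -
  have "conductor_2 D dvd m"
    using dvd_trans[OF level_props(3) m(2)] unfolding conductor_eq[OF sqf] by (rule dvd_mult_left)
  moreover have "2 ^ k dvd (2 :: nat) ^ multiplicity 2 m" if "2 ^ k dvd m" for k
    using that m(1) by (intro le_imp_power_dvd) (simp add: power_dvd_iff_le_multiplicity)
  from this[of 2] this[of 3] have "4 dvd m \<Longrightarrow> 4 dvd (2 :: nat) ^ multiplicity 2 m" "8 dvd m \<Longrightarrow> 8 dvd (2 :: nat) ^ multiplicity 2 m"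
    by simp_all
  ultimately show ?thesis by (auto simp: conductor_2_def split: if_splits)
qed

lemma entangle_prod: "entangle A = (\<Prod>l\<in>prime_factors m. local_weight l A)"
proof -
  have "(\<Prod>l\<in>prime_factors m - {2}. local_weight l A) = (\<Prod>l\<in>odd_primes D. Legendre (det A) (int l))"
    using odd_primes_sub odd_primesD(2)[of 2 D]
    by (intro prod.mono_neutral_cong_right) (auto simp: local_weight_def)
  then show ?thesis
    using prod.remove[OF _ two_in, of "\<lambda>l. local_weight l A"]
    by (simp add: entangle_def kronecker_def local_weight_def)
qed

lemma local_weight_red:
  assumes l: "l \<in> prime_factors m"
  shows "local_weight l (red_mat (l ^ multiplicity l m) A) = local_weight l A"
proof -
  let ?n = "l ^ multiplicity l m"
  have ln: "l dvd ?n" using multiplicity_pos_prime_factors[OF l] by simp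
  show ?thesis
  proof (cases "l = 2")
    case True
    have "[det (red_mat ?n A) = det A] (mod int (conductor_2 D))"
      by (rule cong_dvd_modulus[OF det_red_mat]) (use conductor_2_dvd True in presburger)
    then show ?thesis
      using chi2_two_part_cong[OF sqf] red_mat_red_mat[OF ln, of A] True by (simp add: local_weight_def)
  next
    case False
    have "[det (red_mat ?n A) = det A] (mod int l)"
      by (rule cong_dvd_modulus[OF det_red_mat]) (use ln in presburger)
    from Legendre_cong[OF this] show ?thesis using False by (simp add: local_weight_def)
  qed
qed

text \<open>That the level divides m gives the lower bounds on the exponent of 2 under which the
  dyadic sums were evaluated.\<close>

lemma sum_local_weight:
  assumes l: "l \<in> prime_factors m"
  shows "(\<Sum>A\<in>Psi (l ^ multiplicity l m). local_weight l A) =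
    (if l dvd level then if l = 2 \<and> exceptional m then 0 else - (int l ^ (2 * multiplicity l m - 1))
     else int (card (Psi (l ^ multiplicity l m))))"
proof -
  have pl: "prime l" using l by (simp add: in_prime_factors_iff)
  obtain i where i: "multiplicity l m = Suc i"
    using multiplicity_pos_prime_factors[OF l] by (cases "multiplicity l m") auto
  consider "l = 2" | "l \<noteq> 2" "l \<in> odd_primes D" | "l \<noteq> 2" "l \<notin> odd_primes D" by blast
  then show ?thesis
  proof cases
    case 1
    have c: "conductor_2 D dvd 2 ^ Suc i" using conductor_2_dvd i 1 by simp
    have mult: "2 * multiplicity l m - 1 = 2 * i + 1" by (simp add: i)
    have goal: ?thesis if "(\<Sum>A\<in>Psi (2 ^ Suc i). eps2 (red_mat 2 A) * chi2 (two_part D) (det A)) =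
        (if exceptional m then 0 else - (2 ^ (2 * i + 1)))"
      using that 1 level_props(2) unfolding mult unfolding i local_weight_def by simp
    have D4: "D mod 4 = 1 \<or> D mod 4 = 3 \<or> D mod 4 = 2"
      using squarefree_mod_4[OF sqf] by presburger
    then show ?thesis
    proof (elim disjE)
      assume "D mod 4 = 1"
      then show ?thesis
        using sum_Psi_eps2_1[of i] by (intro goal) (simp add: two_part_def exceptional_def)
    next
      assume D: "D mod 4 = 3"
      then have "odd D" by presburger
      then have "2 ^ 2 dvd (2 :: nat) ^ Suc i" using c D by (simp add: conductor_2_def)
      then have "2 \<le> Suc i" by (rule power_dvd_imp_le) simp
      then have "i \<ge> 1" by simp
      then show ?thesis
        using sum_Psi_eps2_minus_1[of i] D i 1 by (intro goal) (simp add: two_part_def exceptional_def)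
    next
      assume D: "D mod 4 = 2"
      then have "even D" by presburger
      then have "2 ^ 3 dvd (2 :: nat) ^ Suc i" using c D by (simp add: conductor_2_def)
      then have "3 \<le> Suc i" by (rule power_dvd_imp_le) simp
      then have "i \<ge> 2" by simp
      moreover have "two_part D \<in> {2, -2}" using D by (simp add: two_part_def)
      ultimately show ?thesis
        using sum_Psi_eps2_2[of i "two_part D"] D i 1 by (intro goal) (simp add: exceptional_def)
    qed
  next
    case 2
    then show ?thesis
      using sum_Psi_Legendre[OF pl odd_primesD(2), of D i] prime_dvd_level_iff[OF pl]
      by (simp add: local_weight_def i del: power_Suc)
  next
    case 3
    then show ?thesis
      using prime_dvd_level_iff[OF pl] by (simp add: local_weight_def)
  qed
qed

lemma sum_Psi_entangle:
  "(\<Sum>A\<in>Psi m. entangle A) = (if exceptional m then 0 else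
     (\<Prod>l\<in>{l \<in> prime_factors m. l dvd level}. - (int l ^ (2 * multiplicity l m - 1))) *
     (\<Prod>l\<in>{l \<in> prime_factors m. \<not> l dvd level}. int (card (Psi (l ^ multiplicity l m)))))"
proof -
  let ?S = "\<lambda>l. \<Sum>A\<in>Psi (l ^ multiplicity l m). local_weight l A"
  have sub: "Psi n \<subseteq> mats n" for n by (auto simp: Psi_eq)
  have "(\<Sum>A\<in>Psi m. entangle A) = (\<Prod>l\<in>prime_factors m. ?S l)"
    unfolding entangle_prod
    by (rule sum_multiplicative_family[of m Psi local_weight, OF m(1) sub Psi_red_iff[OF m(1)] local_weight_red])
  also have "\<dots> = (if exceptional m then 0 else
     (\<Prod>l\<in>{l \<in> prime_factors m. l dvd level}. - (int l ^ (2 * multiplicity l m - 1))) *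
     (\<Prod>l\<in>{l \<in> prime_factors m. \<not> l dvd level}. int (card (Psi (l ^ multiplicity l m)))))"
  proof (cases "exceptional m")
    case True
    then have "?S 2 = 0" using sum_local_weight[OF two_in] level_props(2) by simp
    then have "(\<Prod>l\<in>prime_factors m. ?S l) = 0" using two_in by (intro prod_zero) auto
    then show ?thesis using True by simp
  next
    case False
    have "(\<Prod>l\<in>prime_factors m. ?S l) = (\<Prod>l\<in>prime_factors m. if l dvd level
        then - (int l ^ (2 * multiplicity l m - 1)) else int (card (Psi (l ^ multiplicity l m))))"
      by (intro prod.cong refl) (use sum_local_weight False in simp)
    also have "\<dots> = (\<Prod>l\<in>prime_factors m \<inter> {l. l dvd level}. - (int l ^ (2 * multiplicity l m - 1))) *
        (\<Prod>l\<in>prime_factors m \<inter> - {l. l dvd level}. int (card (Psi (l ^ multiplicity l m))))"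
      by (rule prod.If_cases) simp
    also have "prime_factors m \<inter> {l. l dvd level} = {l \<in> prime_factors m. l dvd level}" by blast
    also have "prime_factors m \<inter> - {l. l dvd level} = {l \<in> prime_factors m. \<not> l dvd level}" by blast
    finally show ?thesis using False by simp
  qed
  finally show ?thesis .
qed

text \<open>1 + \<open>entangle\<close> is twice the indicator of the reduced group. Its sum over
  \<open>GL2 m\<close> shows that the index is 2, and the factors 2 cancel.\<close>

lemma density_level:
  assumes "D \<noteq> 1"
  shows "real (card (red_group (H_E a b) m \<inter> Psi m)) / real (card (red_group (H_E a b) m)) =
    (real (card (Psi m)) + of_int (\<Sum>A\<in>Psi m. entangle A)) / real (card (GL2 m))"
proof -
  let ?G = "red_group (H_E a b) m"
  have G: "?G = {A \<in> GL2 m. eps2 (red_mat 2 A) = kronecker D (det A)}"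
    by (rule red_group_level[OF m])
  have c: "conductor D dvd m" using m(2) level_props(4) by simp
  have ent: "1 + entangle A = (if A \<in> ?G then 2 else 0)" if "A \<in> GL2 m" for A
    using that eps2_cases[of "red_mat 2 A"] kronecker_det_cases[OF that c] by (auto simp: G entangle_def)
  have card: "int (card X) + (\<Sum>A\<in>X. entangle A) = 2 * int (card (?G \<inter> X))" if X: "X \<subseteq> GL2 m" for X
  proof -
    have fin: "finite X" using X by (rule finite_subset) simp
    have "int (card X) + (\<Sum>A\<in>X. entangle A) = (\<Sum>A\<in>X. 1 + entangle A)" by (simp add: sum.distrib)
    also have "\<dots> = (\<Sum>A\<in>X. if A \<in> ?G then 2 else 0)" using X by (intro sum.cong refl ent) auto
    also have "\<dots> = 2 * int (card (?G \<inter> X))" using fin by (simp add: sum.If_cases Int_commute)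
    finally show ?thesis .
  qed
  have "?G \<subseteq> GL2 m" by (auto simp: G)
  then have "?G \<inter> GL2 m = ?G" by blast
  then have "int (card (GL2 m)) = 2 * int (card ?G)"
    using card[of "GL2 m"] sum_GL2_entangle[OF m assms] by simp
  then have 1: "real (card (GL2 m)) = 2 * real (card ?G)" by linarith
  have "real_of_int (int (card (Psi m)) + (\<Sum>A\<in>Psi m. entangle A)) = real_of_int (2 * int (card (?G \<inter> Psi m)))"
    using card[OF Psi_subset_GL2] by simp
  then have 2: "real (card (Psi m)) + of_int (\<Sum>A\<in>Psi m. entangle A) = 2 * real (card (?G \<inter> Psi m))" by simp
  show ?thesis unfolding 1 2 by simp
qed

end

theorem density_formula:
  assumes "m > 0" "D \<noteq> 1"
  defines "C \<equiv> real (card (red_group (H_E a b) m \<inter> Psi m)) / real (card (red_group (H_E a b) m))"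
    and "m1 \<equiv> gcd_inf m level" and "m2 \<equiv> m div gcd_inf m level"
  shows "\<not> level dvd m \<or> exceptional m \<Longrightarrow> C = C_div m"
    "level dvd m \<Longrightarrow> \<not> exceptional m \<Longrightarrow> C = (C_div m1 + (\<Prod>l\<in>prime_factors m1.
        - (real l ^ (2 * multiplicity l m1 - 1)) / real (card (GL2 (l ^ multiplicity l m1))))) * C_div m2"
proof -
  show "C = C_div m" if *: "\<not> level dvd m \<or> exceptional m"
  proof (cases "level dvd m")
    case True
    then show ?thesis
      unfolding C_def density_level[OF assms(1) True assms(2)] sum_Psi_entangle[OF assms(1) True]
      using * assms(1) by (simp add: C_div_eq)
  next
    case False
    have "GL2 m \<inter> Psi m = Psi m" using Psi_subset_GL2[of m] by blast
    then show ?thesis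
      unfolding C_def red_group_not_level[OF assms(1) False] using assms(1) by (simp add: C_div_eq)
  qed
  assume lv: "level dvd m" and ne: "\<not> exceptional m"
  note pf = prime_factors_gcd_inf[OF assms(1), where n = level, folded m1_def m2_def]
  let ?p = "\<lambda>l. real (card (Psi (l ^ multiplicity l m)))" and ?g = "\<lambda>l. real (card (GL2 (l ^ multiplicity l m)))"
    and ?s = "\<lambda>l. - (real l ^ (2 * multiplicity l m - 1))"
  let ?A = "{l \<in> prime_factors m. l dvd level}" and ?B = "{l \<in> prime_factors m. \<not> l dvd level}"
  have split: "(\<Prod>l\<in>prime_factors m. f l) = (\<Prod>l\<in>?A. f l) * (\<Prod>l\<in>?B. f l)" for f :: "nat \<Rightarrow> real"
    by (subst prod.union_disjoint[symmetric]) (auto intro!: prod.cong)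
  have C1: "C_div m1 = (\<Prod>l\<in>?A. ?p l) / (\<Prod>l\<in>?A. ?g l)"
    unfolding C_div_eq_prod prod_dividef[symmetric] by (rule prod.cong) (use pf in auto)
  have C2: "C_div m2 = (\<Prod>l\<in>?B. ?p l) / (\<Prod>l\<in>?B. ?g l)"
    unfolding C_div_eq_prod prod_dividef[symmetric] by (rule prod.cong) (use pf in auto)
  have S1: "(\<Prod>l\<in>prime_factors m1. - (real l ^ (2 * multiplicity l m1 - 1)) / real (card (GL2 (l ^ multiplicity l m1)))) =
      (\<Prod>l\<in>?A. ?s l) / (\<Prod>l\<in>?A. ?g l)"
    unfolding prod_dividef[symmetric] by (rule prod.cong) (use pf in auto)
  \<comment> \<open>Primes outside the level contribute the size of \<open>Psi\<close> to both
    summands, so the factor for \<open>m2\<close> can be taken out.\<close>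
  have "of_int (\<Sum>A\<in>Psi m. entangle A) = (\<Prod>l\<in>?A. ?s l) * (\<Prod>l\<in>?B. ?p l)"
    unfolding sum_Psi_entangle[OF assms(1) lv] using ne by simp
  then have "C = ((\<Prod>l\<in>?A. ?p l) * (\<Prod>l\<in>?B. ?p l) + (\<Prod>l\<in>?A. ?s l) * (\<Prod>l\<in>?B. ?p l)) /
      ((\<Prod>l\<in>?A. ?g l) * (\<Prod>l\<in>?B. ?g l))"
    unfolding C_def density_level[OF assms(1) lv assms(2)] card_GL2_Psi_prod[OF assms(1)] of_nat_prod split by simp
  then show "C = (C_div m1 + (\<Prod>l\<in>prime_factors m1.
        - (real l ^ (2 * multiplicity l m1 - 1)) / real (card (GL2 (l ^ multiplicity l m1))))) * C_div m2"
    unfolding C1 C2 S1 by (simp add: add_divide_distrib[symmetric] distrib_right)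
qed

end

theorem theorem3:
  fixes a b :: int and P Q :: "nat \<Rightarrow> point" and m :: nat
  assumes "Delta a b \<noteq> 0"
    and "tate_basis a b P Q"
    and "serre_curve a b P Q"
    and "m \<ge> 2"
  shows "let mE = adelic_level (G_E a b P Q);
             D' = squarefree_part (Delta a b);
             v = multiplicity 2 m;
             m1 = gcd_inf m mE;
             m2 = m div m1
         in if \<not> mE dvd m
               \<or> (mE dvd m \<and> [D' = 3] (mod 4) \<and> v = 2)
               \<or> (mE dvd m \<and> [D' = 2] (mod 4) \<and> v \<in> {3, 4})
            then C_E_div a b P Q m = C_div m
            else m = m1 * m2 \<and> coprime m2 mE \<and>
                 C_E_div a b P Q m =
                   (C_div m1 + (\<Prod>l\<in>prime_factors m1.
                      - (real l ^ (2 * multiplicity l m1 - 1))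
                        / real (card (GL2 (l ^ multiplicity l m1)))))
                   * C_div m2"
proof -
  define D s where "D = squarefree_part (Delta a b)" and "s = square_part (Delta a b)"
  have Delta: "Delta a b = D * s\<^sup>2" by (simp add: D_def s_def flip: squarefree_decompose)
  interpret quadratic_discriminant a b D s
    using Delta assms(1) by unfold_locales (auto simp: D_def)
  have G: "G_E a b P Q = H_E a b" and nonsquare: "\<nexists>k. Delta a b = k\<^sup>2"
    using assms(3) by (auto simp: serre_curve_def)
  \<comment> \<open>With D = 1 the discriminant would be the square of \<open>s\<close>.\<close>
  have D1: "D \<noteq> 1" using nonsquare Delta by auto
  have m: "m > 0" using assms(4) by simp
  have cond: "\<not> level dvd m \<or> (level dvd m \<and> [D = 3] (mod 4) \<and> multiplicity 2 m = 2)
      \<or> (level dvd m \<and> [D = 2] (mod 4) \<and> multiplicity 2 m \<in> {3, 4}) \<longleftrightarrow> \<not> level dvd m \<or> exceptional m"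
    by (cases "level dvd m") (simp_all add: exceptional_def Cong.cong_def)
  show ?thesis
    unfolding Let_def C_E_div_def G adelic_level_eq D_def[symmetric] cond
    using density_formula[OF m D1] gcd_inf_props(3,7)[OF m, of level] by simp
qed

end
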